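(* Let $\mathcal K=F^{-1}[u,\infty)\subset\mathbb R^K$ be smooth and convex, $\Theta$ symmetric positive definite, and $n\ge0$ an integer. Assume that for some $\beta>0$ the integrals $\int_{\partial\mathcal K}\frac{1}{1+\|z\|^\beta}\mathcal M_j^*(\mathcal K,dz)$ are bounded for all $0\le j\le K$. Then $$\gamma_{\mathbb R^K}\big(\mathcal K\oplus B_{\Theta,\mathbb R^K}(\epsilon)\big)=\mathcal M_0(\mathcal K)+\sum_{l=1}^{n+K}\frac{\epsilon^l}{l!}\mathcal M_l(\mathcal K)+\mathcal R(\mathcal K),$$ where $|\mathcal R(\mathcal K)|\le\frac{\epsilon^{n+2}}{(n+2)!}C(\mathcal K)$ for a constant $C(\mathcal K)$ not depending on $\epsilon$, $\mathcal M_0(\mathcal K)=\int_{\mathcal K}\varphi(x)\,dx=\gamma_{\mathbb R^K}(\mathcal K)$, and for $l\ge1$ $$\mathcal M_l(\mathcal K)=\sum_{m=0}^{l-1}\binom{l-1}{m}(-1)^{l-1-m}\int_{\partial\mathcal K}\frac{\|\Theta^{1/2}\eta_x\|}{\|\eta_x\|}\Big(\frac{\|\Theta\eta_x\|}{\|\Theta^{1/2}\eta_x\|}\Big)^{l-1-m}H_{l-1-m}\Big(\Big\langle x,\frac{\Theta\eta_x}{\|\Theta\eta_x\|}\Big\rangle\Big)\varphi(x)\,\mathcal M^*_{m+1}(\mathcal K,dx),$$ with the convention $\mathcal M_j^*(\mathcal K,\cdot)=0$ for $j>K$. (For $\Theta=D$ these coefficients are the Gaussian Minkowski functionals $\mathcal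 M_l^{\gamma_{\mathbb R^K},D}(\mathcal K)$.)
   Context: $\varphi(x)=(2\pi)^{-K/2}e^{-\|x\|^2/2}$, $\gamma_{\mathbb R^K}$ is the standard Gaussian measure on $\mathbb R^K$, $H_j$ is the probabilists' Hermite polynomial $H_j(x)=(-1)^je^{x^2/2}\frac{d^j}{dx^j}e^{-x^2/2}$. $B_{\Theta,\mathbb R^K}(\epsilon)=\{w:w^T\Theta^{-1}w\le\epsilon^2\}$, $\oplus$ Minkowski sum, $\eta_x=-\nabla F(x)/\|\nabla F(x)\|$ is the outward unit normal at $x\in\partial\mathcal K$, $\|\cdot\|$ the Euclidean norm, $\|v\|_\Theta=\sqrt{v^T\Theta v}$. For $x\in\partial\mathcal K$ choose a frame $E_1,\dots,E_K$ with $E_i^T\Theta^{-1}E_j=\delta_{ij}$, $E_K=\Theta\eta/\|\eta\|_\Theta$, and let $A(x)$ be the $(K-1)\times(K-1)$ matrix $A(x)_{ij}=\|\eta_x\|_\Theta^{-1}\langle\nabla_{E_i}\eta,E_j\rangle|_x$ (Euclidean inner product and differentiation). The measures $\mathcal M_j^*(\mathcal K,\cdot)$ on $\partial\mathcal K$ are $\mathcal M_j^*(\mathcal K,dx)=(j-1)!\,\mathrm{detr}_{j-1}(A(x))\,\mathcal H_{K-1}(dx)$, $1\le j\le K$, where $\mathrm{detr}_j$ is the sum of $j\times j$ principal minors and $\mathcal H_{K-1}$ is $(K-1)$-dimensional Hausdorff measure. $D=\mathrm{diag}(\lambda_1,\dots,\lambda_K)$ with $\lambda_k>0$; the Gaussian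 Minkowski functionals $\mathcal M_l^{\gamma_{\mathbb R^K},D}(\mathcal K)$ are defined as the coefficients of $\epsilon^l/l!$ in the expansion of $\gamma_{\mathbb R^K}(\mathcal K\oplus B_{D,\mathbb R^K}(\epsilon))$.
   Formalization: The remainder bound is stated for 0 < ε ≤ ε0 with some ε0 > 0, since for all ε > 0 it fails (e.g. a half-space through 0 in R^3 with Θ = I, n = 0); the closing remark on Θ = D is not stated separately. *)

theory Defs
  imports "HOL-Analysis.Analysis"
begin

fun Ck :: "nat \<Rightarrow> ('a::euclidean_space \<Rightarrow> real) \<Rightarrow> bool" where
  "Ck 0 f = continuous_on UNIV f"
| "Ck (Suc k) f = ((\<forall>x. f differentiable (at x)) \<and>
      (\<forall>v. Ck k (\<lambda>x. frechet_derivative f (at x) v)))"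

definition smooth_fun :: "('a::euclidean_space \<Rightarrow> real) \<Rightarrow> bool" where
  "smooth_fun f = (\<forall>k. Ck k f)"

definition grad :: "(real^'n \<Rightarrow> real) \<Rightarrow> real^'n \<Rightarrow> real^'n" where
  "grad F x = (\<chi> i. frechet_derivative F (at x) (axis i 1))"

text \<open>outward unit normal of K = F^{-1}[u,inf): eta_x = - grad F x / norm (grad F x)\<close>
definition eta :: "(real^'n \<Rightarrow> real) \<Rightarrow> real^'n \<Rightarrow> real^'n" where
  "eta F x = - (1 / norm (grad F x)) *\<^sub>R grad F x"

definition theta_norm :: "real^'n^'n \<Rightarrow> real^'n \<Rightarrow> real" where
  "theta_norm \<Theta> v = sqrt (v \<bullet> (\<Theta> *v v))"

definition gauss_dens :: "real^'n \<Rightarrow> real" where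
  "gauss_dens x = (2 * pi) powr (- real CARD('n) / 2) * exp (- (norm x)\<^sup>2 / 2)"

definition gauss_measure :: "(real^'n) measure" where
  "gauss_measure = density lborel (\<lambda>x. ennreal (gauss_dens x))"

definition theta_ball :: "real^'n^'n \<Rightarrow> real \<Rightarrow> (real^'n) set" where
  "theta_ball \<Theta> \<epsilon> = {w. w \<bullet> (matrix_inv \<Theta> *v w) \<le> \<epsilon>\<^sup>2}"

definition minkowski_sum :: "(real^'n) set \<Rightarrow> (real^'n) set \<Rightarrow> (real^'n) set" where
  "minkowski_sum A B = {a + b | a b. a \<in> A \<and> b \<in> B}"

definition hermite :: "nat \<Rightarrow> real \<Rightarrow> real" where
  "hermite j x = (-1) ^ j * exp (x\<^sup>2 / 2) * (deriv ^^ j) (\<lambda>t. exp (- t\<^sup>2 / 2)) x"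

section \<open>Hausdorff measure (normalised so that H^d agrees with Lebesgue measure on R^d)\<close>

definition hausdorff_const :: "nat \<Rightarrow> real" where
  "hausdorff_const s = pi powr (real s / 2) / Gamma (real s / 2 + 1) / 2 ^ s"

definition hausdorff_pre :: "nat \<Rightarrow> real \<Rightarrow> 'a::metric_space set \<Rightarrow> ennreal" where
  "hausdorff_pre s \<delta> A =
     (INF C \<in> {C :: nat \<Rightarrow> 'a set. A \<subseteq> (\<Union>i. C i) \<and> (\<forall>i. bounded (C i) \<and> diameter (C i) \<le> \<delta>)}.
        (\<Sum>i. ennreal (if C i = {} then 0 else hausdorff_const s * diameter (C i) ^ s)))"

definition hausdorff_outer :: "nat \<Rightarrow> 'a::metric_space set \<Rightarrow> ennreal" where
  "hausdorff_outer s A = (SUP \<delta> \<in> {0<..}. hausdorff_pre s \<delta> A)"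

definition hausdorff_measure :: "nat \<Rightarrow> ('a::{metric_space, topological_space}) measure" where
  "hausdorff_measure s = measure_of UNIV (sets borel) (hausdorff_outer s)"

definition det_on :: "nat set \<Rightarrow> (nat \<Rightarrow> nat \<Rightarrow> real) \<Rightarrow> real" where
  "det_on S A = (\<Sum>p | p permutes S. of_int (sign p) * (\<Prod>i\<in>S. A i (p i)))"

definition detr :: "nat \<Rightarrow> nat \<Rightarrow> (nat \<Rightarrow> nat \<Rightarrow> real) \<Rightarrow> real" where
  "detr j m A = (\<Sum>S | S \<subseteq> {..<m} \<and> card S = j. det_on S A)"

definition is_frame :: "real^'n^'n \<Rightarrow> real^'n \<Rightarrow> (nat \<Rightarrow> real^'n) \<Rightarrow> bool" where
  "is_frame \<Theta> \<eta> E = ((\<forall>i<CARD('n). \<forall>j<CARD('n).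
        E i \<bullet> (matrix_inv \<Theta> *v E j) = (if i = j then 1 else 0)) \<and>
      E (CARD('n) - 1) = (1 / theta_norm \<Theta> \<eta>) *\<^sub>R (\<Theta> *v \<eta>))"

definition frame :: "real^'n^'n \<Rightarrow> (real^'n \<Rightarrow> real) \<Rightarrow> real^'n \<Rightarrow> nat \<Rightarrow> real^'n" where
  "frame \<Theta> F x = (SOME E. is_frame \<Theta> (eta F x) E)"

definition curv_mat :: "real^'n^'n \<Rightarrow> (real^'n \<Rightarrow> real) \<Rightarrow> real^'n \<Rightarrow> nat \<Rightarrow> nat \<Rightarrow> real" where
  "curv_mat \<Theta> F x i j = (1 / theta_norm \<Theta> (eta F x)) *
      (frechet_derivative (eta F) (at x) (frame \<Theta> F x i) \<bullet> frame \<Theta> F x j)"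

text \<open>density of M_j^*(K, dx) with respect to H_{K-1} on the boundary (j >= 1);
  zero for j > K (convention of the paper)\<close>
definition Mstar_dens :: "real^'n^'n \<Rightarrow> (real^'n \<Rightarrow> real) \<Rightarrow> nat \<Rightarrow> real^'n \<Rightarrow> real" where
  "Mstar_dens \<Theta> F j x =
     (if 1 \<le> j \<and> j \<le> CARD('n)
      then fact (j - 1) * detr (j - 1) (CARD('n) - 1) (curv_mat \<Theta> F x) else 0)"

definition Mstar_int :: "real^'n^'n \<Rightarrow> (real^'n \<Rightarrow> real) \<Rightarrow> real \<Rightarrow> nat \<Rightarrow> (real^'n \<Rightarrow> real) \<Rightarrow> real" where
  "Mstar_int \<Theta> F u j g =
     (LINT x : frontier {y. u \<le> F y} | hausdorff_measure (CARD('n) - 1).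
        g x * Mstar_dens \<Theta> F j x)"

definition M0 :: "(real^'n \<Rightarrow> real) \<Rightarrow> real \<Rightarrow> real" where
  "M0 F u = measure gauss_measure {y. u \<le> F y}"

definition Ml :: "real^'n^'n \<Rightarrow> (real^'n \<Rightarrow> real) \<Rightarrow> real \<Rightarrow> nat \<Rightarrow> real" where
  "Ml \<Theta> F u l = (\<Sum>m = 0..l-1. real (l - 1 choose m) * (-1) ^ (l - 1 - m) *
     Mstar_int \<Theta> F u (m + 1) (\<lambda>x.
        theta_norm \<Theta> (eta F x) / norm (eta F x) *
        (norm (\<Theta> *v eta F x) / theta_norm \<Theta> (eta F x)) ^ (l - 1 - m) *
        hermite (l - 1 - m) (x \<bullet> ((1 / norm (\<Theta> *v eta F x)) *\<^sub>R (\<Theta> *v eta F x))) *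
        gauss_dens x))"

end

theory Submission
  imports Defs "HOL-Probability.Distribution_Functions" "HOL-Probability.Distributions"
begin

text \<open>Put \<open>\<nu> = \<Theta>\<eta> / \<parallel>\<eta>\<parallel>\<^sub>\<Theta>\<close>. The nearest point projection in the metric of \<open>\<Theta>\<^sup>-\<^sup>1\<close> shows that
  \<open>(x, t) \<mapsto> x + t\<nu>(x)\<close> maps \<open>\<partial>K \<times> (0, \<epsilon>]\<close> bijectively onto the part of the enlarged body outside \<open>K\<close>.
  Written in the frame \<open>E\<^sub>i\<close>, the derivative of this map has determinant
  \<open>J(x, t) = \<parallel>\<eta>\<parallel>\<^sub>\<Theta> (\<Sum>j. t^j detr\<^sub>j (A(x)))\<close>, which does not vanish for \<open>t \<ge> 0\<close> because convexity makes \<open>A\<close>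
  positive semidefinite, and hence is positive.

  That Lebesgue measure is the image of \<open>J dH dt\<close> is proved by covering \<open>\<partial>K\<close> with pieces on which the map
  is linear up to a factor close to \<open>1\<close>; on a hyperplane, Hausdorff measure is Lebesgue measure by the
  isodiametric inequality, which follows from the Brunn-Minkowski inequality applied to a set and its reflection in the origin.

  Finally the Gaussian density is expanded along the normals. Its \<open>k\<close>-th derivative at \<open>t = 0\<close> is
  \<open>(-1)^k \<bar>\<nu>\<bar>^k H\<^sub>k(\<langle>x, \<nu>/\<bar>\<nu>\<bar>\<rangle>) \<phi>(x)\<close>, and as \<open>\<nu>\<close> is bounded, the remainder is at most
  \<open>t^P\<close> times a multiple of \<open>1/(1 + \<bar>x\<bar>^\<beta>)\<close>, which is integrable by hypothesis.\<close>

section \<open>Hausdorff measure\<close>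

text \<open>The frame, and with it every entry of A(x), is picked by \<open>SOME\<close> separately
  at each boundary point, so neither continuity nor measurability in x can be read off from
  \<open>curv_mat\<close>. Therefore J is handled as the determinant of the frame-free linear map
  \<open>tubeD\<close>, which is continuous, while measurability of the single curvature densities
  is extracted from the integrability hypothesis. For j = 1 that hypothesis has density 1 and also
  makes the surface measure \<sigma>-finite, as Fubini's theorem on boundary times line requires.
  Each local estimate loses a factor \<kappa> > 1 that does not depend on the piece, so the
  estimates add up over countably many pieces before \<kappa> tends to 1. The orders n + K and n + 2
  fit together as follows. The Gaussian density is expanded to order P = n + K, and J is a
  polynomial of degree less than K in t. The products of t^j and t^k fill the rectangle j < K, k <
  P; the sum over l \<le> P is the triangle j + k < P. What lies outside has order at least
  \<epsilon>^(P + 1), and P + 1 \<ge> n + 2 because K \<ge> 1. Only \<epsilon> \<le> 1 is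
  considered, so that higher powers are absorbed.\<close>

definition hcost :: "nat \<Rightarrow> 'a::metric_space set \<Rightarrow> ennreal" where
  "hcost s C = ennreal (if C = {} then 0 else hausdorff_const s * diameter C ^ s)"

lemma hausdorff_const_nonneg: "0 \<le> hausdorff_const s"
  unfolding hausdorff_const_def by (intro divide_nonneg_nonneg Gamma_real_nonneg) auto

lemma hcost_empty [simp]: "hcost s {} = 0"
  by (simp add: hcost_def)

lemma hcost_mono: "A \<subseteq> B \<Longrightarrow> bounded B \<Longrightarrow> hcost s A \<le> hcost s B"
  unfolding hcost_def
  by (intro ennreal_leI)
    (auto intro!: mult_left_mono power_mono diameter_subset hausdorff_const_nonneg diameter_ge_0
       mult_nonneg_nonneg zero_le_power bounded_subset[of B])

lemma hausdorff_pre_le: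
  assumes "A \<subseteq> (\<Union>i. C i)" "\<And>i. bounded (C i)" "\<And>i. diameter (C i) \<le> \<delta>"
  shows "hausdorff_pre s \<delta> A \<le> (\<Sum>i. hcost s (C i))"
  unfolding hausdorff_pre_def hcost_def using assms by (intro INF_lower) auto

lemma hausdorff_pre_greatest:
  assumes "\<And>C. A \<subseteq> (\<Union>i::nat. C i) \<Longrightarrow> (\<And>i. bounded (C i)) \<Longrightarrow> (\<And>i. diameter (C i) \<le> \<delta>)
     \<Longrightarrow> x \<le> (\<Sum>i. hcost s (C i))"
  shows "x \<le> hausdorff_pre s \<delta> A"
  unfolding hausdorff_pre_def using assms unfolding hcost_def by (intro INF_greatest) auto

lemma hausdorff_pre_mono: "A \<subseteq> B \<Longrightarrow> hausdorff_pre s \<delta> A \<le> hausdorff_pre s \<delta> B"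
  by (rule hausdorff_pre_greatest, rule hausdorff_pre_le) auto

lemma hausdorff_pre_antimono: "\<delta> \<le> \<delta>' \<Longrightarrow> hausdorff_pre s \<delta>' A \<le> hausdorff_pre s \<delta> A"
  by (rule hausdorff_pre_greatest, rule hausdorff_pre_le) (auto intro: order_trans)

lemma hausdorff_pre_empty: "0 \<le> \<delta> \<Longrightarrow> hausdorff_pre s \<delta> {} = 0"
  using hausdorff_pre_le[of "{}" "\<lambda>_. {}" \<delta> s] by simp

lemma hausdorff_pre_approx:
  assumes "hausdorff_pre s \<delta> A < \<infinity>" "0 < e"
  shows "\<exists>C. A \<subseteq> (\<Union>i::nat. C i) \<and> (\<forall>i. bounded (C i)) \<and> (\<forall>i. diameter (C i) \<le> \<delta>) \<and>
     (\<Sum>i. hcost s (C i)) \<le> hausdorff_pre s \<delta> A + ennreal e"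
proof (rule ccontr)
  assume neg: "\<not> ?thesis"
  have "hausdorff_pre s \<delta> A + ennreal e \<le> hausdorff_pre s \<delta> A"
  proof (rule hausdorff_pre_greatest)
    fix C assume C: "A \<subseteq> (\<Union>i::nat. C i)" "\<And>i. bounded (C i)" "\<And>i. diameter (C i) \<le> \<delta>"
    show "hausdorff_pre s \<delta> A + ennreal e \<le> (\<Sum>i. hcost s (C i))"
    proof (rule ccontr)
      assume "\<not> ?thesis"
      then have "(\<Sum>i. hcost s (C i)) \<le> hausdorff_pre s \<delta> A + ennreal e" by simp
      with C have "A \<subseteq> (\<Union>i. C i) \<and> (\<forall>i. bounded (C i)) \<and> (\<forall>i. diameter (C i) \<le> \<delta>) \<and>
        (\<Sum>i. hcost s (C i)) \<le> hausdorff_pre s \<delta> A + ennreal e" by simp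
      then show False using neg by blast
    qed
  qed
  moreover obtain r where "hausdorff_pre s \<delta> A = ennreal r" "0 \<le> r"
    using assms by (cases "hausdorff_pre s \<delta> A") auto
  ultimately show False
    using assms by (simp add: ennreal_plus[symmetric] del: ennreal_plus)
qed

text \<open>Near-optimal covers of the sets \<open>A i\<close>, the i-th with excess
  \<open>e / 2^(i+1)\<close>, are merged into one sequence along the pairing of naturals. An
  infinite summand admits no near-optimal cover, but then the bound is trivial.\<close>

lemma hausdorff_pre_Union:
  assumes "0 \<le> \<delta>"
  shows "hausdorff_pre s \<delta> (\<Union>i::nat. A i) \<le> (\<Sum>i. hausdorff_pre s \<delta> (A i))"
proof (cases "\<forall>i. hausdorff_pre s \<delta> (A i) < \<infinity>")
  case False
  then obtain i where i: "hausdorff_pre s \<delta> (A i) = \<infinity>"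
    by (metis infinity_ennreal_def top.not_eq_extremum)
  have "hausdorff_pre s \<delta> (A i) \<le> (\<Sum>i. hausdorff_pre s \<delta> (A i))"
    using sum_le_suminf[of "\<lambda>i. hausdorff_pre s \<delta> (A i)" "{i}"] by simp
  then show ?thesis using i by (simp add: top_unique)
next
  case True
  show ?thesis
  proof (rule ennreal_le_epsilon)
    fix e :: real assume e: "0 < e"
    have "\<forall>i. \<exists>C. A i \<subseteq> (\<Union>k::nat. C k) \<and> (\<forall>k. bounded (C k)) \<and> (\<forall>k. diameter (C k) \<le> \<delta>) \<and>
       (\<Sum>k. hcost s (C k)) \<le> hausdorff_pre s \<delta> (A i) + ennreal (e * (1/2)^Suc i)"
      using True e by (intro allI hausdorff_pre_approx) auto
    then obtain C where C: "\<And>i. A i \<subseteq> (\<Union>k::nat. C i k)" "\<And>i k. bounded (C i k)"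
      "\<And>i k. diameter (C i k) \<le> \<delta>"
      "\<And>i. (\<Sum>k. hcost s (C i k)) \<le> hausdorff_pre s \<delta> (A i) + ennreal (e * (1/2)^Suc i)"
      by metis
    define D where "D k = (case prod_decode k of (i, j) \<Rightarrow> C i j)" for k
    have "(\<Union>i. A i) \<subseteq> (\<Union>k. D k)"
    proof
      fix x assume "x \<in> (\<Union>i. A i)"
      then obtain i j where "x \<in> C i j" using C(1) by blast
      then have "x \<in> D (prod_encode (i,j))" by (simp add: D_def)
      then show "x \<in> (\<Union>k. D k)" by blast
    qed
    then have "hausdorff_pre s \<delta> (\<Union>i. A i) \<le> (\<Sum>k. hcost s (D k))"
      using C by (intro hausdorff_pre_le) (auto simp: D_def split: prod.split)
    also have "\<dots> = (\<Sum>k. (\<lambda>(i,j). hcost s (C i j)) (prod_decode k))"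
      by (auto simp: D_def split: prod.split intro!: suminf_cong)
    also have "\<dots> = (\<Sum>i. \<Sum>j. hcost s (C i j))"
      by (rule suminf_ennreal_2dimen) auto
    also have "\<dots> \<le> (\<Sum>i. hausdorff_pre s \<delta> (A i) + ennreal (e * (1/2)^Suc i))"
      by (intro suminf_le C) auto
    also have "\<dots> = (\<Sum>i. hausdorff_pre s \<delta> (A i)) + (\<Sum>i. ennreal (e * (1/2)^Suc i))"
      by (intro suminf_add[symmetric]) auto
    also have "(\<Sum>i. ennreal (e * (1/2)^Suc i)) = ennreal e"
      using e sums_mult[OF power_half_series, of e]
      by (intro suminf_ennreal_eq) auto
    finally show "hausdorff_pre s \<delta> (\<Union>i. A i) \<le> (\<Sum>i. hausdorff_pre s \<delta> (A i)) + ennreal e" .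
  qed
qed

lemma hausdorff_pre_le_outer: "0 < \<delta> \<Longrightarrow> hausdorff_pre s \<delta> A \<le> hausdorff_outer s A"
  unfolding hausdorff_outer_def by (rule SUP_upper) auto

lemma hausdorff_outer_least: "(\<And>\<delta>. 0 < \<delta> \<Longrightarrow> hausdorff_pre s \<delta> A \<le> x) \<Longrightarrow> hausdorff_outer s A \<le> x"
  unfolding hausdorff_outer_def by (rule SUP_least) auto

lemma hausdorff_outer_empty [simp]: "hausdorff_outer s {} = 0"
proof -
  have "hausdorff_outer s ({}::'a set) \<le> 0"
    by (rule hausdorff_outer_least) (simp add: hausdorff_pre_empty)
  then show ?thesis by simp
qed

lemma hausdorff_outer_mono:
  assumes "A \<subseteq> B"
  shows "hausdorff_outer s A \<le> hausdorff_outer s B"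
proof (rule hausdorff_outer_least)
  fix \<delta> :: real assume "0 < \<delta>"
  then show "hausdorff_pre s \<delta> A \<le> hausdorff_outer s B"
    by (rule order_trans[OF hausdorff_pre_mono[OF assms] hausdorff_pre_le_outer])
qed

lemma hausdorff_outer_Union:
  "hausdorff_outer s (\<Union>i::nat. A i) \<le> (\<Sum>i. hausdorff_outer s (A i))"
proof (rule hausdorff_outer_least)
  fix \<delta> :: real assume d: "0 < \<delta>"
  have "hausdorff_pre s \<delta> (\<Union>i::nat. A i) \<le> (\<Sum>i. hausdorff_pre s \<delta> (A i))"
    using d by (intro hausdorff_pre_Union) auto
  also have "\<dots> \<le> (\<Sum>i. hausdorff_outer s (A i))"
    by (intro suminf_le hausdorff_pre_le_outer d) auto
  finally show "hausdorff_pre s \<delta> (\<Union>i::nat. A i) \<le> (\<Sum>i. hausdorff_outer s (A i))" .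
qed

lemma hausdorff_outer_Un: "hausdorff_outer s (A \<union> B) \<le> hausdorff_outer s A + hausdorff_outer s B"
proof -
  define C where "C i = (if i = 0 then A else if i = 1 then B else {})" for i :: nat
  have "hausdorff_outer s (A \<union> B) \<le> hausdorff_outer s (\<Union>i. C i)"
    by (intro hausdorff_outer_mono) (force simp: C_def split: if_splits)
  also have "\<dots> \<le> (\<Sum>i. hausdorff_outer s (C i))" by (rule hausdorff_outer_Union)
  also have "\<dots> = (\<Sum>i<2. hausdorff_outer s (C i))"
    by (rule suminf_finite) (auto simp: C_def)
  also have "\<dots> = hausdorff_outer s A + hausdorff_outer s B"
    by (simp add: numeral_2_eq_2 C_def)
  finally show ?thesis .
qed

text \<open>A covering set of diameter less than \<open>d\<close> cannot meet both \<open>A\<close>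
  and \<open>B\<close>, so every fine cover of the union splits into a cover of \<open>A\<close> and
  a cover of \<open>B\<close>.\<close>

lemma hausdorff_outer_Un_separated:
  assumes "0 < d" and sep: "\<And>a b. a \<in> A \<Longrightarrow> b \<in> B \<Longrightarrow> d \<le> dist a b"
  shows "hausdorff_outer s A + hausdorff_outer s B \<le> hausdorff_outer s (A \<union> B)"
proof -
  have small: "hausdorff_pre s \<delta> A + hausdorff_pre s \<delta> B \<le> hausdorff_pre s \<delta> (A \<union> B)"
    if \<delta>: "0 < \<delta>" "\<delta> < d" for \<delta>
  proof (rule hausdorff_pre_greatest)
    fix C assume C: "A \<union> B \<subseteq> (\<Union>i::nat. C i)" "\<And>i. bounded (C i)" "\<And>i. diameter (C i) \<le> \<delta>"
    have bd: "bounded (C i \<inter> Z)" "diameter (C i \<inter> Z) \<le> \<delta>" for i Z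
      using C(2)[of i] C(3)[of i] diameter_subset[of "C i \<inter> Z" "C i"] by (auto intro: bounded_subset)
    have "hausdorff_pre s \<delta> A + hausdorff_pre s \<delta> B
        \<le> (\<Sum>i. hcost s (C i \<inter> A)) + (\<Sum>i. hcost s (C i \<inter> B))"
      using C bd by (intro add_mono hausdorff_pre_le) auto
    also have "\<dots> = (\<Sum>i. hcost s (C i \<inter> A) + hcost s (C i \<inter> B))"
      by (intro suminf_add) auto
    also have "\<dots> \<le> (\<Sum>i. hcost s (C i))"
    proof (intro suminf_le allI)
      fix i
      have "C i \<inter> A = {} \<or> C i \<inter> B = {}"
      proof (rule ccontr)
        assume "\<not> ?thesis"
        then obtain a b where "a \<in> C i" "a \<in> A" "b \<in> C i" "b \<in> B" by auto
        then show False
          using diameter_bounded_bound[OF C(2), of a i b] C(3)[of i] sep[of a b] \<delta> by force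
      qed
      then show "hcost s (C i \<inter> A) + hcost s (C i \<inter> B) \<le> hcost s (C i)"
        using hcost_mono[of "C i \<inter> A" "C i" s] hcost_mono[of "C i \<inter> B" "C i" s] C(2)[of i] by auto
    qed auto
    finally show "hausdorff_pre s \<delta> A + hausdorff_pre s \<delta> B \<le> (\<Sum>i. hcost s (C i))" .
  qed
  \<comment> \<open>The two suprema are taken one after the other, hence two independent scales;
    both are refined to the common scale \<open>\<mu>\<close>.\<close>
  have *: "hausdorff_pre s \<delta> A + hausdorff_pre s \<delta>' B \<le> hausdorff_outer s (A \<union> B)"
    if "0 < \<delta>" "0 < \<delta>'" for \<delta> \<delta>'
  proof -
    define \<mu> where "\<mu> = min (min \<delta> \<delta>') (d/2)"
    have \<mu>: "0 < \<mu>" "\<mu> < d" "\<mu> \<le> \<delta>" "\<mu> \<le> \<delta>'" using that \<open>0 < d\<close> by (auto simp: \<mu>_def)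
    have "hausdorff_pre s \<delta> A + hausdorff_pre s \<delta>' B \<le> hausdorff_pre s \<mu> A + hausdorff_pre s \<mu> B"
      by (intro add_mono hausdorff_pre_antimono \<mu>)
    also have "\<dots> \<le> hausdorff_outer s (A \<union> B)"
      using small[OF \<mu>(1,2)] hausdorff_pre_le_outer[OF \<mu>(1)] by (rule order_trans)
    finally show ?thesis .
  qed
  have "hausdorff_outer s A + hausdorff_pre s \<delta>' B \<le> hausdorff_outer s (A \<union> B)" if "0 < \<delta>'" for \<delta>'
    unfolding hausdorff_outer_def[of s A] using *[OF _ that]
    by (subst ennreal_SUP_add_left[symmetric]) (auto intro!: SUP_least)
  then have "hausdorff_pre s \<delta>' B + hausdorff_outer s A \<le> hausdorff_outer s (A \<union> B)" if "0 < \<delta>'" for \<delta>'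
    using that by (simp add: add.commute)
  then have "hausdorff_outer s B + hausdorff_outer s A \<le> hausdorff_outer s (A \<union> B)"
    unfolding hausdorff_outer_def[of s B]
    by (subst ennreal_SUP_add_left[symmetric]) (auto intro!: SUP_least)
  then show ?thesis by (simp add: add.commute)
qed

text \<open>Caratheodory's criterion: the shells of points at distance between \<open>1/(k+2)\<close> and \<open>1/(k+1)\<close>
  from the closed set are mutually separated as soon as \<open>k\<close> runs through numbers of one parity,
  so their measures are summable.\<close>

lemma hausdorff_outer_closed_split:
  fixes F :: "'a::metric_space set"
  assumes "closed F"
  shows "hausdorff_outer s (X \<inter> F) + hausdorff_outer s (X - F) \<le> hausdorff_outer s X"
proof (cases "F = {} \<or> hausdorff_outer s X = \<infinity>")
  case True then show ?thesis by auto
next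
  case False
  then have F0: "F \<noteq> {}" and fin: "hausdorff_outer s X < \<infinity>" by (auto simp: top.not_eq_extremum)
  define Y where "Y n = {x\<in>X. 1 / (real n + 1) \<le> infdist x F}" for n
  define R where "R k = {x\<in>X. 1 / (real k + 2) \<le> infdist x F \<and> infdist x F < 1 / (real k + 1)}" for k
  have sep: "hausdorff_outer s A + hausdorff_outer s B \<le> hausdorff_outer s (A \<union> B)"
    if "\<And>x. x \<in> A \<Longrightarrow> p \<le> infdist x F" "\<And>x. x \<in> B \<Longrightarrow> infdist x F \<le> q" "q < p" for A B p q
  proof (rule hausdorff_outer_Un_separated[of "p - q"])
    fix a b assume "a \<in> A" "b \<in> B"
    then show "p - q \<le> dist a b"
      using that(1)[of a] that(2)[of b] infdist_triangle[of a F b] by (simp add: dist_commute)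
  qed (use that in auto)
  have parity: "(\<Sum>k<N. hausdorff_outer s (R (2*k+c))) \<le> hausdorff_outer s (\<Union>k<N. R (2*k+c))" for N c
  proof (induction N)
    case (Suc N)
    show ?case
    proof (cases "N = 0")
      case False
      have "hausdorff_outer s (\<Union>k<N. R (2*k+c)) + hausdorff_outer s (R (2*N+c))
        \<le> hausdorff_outer s ((\<Union>k<N. R (2*k+c)) \<union> R (2*N+c))"
      proof (rule sep[of _ "1 / (2 * real N + real c)" _ "1 / (2 * real N + real c + 1)"])
        show "1 / (2 * real N + real c + 1) < 1 / (2 * real N + real c)"
          using False by (intro divide_strict_left_mono) auto
      next
        fix x assume "x \<in> (\<Union>k<N. R (2*k+c))"
        then obtain k where "k < N" "x \<in> R (2*k+c)" by auto
        then have 1: "1 / (2 * real k + real c + 2) \<le> infdist x F"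
          by (auto simp: R_def algebra_simps)
        have "real k + 1 \<le> real N" using \<open>k < N\<close> by linarith
        then have "1 / (2 * real N + real c) \<le> 1 / (2 * real k + real c + 2)"
          by (intro divide_left_mono) auto
        with 1 show "1 / (2 * real N + real c) \<le> infdist x F" by linarith
      qed (auto simp: R_def algebra_simps)
      moreover have "(\<Union>k<Suc N. R (2*k+c)) = (\<Union>k<N. R (2*k+c)) \<union> R (2*N+c)"
        by (auto simp: lessThan_Suc)
      ultimately show ?thesis
        using Suc.IH by (auto intro: order_trans add_right_mono)
    qed auto
  qed simp
  have sumc: "(\<Sum>k. hausdorff_outer s (R (2*k+c))) \<le> hausdorff_outer s X" for c
  proof (rule suminf_le_const)
    fix N
    have "(\<Union>k<N. R (2*k+c)) \<subseteq> X" by (auto simp: R_def)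
    then show "(\<Sum>k<N. hausdorff_outer s (R (2*k+c))) \<le> hausdorff_outer s X"
      by (rule order_trans[OF parity hausdorff_outer_mono])
  qed auto
  define r where "r k = hausdorff_outer s (R k)" for k
  \<comment> \<open>Even and odd shells are summed separately. Each of the two series is bounded by
    the measure of \<open>X\<close>, so the whole series is finite.\<close>
  have rfin: "(\<Sum>k. r k) < \<infinity>"
  proof -
    have "(\<Sum>k<n. r k) \<le> hausdorff_outer s X + hausdorff_outer s X" for n
    proof -
      have "(\<Sum>k<n. r k) \<le> (\<Sum>k<2*n. r k)" by (intro sum_mono2) auto
      also have "\<dots> = (\<Sum>k<n. r (2*k)) + (\<Sum>k<n. r (2*k+1))"
        by (induction n) (auto simp: algebra_simps)
      also have "\<dots> \<le> (\<Sum>k. r (2*k)) + (\<Sum>k. r (2*k+1))"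
        by (intro add_mono sum_le_suminf) auto
      also have "\<dots> \<le> hausdorff_outer s X + hausdorff_outer s X"
        using sumc[of 0] sumc[of 1] unfolding r_def by (intro add_mono) auto
      finally show ?thesis .
    qed
    then have "(\<Sum>k. r k) \<le> hausdorff_outer s X + hausdorff_outer s X"
      by (intro suminf_le_const) auto
    also have "\<dots> < \<infinity>" using fin by simp
    finally show ?thesis .
  qed
  have cover: "X - F \<subseteq> Y n \<union> (\<Union>k. R (k + n))" for n
  proof
    fix x assume x: "x \<in> X - F"
    then have pos: "0 < infdist x F"
      using assms F0 by (metis DiffE in_closed_iff_infdist_zero infdist_nonneg less_eq_real_def)
    show "x \<in> Y n \<union> (\<Union>k. R (k + n))"
    proof (cases "x \<in> Y n")
      case False
      define m where "m = (LEAST m. 1 / (real m + 1) \<le> infdist x F)"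
      obtain m0 where "1 / (real m0 + 1) \<le> infdist x F"
        using pos by (metis less_eq_real_def nat_approx_posE of_nat_Suc add.commute)
      then have m: "1 / (real m + 1) \<le> infdist x F" unfolding m_def by (rule LeastI)
      have "n < m"
      proof (rule ccontr)
        assume "\<not> n < m"
        then have "1 / (real n + 1) \<le> 1 / (real m + 1)" by (intro divide_left_mono) auto
        with m False x show False by (auto simp: Y_def)
      qed
      then obtain k where k: "m = Suc (k + n)" using less_imp_Suc_add by (metis add.commute)
      have "\<not> 1 / (real (k + n) + 1) \<le> infdist x F"
        using not_less_Least[of "k+n" "\<lambda>m. 1 / (real m + 1) \<le> infdist x F"] k by (simp add: m_def)
      then have "x \<in> R (k + n)" using m x k by (auto simp: R_def algebra_simps)
      then show ?thesis by blast
    qed auto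
  qed
  \<comment> \<open>Beyond \<open>Y n\<close>, which is separated from \<open>F\<close>, the set
    \<open>X - F\<close> consists of shells with index at least \<open>n\<close>; their total
    measure is the tail of a convergent series.\<close>
  have step: "hausdorff_outer s (X \<inter> F) + hausdorff_outer s (X - F) \<le> hausdorff_outer s X + (\<Sum>k. r (k + n))" for n
  proof -
    have "hausdorff_outer s (X - F) \<le> hausdorff_outer s (Y n) + hausdorff_outer s (\<Union>k. R (k + n))"
      using hausdorff_outer_mono[OF cover] hausdorff_outer_Un order_trans by blast
    also have "\<dots> \<le> hausdorff_outer s (Y n) + (\<Sum>k. r (k + n))"
      unfolding r_def by (intro add_left_mono hausdorff_outer_Union)
    finally have "hausdorff_outer s (X \<inter> F) + hausdorff_outer s (X - F)
       \<le> (hausdorff_outer s (Y n) + hausdorff_outer s (X \<inter> F)) + (\<Sum>k. r (k + n))"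
      by (metis add.assoc add.commute add_left_mono)
    also have "hausdorff_outer s (Y n) + hausdorff_outer s (X \<inter> F) \<le> hausdorff_outer s (Y n \<union> (X \<inter> F))"
      by (rule sep[of _ "1 / (real n + 1)" _ 0]) (auto simp: Y_def)
    also have "\<dots> \<le> hausdorff_outer s X" by (rule hausdorff_outer_mono) (auto simp: Y_def)
    finally show ?thesis by (simp add: add_right_mono)
  qed
  obtain r' where r': "\<And>k. r k = ennreal (r' k)" "\<And>k. 0 \<le> r' k"
  proof -
    have "\<exists>x\<ge>0. r k = ennreal x" for k
      using ennreal_suminf_lessD[of r \<infinity> k] rfin by (cases "r k") auto
    then show ?thesis using that by metis
  qed
  have "summable r'"
    using rfin r' by (intro summable_suminf_not_top) auto
  have tail: "(\<lambda>n. \<Sum>k. r (k + n)) \<longlonglongrightarrow> 0"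
  proof -
    have "(\<Sum>k. r (k + n)) = ennreal (\<Sum>k. r' (k + n))" for n
      unfolding r'(1) using \<open>summable r'\<close> r'(2) by (intro suminf_ennreal2) (auto simp: summable_iff_shift)
    moreover have "(\<lambda>n. \<Sum>k. r' (k + n)) \<longlonglongrightarrow> 0"
      using suminf_exist_split2[OF \<open>summable r'\<close>] .
    ultimately show ?thesis by (simp add: tendsto_ennrealI[of _ 0, simplified])
  qed
  have "(\<lambda>n. hausdorff_outer s X + (\<Sum>k. r (k + n))) \<longlonglongrightarrow> hausdorff_outer s X + 0"
    by (intro tendsto_add tendsto_const tail)
  then show ?thesis
    using LIMSEQ_le_const[of "\<lambda>n. hausdorff_outer s X + (\<Sum>k. r (k + n))"] step by auto
qed

text \<open>\<open>measure_of\<close> returns the outer measure only where this is countably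
  additive. By the splitting at closed sets, all closed and hence all Borel sets lie in the
  Caratheodory system, where additivity holds.\<close>

theorem emeasure_hausdorff_measure:
  fixes A :: "'a::metric_space set"
  assumes "A \<in> sets borel"
  shows "emeasure (hausdorff_measure s) A = hausdorff_outer s A"
proof -
  interpret sigma_algebra UNIV "Pow UNIV :: 'a set set" by (rule sigma_algebra_Pow)
  let ?L = "lambda_system UNIV (Pow UNIV) (hausdorff_outer s :: 'a set \<Rightarrow> ennreal)"
  have "outer_measure_space (Pow UNIV) (hausdorff_outer s :: 'a set \<Rightarrow> ennreal)"
    unfolding outer_measure_space_def positive_def increasing_def countably_subadditive_def
    by (auto intro: hausdorff_outer_mono hausdorff_outer_Union)
  then have ms: "measure_space UNIV ?L (hausdorff_outer s)"
    by (rule caratheodory_lemma)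
  have "sets borel \<subseteq> ?L"
    unfolding borel_eq_closed sets_measure_of[OF subset_UNIV[of "Collect closed", unfolded Pow_UNIV[symmetric]]]
  proof (rule sigma_algebra.sigma_sets_subset)
    show "sigma_algebra UNIV ?L" using ms by (simp add: measure_space_def)
    show "Collect closed \<subseteq> ?L"
    proof
      fix F :: "'a set" assume "F \<in> Collect closed"
      then have "closed F" by simp
      have "hausdorff_outer s (X \<inter> F) + hausdorff_outer s (X - F) = hausdorff_outer s X" for X
        using hausdorff_outer_closed_split[OF \<open>closed F\<close>, of s X] hausdorff_outer_Un[of s "X \<inter> F" "X - F"]
        by (simp add: Int_Diff_Un antisym)
      then show "F \<in> ?L" unfolding lambda_system_eq by blast
    qed
  qed
  then have "measure_space UNIV (sets borel) (hausdorff_outer s :: 'a set \<Rightarrow> ennreal)"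
    using sets.sigma_algebra_axioms[of "borel :: 'a measure"] by (intro measure_down[OF ms]) auto
  then show ?thesis
    using assms unfolding hausdorff_measure_def
    by (intro emeasure_measure_of_sigma) (auto simp: measure_space_def)
qed

lemma sets_hausdorff_measure [simp, measurable_cong]: "sets (hausdorff_measure s) = sets borel"
  unfolding hausdorff_measure_def
  by (rule sets.sets_measure_of_eq[of borel, unfolded space_borel])

lemma space_hausdorff_measure [simp]: "space (hausdorff_measure s) = UNIV"
  by (simp add: hausdorff_measure_def space_measure_of_conv)

text \<open>A cover of \<open>A\<close> is pushed forward by \<open>f\<close>, and diameters grow at
  most by the factor \<open>L\<close>; accordingly the scale \<open>\<delta>\<close> for the image
  corresponds to the scale \<open>\<delta> / L\<close> for \<open>A\<close>.\<close>

lemma hausdorff_outer_lipschitz_image: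
  fixes f :: "'a::metric_space \<Rightarrow> 'b::metric_space"
  assumes L: "0 < L" and lip: "\<And>x y. x \<in> A \<Longrightarrow> y \<in> A \<Longrightarrow> dist (f x) (f y) \<le> L * dist x y"
  shows "hausdorff_outer s (f ` A) \<le> ennreal (L ^ s) * hausdorff_outer s A"
proof (rule hausdorff_outer_least)
  fix \<delta> :: real assume \<delta>: "0 < \<delta>"
  have "hausdorff_pre s \<delta> (f ` A) / ennreal (L ^ s) \<le> hausdorff_pre s (\<delta> / L) A"
  proof (rule hausdorff_pre_greatest)
    fix C assume C: "A \<subseteq> (\<Union>i::nat. C i)" "\<And>i. bounded (C i)" "\<And>i. diameter (C i) \<le> \<delta> / L"
    \<comment> \<open>The covering sets are cut down to \<open>A\<close> because the Lipschitz bound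
      is known only there.\<close>
    define D where "D i = f ` (C i \<inter> A)" for i
    have dist: "dist x y \<le> L * diameter (C i)" if xy: "x \<in> D i" "y \<in> D i" for i x y
    proof -
      obtain a b where ab: "a \<in> C i \<inter> A" "b \<in> C i \<inter> A" "x = f a" "y = f b"
        using xy unfolding D_def by blast
      then have "dist x y \<le> L * dist a b" using lip by auto
      also have "\<dots> \<le> L * diameter (C i)"
        using ab L diameter_bounded_bound[OF C(2)] by (intro mult_left_mono) auto
      finally show ?thesis .
    qed
    have bd: "bounded (D i)" for i
      using dist by (metis bounded_two_points)
    have diam: "diameter (D i) \<le> L * diameter (C i)" for i
    proof (cases "D i = {}")
      case False
      then show ?thesis
        unfolding diameter_def[of "D i"] using dist[of _ i] by (auto intro!: cSUP_least)
    qed (use L diameter_ge_0[OF C(2), of i] in auto)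
    have "hausdorff_pre s \<delta> (f ` A) \<le> (\<Sum>i. hcost s (D i))"
    proof (rule hausdorff_pre_le)
      show "diameter (D i) \<le> \<delta>" for i
        using diam[of i] C(3)[of i] L by (simp add: field_simps)
      show "f ` A \<subseteq> (\<Union>i. D i)" using C(1) unfolding D_def by blast
    qed (use bd in auto)
    also have "\<dots> \<le> (\<Sum>i. ennreal (L ^ s) * hcost s (C i))"
    proof (intro suminf_le allI)
      fix i
      show "hcost s (D i) \<le> ennreal (L ^ s) * hcost s (C i)"
      proof (cases "D i = {}")
        case False
        then have "C i \<noteq> {}" by (auto simp: D_def)
        have "hausdorff_const s * diameter (D i) ^ s \<le> hausdorff_const s * (L * diameter (C i)) ^ s"
          by (intro mult_left_mono power_mono diam hausdorff_const_nonneg diameter_ge_0 bd)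
        then show ?thesis
          using False \<open>C i \<noteq> {}\<close> L
          by (simp add: hcost_def ennreal_mult'[symmetric] power_mult_distrib algebra_simps ennreal_leI)
      qed auto
    qed auto
    also have "\<dots> = ennreal (L ^ s) * (\<Sum>i. hcost s (C i))" by simp
    finally show "hausdorff_pre s \<delta> (f ` A) / ennreal (L ^ s) \<le> (\<Sum>i. hcost s (C i))"
      using L by (intro divide_le_posI_ennreal) (auto simp: mult.commute)
  qed
  also have "\<dots> \<le> hausdorff_outer s A" using \<delta> L by (intro hausdorff_pre_le_outer) auto
  finally have "ennreal (L ^ s) * (hausdorff_pre s \<delta> (f ` A) / ennreal (L ^ s)) \<le> ennreal (L ^ s) * hausdorff_outer s A"
    by (rule mult_left_mono) auto
  then show "hausdorff_pre s \<delta> (f ` A) \<le> ennreal (L ^ s) * hausdorff_outer s A"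
    using L by (simp add: ennreal_times_divide mult.commute[of "ennreal (L ^ s)"] ennreal_mult_divide_eq)
qed

lemma hausdorff_outer_isometry_image:
  assumes "\<And>x y. x \<in> A \<Longrightarrow> y \<in> A \<Longrightarrow> dist (f x) (f y) = dist x y"
  shows "hausdorff_outer s (f ` A) = hausdorff_outer s A"
proof (rule antisym)
  show "hausdorff_outer s (f ` A) \<le> hausdorff_outer s A"
    using hausdorff_outer_lipschitz_image[of 1 A f s] assms by simp
  have inj: "inj_on f A" using assms by (metis dist_eq_0_iff inj_onI)
  have "dist (the_inv_into A f x) (the_inv_into A f y) \<le> 1 * dist x y" if "x \<in> f ` A" "y \<in> f ` A" for x y
    using that assms by (auto simp: the_inv_into_f_f[OF inj])
  then have "hausdorff_outer s (the_inv_into A f ` (f ` A)) \<le> ennreal (1 ^ s) * hausdorff_outer s (f ` A)"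
    by (intro hausdorff_outer_lipschitz_image) auto
  then have "hausdorff_outer s (the_inv_into A f ` (f ` A)) \<le> hausdorff_outer s (f ` A)" by simp
  moreover have "the_inv_into A f ` (f ` A) = A"
    using inj by (auto simp: the_inv_into_f_f image_iff)
  ultimately show "hausdorff_outer s A \<le> hausdorff_outer s (f ` A)" by simp
qed

section \<open>The isodiametric inequality\<close>

text \<open>Written as a double union, the form in which \<open>open_sums\<close> states that a sum
  with an open set is open.\<close>

abbreviation set_sum :: "'a::ab_group_add set \<Rightarrow> 'a set \<Rightarrow> 'a set" where
  "set_sum A B \<equiv> (\<Union>x\<in>A. \<Union>y\<in>B. {x + y})"

text \<open>Empty members are excluded so that the number of boxes can serve as induction measure
  and every family has positive volume.\<close>

definition open_boxes :: "'a::euclidean_space set set \<Rightarrow> bool" where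
  "open_boxes \<A> \<longleftrightarrow> finite \<A> \<and> \<A> \<noteq> {} \<and> pairwise disjnt \<A> \<and> (\<forall>U\<in>\<A>. U \<noteq> {} \<and> (\<exists>a b. U = box a b))"

lemma open_boxes_open: "open_boxes \<A> \<Longrightarrow> open (\<Union>\<A>)"
  unfolding open_boxes_def by (metis open_Union open_box)

lemma open_boxes_bounded: "open_boxes \<A> \<Longrightarrow> bounded (\<Union>\<A>)"
  unfolding open_boxes_def by (metis bounded_Union bounded_box)

lemma measure_lborel_mono:
  assumes "A \<subseteq> B" "bounded B" "A \<in> sets borel" "B \<in> sets borel"
  shows "measure lborel A \<le> measure lborel (B::'a::euclidean_space set)"
  using assms emeasure_bounded_finite[OF assms(2)]
  by (intro measure_mono_fmeasurable) (auto simp: fmeasurable_def)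

lemma box_Int_halfspace_less:
  fixes a b :: "'a::euclidean_space"
  assumes "i \<in> Basis"
  shows "box a b \<inter> {x. x \<bullet> i < c} = box a (b + (min (b \<bullet> i) c - b \<bullet> i) *\<^sub>R i)"
proof -
  have *: "(b + t *\<^sub>R i) \<bullet> j = (if j = i then b \<bullet> i + t else b \<bullet> j)" if "j \<in> Basis" for j t
    using assms that by (auto simp: inner_simps inner_Basis)
  show ?thesis using assms by (auto simp: mem_box * split: if_splits)
qed

lemma box_Int_halfspace_greater:
  fixes a b :: "'a::euclidean_space"
  assumes "i \<in> Basis"
  shows "box a b \<inter> {x. c < x \<bullet> i} = box (a + (max (a \<bullet> i) c - a \<bullet> i) *\<^sub>R i) b"
proof -
  have *: "(a + t *\<^sub>R i) \<bullet> j = (if j = i then a \<bullet> i + t else a \<bullet> j)" if "j \<in> Basis" for j t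
    using assms that by (auto simp: inner_simps inner_Basis)
  show ?thesis using assms by (auto simp: mem_box * split: if_splits)
qed

lemma null_hyperplane: "i \<in> Basis \<Longrightarrow> {x::'a::euclidean_space. x \<bullet> i = c} \<in> null_sets lborel"
  using negligible_standard_hyperplane[of i c]
  by (simp add: negligible_iff_null_sets null_sets_completion_iff borel_measurable_const)

lemma measure_split_halfspaces:
  fixes A :: "'a::euclidean_space set"
  assumes "i \<in> Basis" "open A" "bounded A"
  shows "measure lborel A = measure lborel (A \<inter> {x. x \<bullet> i < c}) + measure lborel (A \<inter> {x. c < x \<bullet> i})"
proof -
  have o: "open {x::'a. x \<bullet> i < c}" "open {x::'a. c < x \<bullet> i}"
    by (auto intro!: open_Collect_less continuous_intros)
  have [simp]: "A \<in> sets borel" "{x. x \<bullet> i < c} \<in> sets borel" "{x. c < x \<bullet> i} \<in> sets borel"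
    using assms o by auto
  have fin: "emeasure lborel (A \<inter> S) < \<infinity>" for S
    using emeasure_bounded_finite bounded_subset[OF assms(3)] by blast
  have "measure lborel A = measure lborel (A - {x. x \<bullet> i = c})"
    using null_hyperplane[OF assms(1)] by (intro measure_Diff_null_set[symmetric]) auto
  also have "A - {x. x \<bullet> i = c} = (A \<inter> {x. x \<bullet> i < c}) \<union> (A \<inter> {x. c < x \<bullet> i})" by auto
  also have "measure lborel \<dots> = measure lborel (A \<inter> {x. x \<bullet> i < c}) + measure lborel (A \<inter> {x. c < x \<bullet> i})"
    using fin[THEN less_imp_neq] by (intro measure_Union) auto
  finally show ?thesis .
qed

text \<open>The volume to the left of a hyperplane is the distribution function of the push-forward
  of Lebesgue measure on \<open>B\<close> under the coordinate. Hyperplanes are null, so it is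
  continuous and the intermediate value theorem applies.\<close>

lemma exists_halfspace_fraction:
  fixes B :: "'a::euclidean_space set"
  assumes i: "i \<in> Basis" and B: "open B" "bounded B" and \<theta>: "0 < \<theta>" "\<theta> < 1"
  obtains c where "measure lborel (B \<inter> {x. x \<bullet> i < c}) = \<theta> * measure lborel B"
proof -
  define M where "M = distr (restrict_space lborel B) borel (\<lambda>x. x \<bullet> i)"
  have [simp]: "B \<in> sets borel" using B by auto
  have meas[measurable]: "(\<lambda>x. x \<bullet> i) \<in> restrict_space lborel B \<rightarrow>\<^sub>M borel"
    by (intro measurable_restrict_space1) auto
  interpret R: finite_measure "restrict_space lborel B"
    using emeasure_bounded_finite[OF B(2)] by (intro finite_measureI) (simp add: space_restrict_space emeasure_restrict_space)
  interpret finite_borel_measure M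
    unfolding M_def by (intro finite_borel_measure.intro R.finite_measure_distr meas) (simp add: finite_borel_measure_axioms_def)
  have mM: "measure M X = measure lborel (B \<inter> {x. x \<bullet> i \<in> X})" if "X \<in> sets borel" for X
  proof -
    have "{x \<in> B. x \<bullet> i \<in> X} \<in> sets borel"
    proof -
      have "(\<lambda>x::'a. x \<bullet> i) -` X \<inter> space borel \<in> sets borel"
        using that by (intro measurable_sets[of _ borel borel]) auto
      then have "B \<inter> ((\<lambda>x. x \<bullet> i) -` X \<inter> space borel) \<in> sets borel" by (intro sets.Int) auto
      moreover have "{x \<in> B. x \<bullet> i \<in> X} = B \<inter> ((\<lambda>x. x \<bullet> i) -` X \<inter> space borel)" by auto
      ultimately show ?thesis by simp
    qed
    moreover have "(\<lambda>x::'a. x \<bullet> i) -` X \<inter> B = {x \<in> B. x \<bullet> i \<in> X}" by auto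
    ultimately show ?thesis
      using that unfolding M_def
      by (subst measure_distr[OF meas]) (auto simp: space_restrict_space measure_restrict_space intro!: arg_cong[where f="measure lborel"])
  qed
  have sing: "measure M {x} = 0" for x
  proof -
    have "measure M {x} \<le> measure lborel (B \<inter> {y. y \<bullet> i = x})" by (subst mM) auto
    also have "\<dots> = 0"
      using null_sets_subset[OF null_hyperplane[OF i], of "B \<inter> {y. y \<bullet> i = x}"]
      by (intro measure_eq_0_null_sets) (auto simp: B)
    finally show ?thesis by (simp add: measure_le_0_iff)
  qed
  have cont: "isCont (cdf M) x" for x by (simp add: isCont_cdf sing)
  have tot: "measure M (space M) = measure lborel B"
    using mM[of UNIV] by (simp add: M_def)
  obtain c where c: "cdf M c = \<theta> * measure lborel B"
  proof (cases "measure lborel B = 0")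
    case True
    then have "cdf M 0 \<le> 0" using cdf_bounded[of 0] tot by simp
    then show ?thesis using that[of 0] True cdf_nonneg[of 0] by simp
  next
    case False
    then have pos: "0 < measure lborel B" by (simp add: zero_less_measure_iff)
    have "\<forall>\<^sub>F x in at_bot. cdf M x < \<theta> * measure lborel B"
      using cdf_lim_at_bot pos \<theta> by (intro order_tendstoD) auto
    then obtain p where p: "cdf M p < \<theta> * measure lborel B" by (auto simp: eventually_at_bot_linorder)
    have "\<forall>\<^sub>F x in at_top. \<theta> * measure lborel B < cdf M x"
      using cdf_lim_at_top pos \<theta> tot by (intro order_tendstoD) auto
    then obtain q where q: "\<theta> * measure lborel B < cdf M q" by (auto simp: eventually_at_top_linorder)
    have "p \<le> q"
    proof (rule ccontr)
      assume "\<not> p \<le> q"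
      then show False using cdf_nondecreasing[of q p] p q by simp
    qed
    then show ?thesis
      using IVT[of "cdf M" p "\<theta> * measure lborel B" q] p q cont that by auto
  qed
  have "measure lborel (B \<inter> {x. x \<bullet> i < c}) = measure M {..<c}" by (subst mM) auto
  also have "\<dots> = cdf M c"
  proof -
    have "{..c} = {..<c} \<union> {c}" by auto
    then show ?thesis
      using finite_measure_Union[of "{..<c}" "{c}"] sing[of c] by (simp add: cdf_def2 sets_M)
  qed
  finally show ?thesis using c that by simp
qed

lemma box_subset_set_sum:
  fixes a b c d :: "'a::euclidean_space"
  assumes "box a b \<noteq> {}" "box c d \<noteq> {}"
  shows "box (a + c) (b + d) \<subseteq> set_sum (box a b) (box c d)"
proof
  fix z assume z: "z \<in> box (a + c) (b + d)"
  \<comment> \<open>Relative position of \<open>z\<close> in the i-th side of the sum box;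
    \<open>x\<close> and \<open>y\<close> are taken at the same relative position in the two given
    boxes.\<close>
  define t where "t i = (z \<bullet> i - a \<bullet> i - c \<bullet> i) / (b \<bullet> i - a \<bullet> i + (d \<bullet> i - c \<bullet> i))" for i
  from assms have ab: "a \<bullet> i < b \<bullet> i" "c \<bullet> i < d \<bullet> i" if "i \<in> Basis" for i
    using that by (auto simp: box_ne_empty)
  define x where "x = (\<Sum>i\<in>Basis. (a \<bullet> i + t i * (b \<bullet> i - a \<bullet> i)) *\<^sub>R i)"
  define y where "y = (\<Sum>i\<in>Basis. (c \<bullet> i + t i * (d \<bullet> i - c \<bullet> i)) *\<^sub>R i)"
  have t: "0 < t i" "t i < 1" if "i \<in> Basis" for i
    using z ab[OF that] that by (auto simp: t_def mem_box inner_simps field_simps)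
  have between: "p < p + s * (q - p) \<and> p + s * (q - p) < q" if "0 < s" "s < 1" "p < q" for p q s :: real
  proof -
    have *: "0 < r \<Longrightarrow> r < q - p \<Longrightarrow> p < p + r \<and> p + r < q" for r by auto
    show ?thesis
      using that mult_strict_right_mono[of s 1 "q - p", unfolded mult_1] by (intro *) auto
  qed
  have "x \<in> box a b" "y \<in> box c d"
    using between t ab by (simp_all add: x_def y_def mem_box)
  moreover have "x + y = z"
  proof (rule euclidean_eqI)
    fix i :: 'a assume i: "i \<in> Basis"
    have "(x + y) \<bullet> i = a \<bullet> i + c \<bullet> i + t i * (b \<bullet> i - a \<bullet> i + (d \<bullet> i - c \<bullet> i))"
      using i by (simp add: x_def y_def inner_add_left) (simp add: algebra_simps)
    also have "\<dots> = z \<bullet> i"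
      using ab[OF i] by (simp add: t_def)
    finally show "(x + y) \<bullet> i = z \<bullet> i" .
  qed
  ultimately show "z \<in> set_sum (box a b) (box c d)" by blast
qed

lemma bounded_set_sum:
  fixes A B :: "'a::real_normed_vector set"
  assumes "bounded A" "bounded B"
  shows "bounded (set_sum A B)"
proof -
  have "set_sum A B = {x + y |x y. x \<in> A \<and> y \<in> B}" by blast
  then show ?thesis using bounded_plus[OF assms] by (auto elim: bounded_subset)
qed

lemma set_sum_commute: "set_sum A B = set_sum B A"
  by (auto simp: add.commute)

lemma sqrt_prod: "sqrt (\<Prod>i\<in>I. f i) = (\<Prod>i\<in>I. sqrt (f i))"
  by (induction I rule: infinite_finite_induct) (auto simp: real_sqrt_mult)

text \<open>Arithmetic-geometric mean inequality for the two side lengths in each coordinate. It is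
  the base case of the multiplicative form of the Brunn-Minkowski inequality, which is sharp enough
  for two sets of equal volume.\<close>

lemma measure_set_sum_box:
  fixes a b c d :: "'a::euclidean_space"
  assumes "box a b \<noteq> {}" "box c d \<noteq> {}"
  shows "2 ^ DIM('a) * sqrt (measure lborel (box a b) * measure lborel (box c d))
    \<le> measure lborel (set_sum (box a b) (box c d))"
proof -
  have ab: "a \<bullet> i < b \<bullet> i" "c \<bullet> i < d \<bullet> i" if "i \<in> Basis" for i
    using that assms by (auto simp: box_ne_empty)
  then have le: "\<forall>i\<in>Basis. a \<bullet> i \<le> b \<bullet> i" "\<forall>i\<in>Basis. c \<bullet> i \<le> d \<bullet> i"
    "\<forall>i\<in>Basis. (a + c) \<bullet> i \<le> (b + d) \<bullet> i"
    by (auto simp: inner_simps less_imp_le add_mono)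
  have "2 ^ DIM('a) * sqrt (measure lborel (box a b) * measure lborel (box c d))
     = (\<Prod>i\<in>(Basis::'a set). 2 * sqrt (((b - a) \<bullet> i) * ((d - c) \<bullet> i)))"
    using le by (simp add: measure_lborel_box_eq prod.distrib sqrt_prod real_sqrt_mult)
  also have "\<dots> \<le> (\<Prod>i\<in>Basis. ((b + d) - (a + c)) \<bullet> i)"
  proof (intro prod_mono conjI)
    fix i :: 'a assume i: "i \<in> Basis"
    show "2 * sqrt (((b - a) \<bullet> i) * ((d - c) \<bullet> i)) \<le> ((b + d) - (a + c)) \<bullet> i"
      using arith_geo_mean_sqrt[of "(b - a) \<bullet> i" "(d - c) \<bullet> i"] ab[OF i] by (simp add: inner_simps)
    show "0 \<le> 2 * sqrt (((b - a) \<bullet> i) * ((d - c) \<bullet> i))"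
      using ab[OF i] by (simp add: inner_simps)
  qed
  also have "\<dots> = measure lborel (box (a + c) (b + d))"
    using le by (simp add: measure_lborel_box_eq)
  also have "\<dots> \<le> measure lborel (set_sum (box a b) (box c d))"
    by (intro measure_lborel_mono box_subset_set_sum assms bounded_set_sum bounded_box)
      (auto intro!: borel_open open_sums)
  finally show ?thesis .
qed

text \<open>The last part drives the induction: a box that misses the half-space disappears, so the
  number of boxes strictly decreases.\<close>

lemma open_boxes_cut:
  fixes \<A> :: "'a::euclidean_space set set"
  assumes \<A>: "open_boxes \<A>" and H: "\<And>a b. \<exists>a' b'. box a b \<inter> H = box a' b'"
    and ne: "\<Union>\<A> \<inter> H \<noteq> {}"
  shows "open_boxes ((\<lambda>U. U \<inter> H) ` \<A> - {{}})" (is ?th1)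
    and "\<Union>((\<lambda>U. U \<inter> H) ` \<A> - {{}}) = \<Union>\<A> \<inter> H"
    and "card ((\<lambda>U. U \<inter> H) ` \<A> - {{}}) \<le> card \<A>"
    and "V \<in> \<A> \<Longrightarrow> V \<inter> H = {} \<Longrightarrow> card ((\<lambda>U. U \<inter> H) ` \<A> - {{}}) < card \<A>"
proof -
  have fin: "finite \<A>" using \<A> by (simp add: open_boxes_def)
  have boxes: "\<exists>a b. U = box a b" if "U \<in> \<A>" for U using \<A> that by (auto simp: open_boxes_def)
  have disj: "pairwise disjnt ((\<lambda>U. U \<inter> H) ` \<A> - {{}})"
  proof (rule pairwiseI)
    fix X Y assume "X \<in> (\<lambda>U. U \<inter> H) ` \<A> - {{}}" "Y \<in> (\<lambda>U. U \<inter> H) ` \<A> - {{}}" "X \<noteq> Y"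
    then obtain U V where "U \<in> \<A>" "V \<in> \<A>" "X = U \<inter> H" "Y = V \<inter> H" "U \<noteq> V" by auto
    moreover from this have "disjnt U V"
      using \<A> by (auto simp: open_boxes_def dest: pairwiseD)
    ultimately show "disjnt X Y" by (auto simp: disjnt_def)
  qed
  have "\<exists>a b. X = box a b" if "X \<in> (\<lambda>U. U \<inter> H) ` \<A> - {{}}" for X
    using that boxes H by (metis DiffD1 imageE)
  then show ?th1 using fin disj ne by (auto simp: open_boxes_def)
  show "\<Union>((\<lambda>U. U \<inter> H) ` \<A> - {{}}) = \<Union>\<A> \<inter> H" by auto
  have "card ((\<lambda>U. U \<inter> H) ` \<A> - {{}}) \<le> card ((\<lambda>U. U \<inter> H) ` \<A>)"
    using fin by (intro card_mono) auto
  then show "card ((\<lambda>U. U \<inter> H) ` \<A> - {{}}) \<le> card \<A>"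
    using card_image_le[OF fin, of "\<lambda>U. U \<inter> H"] by linarith
  assume V: "V \<in> \<A>" "V \<inter> H = {}"
  have "card ((\<lambda>U. U \<inter> H) ` \<A> - {{}}) \<le> card ((\<lambda>U. U \<inter> H) ` (\<A> - {V}))"
    using fin V by (intro card_mono) auto
  also have "\<dots> \<le> card (\<A> - {V})" using fin by (intro card_image_le) auto
  also have "\<dots> < card \<A>" using fin V by (intro card_Diff1_less)
  finally show "card ((\<lambda>U. U \<inter> H) ` \<A> - {{}}) < card \<A>" .
qed

lemma measure_open_pos:
  fixes A :: "'a::euclidean_space set"
  assumes "open A" "bounded A" "A \<noteq> {}"
  shows "0 < measure lborel A"
proof -
  obtain x e where "0 < e" "ball x e \<subseteq> A" using assms by (meson open_contains_ball ex_in_conv)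
  then have "0 < measure lborel (ball x e)" by (simp add: content_ball_pos)
  also have "\<dots> \<le> measure lborel A"
    using assms \<open>ball x e \<subseteq> A\<close> by (intro measure_lborel_mono) auto
  finally show ?thesis .
qed

text \<open>Hadwiger and Ohmann's argument: one family is cut by a hyperplane separating two of its boxes,
  the other one by a parallel hyperplane in the same volume ratio.\<close>

lemma brunn_minkowski_cut_step:
  fixes \<A> \<B> :: "'a::euclidean_space set set"
  assumes \<A>: "open_boxes \<A>" and \<B>: "open_boxes \<B>" and two: "1 < card \<A>"
    and IH: "\<And>\<A>' \<B>' :: 'a set set. open_boxes \<A>' \<Longrightarrow> open_boxes \<B>' \<Longrightarrow> card \<A>' + card \<B>' < card \<A> + card \<B> \<Longrightarrow>
      2 ^ DIM('a) * sqrt (measure lborel (\<Union>\<A>') * measure lborel (\<Union>\<B>'))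
        \<le> measure lborel (set_sum (\<Union>\<A>') (\<Union>\<B>'))"
  shows "2 ^ DIM('a) * sqrt (measure lborel (\<Union>\<A>) * measure lborel (\<Union>\<B>))
        \<le> measure lborel (set_sum (\<Union>\<A>) (\<Union>\<B>))"
proof -
  have "\<exists>U V i a b c d. U \<in> \<A> \<and> V \<in> \<A> \<and> i \<in> Basis \<and> U = box a b \<and> V = box c d \<and> b \<bullet> i \<le> c \<bullet> i"
  proof -
    obtain U V where UV: "U \<in> \<A>" "V \<in> \<A>" "U \<noteq> V"
      using two by (metis card_le_Suc0_iff_eq One_nat_def \<A> open_boxes_def not_le)
    obtain a b where boxU: "U = box a b" using \<A> UV unfolding open_boxes_def by metis
    obtain c d where boxV: "V = box c d" using \<A> UV unfolding open_boxes_def by metis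
    note boxes = boxU boxV
    have "disjnt U V" using UV \<A> pairwiseD unfolding open_boxes_def by metis
    then have "box a b \<inter> box c d = {}" "box a b \<noteq> {}" "box c d \<noteq> {}"
      using UV boxes \<A> unfolding open_boxes_def disjnt_def by blast+
    then obtain i where "i \<in> Basis" "b \<bullet> i \<le> c \<bullet> i \<or> d \<bullet> i \<le> a \<bullet> i"
      unfolding disjoint_interval box_ne_empty by force
    then show ?thesis using UV boxes by blast
  qed
  then obtain U V i a b c d where UV: "U \<in> \<A>" "V \<in> \<A>" and i: "i \<in> Basis"
    and U: "U = box a b" and V: "V = box c d" and bc: "b \<bullet> i \<le> c \<bullet> i"
    by blast
  have UVne: "U \<noteq> {}" "V \<noteq> {}" using \<A> UV by (auto simp: open_boxes_def)
  define p where "p = b \<bullet> i"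
  let ?L = "\<lambda>p. {x::'a. x \<bullet> i < p}" and ?G = "\<lambda>p. {x::'a. p < x \<bullet> i}"
  have o: "open (?L p)" "open (?G p)" for p by (auto intro!: open_Collect_less continuous_intros)
  have UL: "U \<subseteq> ?L p" "V \<subseteq> ?G p" using U V bc by (auto simp: mem_box p_def dest!: bspec[OF _ i])
  then have UG: "U \<inter> ?G p = {}" "V \<inter> ?L p = {}" by force+
  let ?A = "\<Union>\<A>" and ?B = "\<Union>\<B>"
  have oA: "open ?A" "bounded ?A" and oB: "open ?B" "bounded ?B"
    using \<A> \<B> open_boxes_open open_boxes_bounded by auto
  have neA: "?A \<inter> ?L p \<noteq> {}" "?A \<inter> ?G p \<noteq> {}" using UL UV UVne by blast+
  define \<alpha> where "\<alpha> = measure lborel ?A"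
  define \<beta> where "\<beta> = measure lborel ?B"
  have \<alpha>L: "0 < measure lborel (?A \<inter> ?L p)" "0 < measure lborel (?A \<inter> ?G p)"
    using neA oA o by (auto intro!: measure_open_pos bounded_Int)
  have \<alpha>: "\<alpha> = measure lborel (?A \<inter> ?L p) + measure lborel (?A \<inter> ?G p)"
    unfolding \<alpha>_def by (rule measure_split_halfspaces[OF i oA])
  have \<alpha>pos: "0 < \<alpha>" using \<alpha> \<alpha>L by linarith
  have \<beta>pos: "0 < \<beta>" using \<B> oB unfolding \<beta>_def open_boxes_def by (intro measure_open_pos) auto
  define \<theta> where "\<theta> = measure lborel (?A \<inter> ?L p) / \<alpha>"
  have \<theta>: "0 < \<theta>" "\<theta> < 1" using \<alpha> \<alpha>L \<alpha>pos by (auto simp: \<theta>_def)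
  obtain q where q: "measure lborel (?B \<inter> ?L q) = \<theta> * \<beta>"
    using exists_halfspace_fraction[OF i oB \<theta>] unfolding \<beta>_def by blast
  have q': "measure lborel (?B \<inter> ?G q) = (1 - \<theta>) * \<beta>"
    using measure_split_halfspaces[OF i oB, of q] q unfolding \<beta>_def[symmetric] by (simp add: algebra_simps)
  have a1: "measure lborel (?A \<inter> ?L p) = \<theta> * \<alpha>" using \<alpha>pos by (simp add: \<theta>_def)
  have a2: "measure lborel (?A \<inter> ?G p) = (1 - \<theta>) * \<alpha>" using \<alpha> a1 by (simp add: algebra_simps)
  have neB: "?B \<inter> ?L q \<noteq> {}" "?B \<inter> ?G q \<noteq> {}"
    using q q' \<theta> \<beta>pos by (metis measure_empty less_irrefl mult_pos_pos, metis measure_empty less_irrefl mult_pos_pos diff_gt_0_iff_gt)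
  have HL: "\<exists>a' b'. box a b \<inter> ?L r = box a' b'" "\<exists>a' b'. box a b \<inter> ?G r = box a' b'" for a b r
    using box_Int_halfspace_less[OF i] box_Int_halfspace_greater[OF i] by blast+
  let ?S = "set_sum ?A ?B"
  let ?SL = "set_sum (?A \<inter> ?L p) (?B \<inter> ?L q)" and ?SG = "set_sum (?A \<inter> ?G p) (?B \<inter> ?G q)"
  have "2 ^ DIM('a) * sqrt (measure lborel (?A \<inter> ?L p) * measure lborel (?B \<inter> ?L q)) \<le> measure lborel ?SL"
    using IH[OF open_boxes_cut(1)[OF \<A> HL(1) neA(1)] open_boxes_cut(1)[OF \<B> HL(1) neB(1)]]
      open_boxes_cut(4)[OF \<A> HL(1) neA(1) UV(2) UG(2)] open_boxes_cut(3)[OF \<B> HL(1) neB(1)]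
    unfolding open_boxes_cut(2)[OF \<A> HL(1) neA(1)] open_boxes_cut(2)[OF \<B> HL(1) neB(1)] by linarith
  \<comment> \<open>Because both families are cut in the same ratio \<open>\<theta>\<close>, the
    product of the volumes carries \<open>\<theta>\<^sup>2\<close> and its root exactly
    \<open>\<theta>\<close>; the two halves thus add up to \<open>sqrt (\<alpha> * \<beta>)\<close>
    without loss.\<close>
  moreover have "sqrt (measure lborel (?A \<inter> ?L p) * measure lborel (?B \<inter> ?L q)) = \<theta> * sqrt (\<alpha> * \<beta>)"
  proof -
    have "measure lborel (?A \<inter> ?L p) * measure lborel (?B \<inter> ?L q) = \<theta>\<^sup>2 * (\<alpha> * \<beta>)"
      by (simp add: a1 q power2_eq_square)
    then show ?thesis using \<theta> by (simp add: real_sqrt_mult)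
  qed
  moreover have "2 ^ DIM('a) * sqrt (measure lborel (?A \<inter> ?G p) * measure lborel (?B \<inter> ?G q)) \<le> measure lborel ?SG"
    using IH[OF open_boxes_cut(1)[OF \<A> HL(2) neA(2)] open_boxes_cut(1)[OF \<B> HL(2) neB(2)]]
      open_boxes_cut(4)[OF \<A> HL(2) neA(2) UV(1) UG(1)] open_boxes_cut(3)[OF \<B> HL(2) neB(2)]
    unfolding open_boxes_cut(2)[OF \<A> HL(2) neA(2)] open_boxes_cut(2)[OF \<B> HL(2) neB(2)] by linarith
  moreover have "sqrt (measure lborel (?A \<inter> ?G p) * measure lborel (?B \<inter> ?G q)) = (1 - \<theta>) * sqrt (\<alpha> * \<beta>)"
  proof -
    have "measure lborel (?A \<inter> ?G p) * measure lborel (?B \<inter> ?G q) = (1 - \<theta>)\<^sup>2 * (\<alpha> * \<beta>)"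
      by (simp add: a2 q' power2_eq_square)
    then show ?thesis using \<theta> by (simp add: real_sqrt_mult)
  qed
  ultimately have "2 ^ DIM('a) * (\<theta> * sqrt (\<alpha> * \<beta>)) + 2 ^ DIM('a) * ((1 - \<theta>) * sqrt (\<alpha> * \<beta>))
      \<le> measure lborel ?SL + measure lborel ?SG"
    by (metis add_mono)
  \<comment> \<open>The two partial sums lie on opposite sides of the hyperplane at height
    \<open>p + q\<close>, so they are disjoint parts of the full sum.\<close>
  also have "measure lborel ?SL + measure lborel ?SG = measure lborel (?SL \<union> ?SG)"
  proof (rule measure_Union[symmetric])
    have bd: "bounded ?SL" "bounded ?SG" using oA oB by (auto intro!: bounded_set_sum bounded_Int)
    then show "emeasure lborel ?SL \<noteq> \<infinity>" "emeasure lborel ?SG \<noteq> \<infinity>"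
      using emeasure_bounded_finite by (metis infinity_ennreal_def less_irrefl)+
    have "open ?SL" "open ?SG" using oA oB o by (auto intro!: open_sums)
    then show "?SL \<in> sets lborel" "?SG \<in> sets lborel" by auto
    have "x \<bullet> i < p + q" if "x \<in> ?SL" for x using that by (auto simp: inner_add_left intro: add_strict_mono)
    moreover have "p + q < x \<bullet> i" if "x \<in> ?SG" for x using that by (auto simp: inner_add_left intro: add_strict_mono)
    ultimately show "?SL \<inter> ?SG = {}" by (meson disjoint_iff less_asym)
  qed
  also have "\<dots> \<le> measure lborel ?S"
  proof (rule measure_lborel_mono)
    show "?SL \<union> ?SG \<subseteq> ?S" by blast
    show "bounded ?S" by (rule bounded_set_sum[OF oA(2) oB(2)])
    show "?SL \<union> ?SG \<in> sets borel" using oA oB o by (auto intro!: borel_open open_sums open_Un)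
    show "?S \<in> sets borel" by (rule borel_open, rule open_sums, rule disjI1, rule oA(1))
  qed
  finally show ?thesis unfolding \<alpha>_def \<beta>_def by (simp add: algebra_simps)
qed

text \<open>Induction on the total number of boxes. If the second family has several members, the
  roles may be exchanged; two single boxes are the base case.\<close>

lemma brunn_minkowski_boxes:
  fixes \<A> \<B> :: "'a::euclidean_space set set"
  assumes "open_boxes \<A>" "open_boxes \<B>"
  shows "2 ^ DIM('a) * sqrt (measure lborel (\<Union>\<A>) * measure lborel (\<Union>\<B>))
        \<le> measure lborel (set_sum (\<Union>\<A>) (\<Union>\<B>))"
  using assms
proof (induction "card \<A> + card \<B>" arbitrary: \<A> \<B> rule: less_induct)
  case less
  consider "1 < card \<A>" | "1 < card \<B>" | "card \<A> = 1" "card \<B> = 1"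
    using less.prems unfolding open_boxes_def by (metis One_nat_def Suc_lessI card_gt_0_iff)
  then show ?case
  proof cases
    case 1
    show ?thesis
      by (rule brunn_minkowski_cut_step[OF less.prems 1 less.hyps])
  next
    case 2
    have "2 ^ DIM('a) * sqrt (measure lborel (\<Union>\<B>) * measure lborel (\<Union>\<A>))
        \<le> measure lborel (set_sum (\<Union>\<B>) (\<Union>\<A>))"
      by (rule brunn_minkowski_cut_step[OF less.prems(2,1) 2]) (rule less.hyps, simp_all add: add.commute)
    then show ?thesis 
      by (simp only: set_sum_commute[of "\<Union>\<B>"] mult.commute[of "measure lborel (\<Union>\<B>)"])
  next
    case 3
    then obtain U V where UV: "\<A> = {U}" "\<B> = {V}" by (metis card_1_singletonE)
    have mem: "U \<in> \<A>" "V \<in> \<B>" using UV by auto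
    obtain a b where "U = box a b" using less.prems(1) mem(1) unfolding open_boxes_def by metis
    moreover obtain c d where "V = box c d" using less.prems(2) mem(2) unfolding open_boxes_def by metis
    moreover have "U \<noteq> {}" "V \<noteq> {}" using less.prems mem by (auto simp: open_boxes_def)
    ultimately show ?thesis using UV measure_set_sum_box[of a b c d] by simp
  qed
qed

lemma interior_cbox_null: "cbox a b - box a b \<in> null_sets lborel"
  using negligible_frontier_interval[of a b]
  by (simp add: negligible_iff_null_sets null_sets_completion_iff)

lemma uminus_box: "uminus ` box a b = box (- b) (- a :: 'a::euclidean_space)"
  by (force simp: mem_box image_iff intro: bexI[of _ "- x" for x])

text \<open>Up to a null set an open set is an increasing union of finite families of disjoint open
  boxes. Reflection preserves volume, so the geometric mean collapses to the volume itself.\<close>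

lemma brunn_minkowski_open_symmetric:
  fixes U :: "'a::euclidean_space set"
  assumes U: "open U" "bounded U"
  shows "2 ^ DIM('a) * measure lborel U \<le> measure lborel (set_sum U (uminus ` U))"
proof (cases "U = {}")
  case False
  obtain r where r: "0 < r" "U \<subseteq> cbox (- (r *\<^sub>R One)) (r *\<^sub>R One)"
  proof -
    obtain c where "U \<subseteq> cbox (-c) (c::'a)" using bounded_subset_cbox_symmetric[OF U(2)] by blast
    moreover have "cbox (-c) c \<subseteq> cbox (- ((norm c + 1) *\<^sub>R One)) ((norm c + 1) *\<^sub>R One)"
    proof
      fix x assume x: "x \<in> cbox (-c) c"
      have "\<bar>x \<bullet> i\<bar> \<le> norm c + 1" if "i \<in> Basis" for i
        using x that Basis_le_norm[OF that, of c] by (fastforce simp: mem_box)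
      then show "x \<in> cbox (- ((norm c + 1) *\<^sub>R One)) ((norm c + 1) *\<^sub>R One)"
        by (force simp: mem_box abs_le_iff)
    qed
    ultimately show ?thesis using that[of "norm c + 1"] by (auto simp: add_nonneg_pos)
  qed
  \<comment> \<open>The gauge forces every cell of the covering, being tagged by a point of
    \<open>U\<close>, to lie inside \<open>U\<close>.\<close>
  define g where "g x = (if x \<in> U then U else UNIV)" for x
  have "gauge g" using U by (auto simp: gauge_def g_def)
  moreover have "box (- (r *\<^sub>R One)) (r *\<^sub>R One :: 'a) \<noteq> {}" using r by (auto simp: box_ne_empty)
  ultimately obtain \<D> where \<D>: "countable \<D>"
    "\<And>K. K \<in> \<D> \<Longrightarrow> interior K \<noteq> {} \<and> (\<exists>c d. K = cbox c d)"
    "pairwise (\<lambda>A B. interior A \<inter> interior B = {}) \<D>"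
    "\<And>K. K \<in> \<D> \<Longrightarrow> \<exists>x \<in> U \<inter> K. K \<subseteq> g x" "U \<subseteq> \<Union>\<D>"
    using covering_lemma[OF r(2)] by metis
  have sub: "K \<subseteq> U" if "K \<in> \<D>" for K using \<D>(4)[OF that] by (auto simp: g_def)
  have \<D>0: "\<D> \<noteq> {}" using False \<D>(5) by auto
  define f where "f = from_nat_into \<D>"
  have f: "range f = \<D>" unfolding f_def using \<D>(1) \<D>0 by simp
  define A where "A k = (\<Union>j<k. interior (f j))" for k
  have inc: "incseq A" by (force simp: A_def incseq_def)
  have oA: "open (A k)" for k by (auto simp: A_def)
  have AU: "A k \<subseteq> U" for k
    unfolding A_def
  proof (intro UN_least)
    fix j
    have "f j \<in> \<D>" using f by blast
    then show "interior (f j) \<subseteq> U" using sub[of "f j"] interior_subset[of "f j"] by blast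
  qed
  have UA: "(\<Union>k. A k) = (\<Union>K\<in>\<D>. interior K)" unfolding A_def f[symmetric] by auto
  have "measure lborel U = measure lborel (\<Union>k. A k)"
  proof -
    have nulls: "(\<Union>K\<in>\<D>. K - interior K) \<in> null_sets lborel"
    proof (rule null_sets_UN'[OF \<D>(1)])
      fix K assume "K \<in> \<D>"
      then obtain c d where "K = cbox c d" using \<D>(2) by blast
      then show "K - interior K \<in> null_sets lborel" using interior_cbox_null[of c d] by simp
    qed
    then have "measure lborel (U - (\<Union>K\<in>\<D>. K - interior K)) = measure lborel U"
      using U by (intro measure_Diff_null_set) auto
    moreover have "measure lborel (U - (\<Union>K\<in>\<D>. K - interior K)) \<le> measure lborel (\<Union>k. A k)"
    proof (rule measure_lborel_mono)
      show "U - (\<Union>K\<in>\<D>. K - interior K) \<subseteq> (\<Union>k. A k)" unfolding UA using \<D>(5) by blast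
      show "bounded (\<Union>k. A k)" using AU U by (meson UN_least bounded_subset)
      have "(\<Union>K\<in>\<D>. K - interior K) \<in> sets borel"
        using nulls by (auto simp: null_sets_def)
      then show "U - (\<Union>K\<in>\<D>. K - interior K) \<in> sets borel" using U by auto
      show "(\<Union>k. A k) \<in> sets borel" using oA by auto
    qed
    moreover have "measure lborel (\<Union>k. A k) \<le> measure lborel U"
      using U AU oA by (intro measure_lborel_mono) auto
    ultimately show ?thesis by linarith
  qed
  moreover have "(\<lambda>k. measure lborel (A k)) \<longlonglongrightarrow> measure lborel (\<Union>k. A k)"
  proof (rule Lim_measure_incseq[OF _ inc])
    have "bounded (\<Union>k. A k)" using AU U by (meson UN_least bounded_subset)
    then show "emeasure lborel (\<Union>k. A k) \<noteq> \<infinity>" using emeasure_bounded_finite less_imp_neq by auto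
  qed (use oA in auto)
  ultimately have lim: "(\<lambda>k. 2 ^ DIM('a) * measure lborel (A k)) \<longlonglongrightarrow> 2 ^ DIM('a) * measure lborel U"
    by (intro tendsto_mult_left) simp
  have "2 ^ DIM('a) * measure lborel (A k) \<le> measure lborel (set_sum U (uminus ` U))" for k
  proof (cases "k = 0")
    case True then show ?thesis by (simp add: A_def)
  next
    case k: False
    define \<A> where "\<A> = interior ` f ` {..<k}"
    have \<A>: "open_boxes \<A>"
      unfolding open_boxes_def
    proof (intro conjI ballI)
      show "finite \<A>" "\<A> \<noteq> {}" using k by (auto simp: \<A>_def)
      show "pairwise disjnt \<A>"
      proof (rule pairwiseI)
        fix X Y assume "X \<in> \<A>" "Y \<in> \<A>" "X \<noteq> Y"
        then obtain i j where ij: "X = interior (f i)" "Y = interior (f j)" unfolding \<A>_def by blast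
        moreover have "f i \<noteq> f j" using ij \<open>X \<noteq> Y\<close> by auto
        moreover have "f i \<in> \<D>" "f j \<in> \<D>" using f by auto
        ultimately show "disjnt X Y" using pairwiseD[OF \<D>(3), of "f i" "f j"] by (simp add: disjnt_def)
      qed
      fix X assume "X \<in> \<A>"
      then obtain i where i: "X = interior (f i)" by (auto simp: \<A>_def)
      have "f i \<in> \<D>" using f by auto
      then obtain c d where "f i = cbox c d" "interior (f i) \<noteq> {}" using \<D>(2) by blast
      then show "X \<noteq> {}" "\<exists>a b. X = box a b" using i by auto
    qed
    have neg: "open_boxes ((`) uminus ` \<A>)"
      unfolding open_boxes_def
    proof (intro conjI ballI)
      show "finite ((`) uminus ` \<A>)" "(`) uminus ` \<A> \<noteq> {}" using \<A> by (auto simp: open_boxes_def)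
      show "pairwise disjnt ((`) uminus ` \<A>)"
      proof (rule pairwiseI)
        fix X Y assume "X \<in> (`) uminus ` \<A>" "Y \<in> (`) uminus ` \<A>" "X \<noteq> Y"
        then obtain P Q where "P \<in> \<A>" "Q \<in> \<A>" "X = uminus ` P" "Y = uminus ` Q" "P \<noteq> Q" by auto
        moreover from this have "disjnt P Q" using \<A> by (auto simp: open_boxes_def dest: pairwiseD)
        ultimately show "disjnt X Y" by (auto simp: disjnt_def)
      qed
      fix X assume "X \<in> (`) uminus ` \<A>"
      then obtain P where P: "P \<in> \<A>" "X = uminus ` P" by auto
      then obtain a b where "P = box a b" "P \<noteq> {}" using \<A> unfolding open_boxes_def by metis
      then show "X \<noteq> {}" "\<exists>a b. X = box a b" using P(2) uminus_box[of a b] by auto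
    qed
    have UnA: "\<Union>\<A> = A k" by (auto simp: \<A>_def A_def)
    have UnN: "\<Union>((`) uminus ` \<A>) = uminus ` A k" unfolding UnA[symmetric] by blast
    have m: "measure lborel (uminus ` A k) = measure lborel (A k)"
    proof -
      have "distr lborel borel (uminus :: 'a \<Rightarrow> 'a) = lborel" using lborel_affine[of "-1" "0::'a"] by (simp add: density_1)
      then have "measure lborel (A k) = measure (distr lborel borel (uminus :: 'a \<Rightarrow> 'a)) (A k)" by simp
      also have "\<dots> = measure lborel (uminus -` A k)" using oA by (subst measure_distr) auto
      also have "uminus -` A k = uminus ` A k" by (force intro: rev_image_eqI)
      finally show ?thesis by simp
    qed
    have "2 ^ DIM('a) * measure lborel (A k) \<le> measure lborel (set_sum (A k) (uminus ` A k))"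
      using brunn_minkowski_boxes[OF \<A> neg] unfolding UnA UnN m by simp
    also have "\<dots> \<le> measure lborel (set_sum U (uminus ` U))"
    proof (rule measure_lborel_mono)
      show "set_sum (A k) (uminus ` A k) \<subseteq> set_sum U (uminus ` U)" using AU by blast
      show "bounded (set_sum U (uminus ` U))" using U by (intro bounded_set_sum) auto
      show "set_sum (A k) (uminus ` A k) \<in> sets borel" using oA by (intro borel_open open_sums) auto
      show "set_sum U (uminus ` U) \<in> sets borel" using U by (intro borel_open open_sums) auto
    qed
    finally show ?thesis .
  qed
  then show ?thesis using LIMSEQ_le_const2[OF lim] by blast
qed auto

text \<open>Differences of points of \<open>S\<close> have norm at most the diameter
  \<open>d\<close>, so they lie in a ball of radius \<open>d\<close>, whose volume is
  \<open>2^n\<close> times the cost of \<open>S\<close>. The closure is measured because the sets of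
  a cover need not be measurable.\<close>

theorem isodiametric:
  fixes S :: "'a::euclidean_space set"
  assumes "bounded S"
  shows "emeasure lborel (closure S) \<le> hcost DIM('a) S"
proof (cases "S = {}")
  case False
  define n where "n = DIM('a)"
  define d where "d = diameter S"
  have d: "0 \<le> d" using assms by (simp add: d_def diameter_ge_0)
  have *: "measure lborel (closure S) \<le> hausdorff_const n * (d + 2 * \<delta>) ^ n" if \<delta>: "0 < \<delta>" for \<delta>
  proof -
    \<comment> \<open>The inequality was obtained for open sets, hence a neighbourhood of
      \<open>S\<close>; its width \<open>\<delta>\<close> is sent to 0 at the end.\<close>
    define U where "U = (\<Union>x\<in>S. ball x \<delta>)"
    have U: "open U" "bounded U"
    proof -
      obtain e where "\<And>x. x \<in> S \<Longrightarrow> norm x \<le> e" using assms by (auto simp: bounded_iff)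
      then have "norm y \<le> e + \<delta>" if "y \<in> U" for y
        using that norm_triangle_sub[of y] unfolding U_def
        by (smt (verit) UN_iff dist_norm mem_ball norm_minus_commute)
      then show "bounded U" by (auto simp: bounded_iff)
    qed (auto simp: U_def)
    have clU: "closure S \<subseteq> U"
    proof
      fix x assume "x \<in> closure S"
      then obtain y where "y \<in> S" "dist y x < \<delta>" using \<delta> by (auto simp: closure_approachable)
      then show "x \<in> U" by (auto simp: U_def)
    qed
    have sub: "set_sum U (uminus ` U) \<subseteq> cball 0 (d + 2 * \<delta>)"
    proof
      fix z assume "z \<in> set_sum U (uminus ` U)"
      then obtain x y where xy: "x \<in> U" "y \<in> U" "z = x - y" by auto
      then obtain a b where ab: "a \<in> S" "b \<in> S" "dist a x < \<delta>" "dist b y < \<delta>" by (auto simp: U_def)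
      have "norm z = dist x y" by (simp add: xy dist_norm)
      also have "\<dots> \<le> dist a x + dist a b + dist b y"
        using dist_triangle[of x y a] dist_triangle[of a y b] by (simp add: dist_commute)
      also have "\<dots> \<le> d + 2 * \<delta>"
        using ab diameter_bounded_bound[OF assms, of a b] by (simp add: d_def)
      finally show "z \<in> cball 0 (d + 2 * \<delta>)" by simp
    qed
    have "2 ^ n * measure lborel (closure S) \<le> 2 ^ n * measure lborel U"
      using U clU by (intro mult_left_mono measure_lborel_mono) auto
    also have "\<dots> \<le> measure lborel (set_sum U (uminus ` U))"
      unfolding n_def by (rule brunn_minkowski_open_symmetric[OF U])
    also have "\<dots> \<le> measure lborel (cball (0::'a) (d + 2 * \<delta>))"
    proof (rule measure_lborel_mono[OF sub])
      show "set_sum U (uminus ` U) \<in> sets borel" by (rule borel_open, rule open_sums, rule disjI1, rule U(1))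
    qed auto
    also have "\<dots> = unit_ball_vol n * (d + 2 * \<delta>) ^ n"
      using d \<delta> by (simp add: content_cball n_def)
    finally show ?thesis
      by (simp add: hausdorff_const_def unit_ball_vol_def field_simps)
  qed
  have "((\<lambda>\<delta>. hausdorff_const n * (d + 2 * \<delta>) ^ n) \<longlongrightarrow> hausdorff_const n * (d + 2 * 0) ^ n) (at_right 0)"
    by (intro tendsto_intros)
  then have "measure lborel (closure S) \<le> hausdorff_const n * (d + 2 * 0) ^ n"
    by (rule tendsto_lowerbound) (use * in \<open>auto simp: eventually_at_filter\<close>)
  moreover have "emeasure lborel (closure S) = measure lborel (closure S)"
    using emeasure_bounded_finite[OF bounded_closure[OF assms]] by (intro emeasure_eq_ennreal_measure) auto
  ultimately show ?thesis
    using False by (simp add: hcost_def n_def d_def ennreal_leI)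
qed auto

text \<open>Any cover, by sets of whatever shape, costs at least the volumes of the closures, by the
  isodiametric inequality. This is the lower half of the equality of the two measures.\<close>

lemma lborel_le_hausdorff_outer:
  fixes A :: "'a::euclidean_space set"
  assumes "A \<in> sets borel"
  shows "emeasure lborel A \<le> hausdorff_outer DIM('a) A"
proof -
  have "emeasure lborel A \<le> hausdorff_pre DIM('a) 1 A"
  proof (rule hausdorff_pre_greatest)
    fix C assume C: "A \<subseteq> (\<Union>i::nat. C i)" "\<And>i. bounded (C i)"
    have "A \<subseteq> (\<Union>i. closure (C i))" using C(1) closure_subset by blast
    then have "emeasure lborel A \<le> emeasure lborel (\<Union>i. closure (C i))"
      by (intro emeasure_mono) auto
    also have "\<dots> \<le> (\<Sum>i. emeasure lborel (closure (C i)))"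
      by (intro emeasure_subadditive_countably) auto
    also have "\<dots> \<le> (\<Sum>i. hcost DIM('a) (C i))"
      by (intro suminf_le isodiametric C) auto
    finally show "emeasure lborel A \<le> (\<Sum>i. hcost DIM('a) (C i))" .
  qed
  also have "\<dots> \<le> hausdorff_outer DIM('a) A" by (rule hausdorff_pre_le_outer) simp
  finally show ?thesis .
qed

lemma hausdorff_pre_single:
  assumes "bounded D" "diameter D \<le> \<delta>" "0 \<le> \<delta>"
  shows "hausdorff_pre s \<delta> D \<le> hcost s D"
proof -
  define C where "C i = (if i = 0 then D else {})" for i :: nat
  have "hausdorff_pre s \<delta> D \<le> (\<Sum>i. hcost s (C i))"
    using assms by (intro hausdorff_pre_le) (auto simp: C_def split: if_splits)
  also have "\<dots> = (\<Sum>i<1. hcost s (C i))" by (rule suminf_finite) (auto simp: C_def)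
  finally show ?thesis by (simp add: C_def)
qed

lemma hausdorff_pre_countable_family:
  fixes g :: "'i \<Rightarrow> 'a::euclidean_space set"
  assumes D: "countable D" and le: "\<And>i. i \<in> D \<Longrightarrow> hausdorff_pre s \<delta> (f i) \<le> c * emeasure lborel (g i)"
    and g: "\<And>i. i \<in> D \<Longrightarrow> g i \<in> sets borel" "disjoint_family_on g D" "\<And>i. i \<in> D \<Longrightarrow> g i \<subseteq> U"
    and U: "U \<in> sets borel" and "0 \<le> \<delta>"
  shows "hausdorff_pre s \<delta> (\<Union>i\<in>D. f i) \<le> c * emeasure lborel U"
proof -
  define J where "J = to_nat_on D ` D"
  define h where "h j = inv_into D (to_nat_on D) j" for j
  have inj: "inj_on (to_nat_on D) D" using D by (rule inj_on_to_nat_on)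
  have h: "h (to_nat_on D i) = i" if "i \<in> D" for i using inj that by (simp add: h_def)
  have hD: "h j \<in> D" if "j \<in> J" for j using that h by (auto simp: J_def)
  define F where "F j = (if j \<in> J then f (h j) else {})" for j
  define G where "G j = (if j \<in> J then g (h j) else {})" for j
  have "(\<Union>i\<in>D. f i) = (\<Union>j. F j)"
    using h by (force simp: F_def J_def split: if_splits)
  then have "hausdorff_pre s \<delta> (\<Union>i\<in>D. f i) \<le> (\<Sum>j. hausdorff_pre s \<delta> (F j))"
    using hausdorff_pre_Union[OF \<open>0 \<le> \<delta>\<close>, of s F] by simp
  also have "\<dots> \<le> (\<Sum>j. c * emeasure lborel (G j))"
    using le hD hausdorff_pre_empty[OF \<open>0 \<le> \<delta>\<close>, of s]
    by (intro suminf_le allI) (auto simp: F_def G_def)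
  also have "\<dots> = c * (\<Sum>j. emeasure lborel (G j))" by simp
  also have "(\<Sum>j. emeasure lborel (G j)) = emeasure lborel (\<Union>j. G j)"
  proof (rule suminf_emeasure)
    show "range G \<subseteq> sets lborel" using g(1) hD by (auto simp: G_def)
    show "disjoint_family G"
      unfolding disjoint_family_on_def
    proof (intro ballI impI)
      fix i j :: nat assume "i \<noteq> j"
      show "G i \<inter> G j = {}"
      proof (cases "i \<in> J \<and> j \<in> J")
        case True
        then have "h i \<noteq> h j" using \<open>i \<noteq> j\<close> h by (auto simp: J_def)
        then show ?thesis using True hD g(2) by (auto simp: G_def disjoint_family_on_def)
      qed (auto simp: G_def)
    qed
  qed
  also have "c * emeasure lborel (\<Union>j. G j) \<le> c * emeasure lborel U"
    using g(3) hD U by (intro mult_left_mono emeasure_mono) (auto simp: G_def split: if_splits)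
  finally show ?thesis .
qed


lemma hausdorff_pre_Un:
  assumes "0 \<le> \<delta>"
  shows "hausdorff_pre s \<delta> (A \<union> B) \<le> hausdorff_pre s \<delta> A + hausdorff_pre s \<delta> B"
proof -
  define C where "C i = (if i = 0 then A else if i = 1 then B else {})" for i :: nat
  have "hausdorff_pre s \<delta> (A \<union> B) \<le> hausdorff_pre s \<delta> (\<Union>i. C i)"
    by (intro hausdorff_pre_mono) (force simp: C_def split: if_splits)
  also have "\<dots> \<le> (\<Sum>i. hausdorff_pre s \<delta> (C i))" by (rule hausdorff_pre_Union[OF assms])
  also have "\<dots> = (\<Sum>i<2. hausdorff_pre s \<delta> (C i))"
    by (rule suminf_finite) (auto simp: C_def hausdorff_pre_empty[OF assms])
  also have "\<dots> = hausdorff_pre s \<delta> A + hausdorff_pre s \<delta> B"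
    by (simp add: numeral_2_eq_2 C_def)
  finally show ?thesis .
qed

text \<open>Inside an open set of tiny volume the null set is covered by dyadic cubes. A cube of
  side \<open>l\<close> has diameter \<open>sqrt n * l\<close>, so it costs the fixed multiple
  \<open>c\<close> of its volume. Boundedness provides the box that is subdivided.\<close>

lemma hausdorff_outer_null_bounded:
  fixes Z :: "'a::euclidean_space set"
  assumes Z: "Z \<in> null_sets lborel" and r: "0 < r" and sub: "Z \<subseteq> cbox (- (r *\<^sub>R One)) (r *\<^sub>R One)"
  shows "hausdorff_outer DIM('a) Z = 0"
proof -
  define n where "n = DIM('a)"
  define c where "c = hausdorff_const n * sqrt (real n) ^ n"
  have "hausdorff_pre n \<delta> Z \<le> 0" if \<delta>: "0 < \<delta>" for \<delta>
  proof (rule ennreal_le_epsilon)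
    fix e :: real assume e: "0 < e"
    have c: "0 \<le> c" unfolding c_def by (intro mult_nonneg_nonneg hausdorff_const_nonneg) auto
    \<comment> \<open>Dividing by \<open>c + 1\<close> makes the final bound
      \<open>c * e / (c + 1)\<close> at most \<open>e\<close>, also when \<open>c\<close> is
      0.\<close>
    obtain U where U: "open U" "Z \<subseteq> U" "emeasure lborel (U - Z) < ennreal (e / (c + 1))"
      using outer_regular_lborel[of Z "e / (c + 1)"] Z e c by (auto simp: null_sets_def)
    have "emeasure lborel U \<le> emeasure lborel (U - Z) + emeasure lborel Z"
      using U Z emeasure_subadditive[of "U - Z" lborel Z] by (auto simp: Un_absorb2 null_sets_def)
    with U(3) Z have eU: "emeasure lborel U \<le> ennreal (e / (c + 1))" by (auto simp: null_sets_def)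
    define g where "g x = (if x \<in> Z then ball x (\<delta> / 2) \<inter> U else UNIV)" for x
    have gg: "gauge g" using U \<delta> by (auto simp: gauge_def g_def)
    have bx: "box (- (r *\<^sub>R One)) (r *\<^sub>R One :: 'a) \<noteq> {}" using r by (auto simp: box_ne_empty)
    obtain \<D> where \<D>: "countable \<D>" "\<Union>\<D> \<subseteq> cbox (- (r *\<^sub>R One)) (r *\<^sub>R One)"
      "\<And>K. K \<in> \<D> \<Longrightarrow> interior K \<noteq> {} \<and> (\<exists>c d. K = cbox c d)"
      "pairwise (\<lambda>A B. interior A \<inter> interior B = {}) \<D>"
      "\<And>K. K \<in> \<D> \<Longrightarrow> \<exists>x \<in> Z \<inter> K. K \<subseteq> g x"
      "\<And>u v. cbox u v \<in> \<D> \<Longrightarrow> \<exists>n. \<forall>i \<in> Basis. v \<bullet> i - u \<bullet> i = ((r *\<^sub>R One) \<bullet> i - (- (r *\<^sub>R One)) \<bullet> i) / 2^n"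
      "Z \<subseteq> \<Union>\<D>"
    proof (rule covering_lemma[OF sub bx gg], goal_cases)
      case (1 \<D>)
      show ?case by (rule that[OF 1(2-8)])
    qed
    have gz: "\<exists>x. K \<subseteq> ball x (\<delta> / 2) \<inter> U" if "K \<in> \<D>" for K
      using \<D>(5)[OF that] by (auto simp: g_def)
    have "hausdorff_pre n \<delta> (\<Union>K\<in>\<D>. K) \<le> ennreal c * emeasure lborel U"
    proof (rule hausdorff_pre_countable_family[OF \<D>(1)])
      fix K assume K: "K \<in> \<D>"
      obtain u v where uv: "K = cbox u v" using \<D>(3)[OF K] by blast
      \<comment> \<open>All sides of a cell have the same length, so cells are true cubes and the
        ratio of diameter to side is the same for all of them.\<close>
      then obtain m where m: "\<And>i. i \<in> Basis \<Longrightarrow> v \<bullet> i - u \<bullet> i = 2 * r / 2 ^ m"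
        using \<D>(6)[of u v] K by (auto simp: inner_simps)
      define l where "l = 2 * r / 2 ^ m"
      have l: "0 < l" using r by (simp add: l_def)
      have le: "u \<bullet> i \<le> v \<bullet> i" if "i \<in> Basis" for i using m[OF that] l by (simp add: l_def)
      obtain x where x: "K \<subseteq> ball x (\<delta> / 2)" using gz[OF K] by blast
      have d1: "diameter K \<le> \<delta>"
        using diameter_subset[OF x] \<delta> by simp
      have "diameter K = sqrt (\<Sum>i\<in>(Basis::'a set). l\<^sup>2)"
      proof -
        have "(dist (u \<bullet> i) (v \<bullet> i))\<^sup>2 = l\<^sup>2" if "i \<in> Basis" for i
          using m[OF that] by (simp add: dist_real_def l_def power2_commute[of "u \<bullet> i"])
        then show ?thesis
          unfolding uv using le by (subst diameter_cbox) (auto simp: euclidean_dist_l2[where 'a='a] L2_set_def)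
      qed
      also have "\<dots> = sqrt (real n) * l" using l by (simp add: real_sqrt_mult n_def)
      finally have d2: "diameter K = sqrt (real n) * l" .
      have "K \<noteq> {}" using \<D>(3)[OF K] by auto
      then have "hcost n K = ennreal (c * l ^ n)"
        by (simp add: hcost_def d2 c_def power_mult_distrib algebra_simps)
      also have "\<dots> = ennreal c * emeasure lborel (interior K)"
        using le m l c by (simp add: uv emeasure_lborel_box_eq ennreal_mult' inner_diff_left l_def n_def)
      finally have "hcost n K = ennreal c * emeasure lborel (interior K)" .
      moreover have "hausdorff_pre n \<delta> K \<le> hcost n K"
        using d1 \<delta> uv by (intro hausdorff_pre_single) auto
      ultimately show "hausdorff_pre n \<delta> K \<le> ennreal c * emeasure lborel (interior K)" by simp
    next
      show "disjoint_family_on interior \<D>" using \<D>(4) by (auto simp: disjoint_family_on_def dest: pairwiseD)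
      show "interior K \<subseteq> U" if "K \<in> \<D>" for K using gz[OF that] interior_subset[of K] by blast
    qed (use U \<delta> in auto)
    also have "\<dots> \<le> ennreal c * ennreal (e / (c + 1))" by (intro mult_left_mono eU) auto
    also have "\<dots> = ennreal (c * (e / (c + 1)))" using c e by (intro ennreal_mult[symmetric]) auto
    also have "\<dots> \<le> ennreal e" using c e by (intro ennreal_leI) (simp add: field_simps)
    finally have "hausdorff_pre n \<delta> (\<Union>K\<in>\<D>. K) \<le> ennreal e" .
    moreover have "hausdorff_pre n \<delta> Z \<le> hausdorff_pre n \<delta> (\<Union>K\<in>\<D>. K)"
      using \<D>(7) by (intro hausdorff_pre_mono) simp
    ultimately show "hausdorff_pre n \<delta> Z \<le> 0 + ennreal e" by (metis add_0 order_trans)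
  qed
  then have "hausdorff_outer n Z \<le> 0" by (rule hausdorff_outer_least)
  then show ?thesis by (simp add: n_def)
qed

lemma hausdorff_outer_null:
  fixes Z :: "'a::euclidean_space set"
  assumes Z: "Z \<in> null_sets lborel"
  shows "hausdorff_outer DIM('a) Z = 0"
proof -
  define B where "B k = Z \<inter> cbox (- (real (Suc k) *\<^sub>R One)) (real (Suc k) *\<^sub>R One)" for k
  have "hausdorff_outer DIM('a) (B k) = 0" for k
  proof (rule hausdorff_outer_null_bounded)
    show "B k \<in> null_sets lborel"
      unfolding B_def using Z by (intro null_set_Int2) auto
  qed (auto simp: B_def)
  moreover have "Z \<subseteq> (\<Union>k. B k)"
  proof
    fix x assume "x \<in> Z"
    obtain k where k: "norm x \<le> real k" using real_arch_simple by blast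
    have "\<bar>x \<bullet> i\<bar> \<le> real (Suc k)" if "i \<in> Basis" for i using Basis_le_norm[OF that, of x] k by simp
    then have "x \<in> B k" using \<open>x \<in> Z\<close> by (force simp: B_def mem_box abs_le_iff)
    then show "x \<in> (\<Union>k. B k)" by blast
  qed
  ultimately have "hausdorff_outer DIM('a) Z \<le> 0"
    using hausdorff_outer_mono[of Z "\<Union>k. B k" "DIM('a)"] hausdorff_outer_Union[of "DIM('a)" B] by simp
  then show ?thesis by simp
qed

text \<open>By Vitali's theorem \<open>U\<close> is filled with small disjoint balls up to a null
  set. The normalising constant makes a ball cost exactly its volume, and the exceptional null set
  costs nothing by the cube covering.\<close>

lemma hausdorff_outer_open_le:
  fixes U :: "'a::euclidean_space set"
  assumes U: "open U"
  shows "hausdorff_outer DIM('a) U \<le> emeasure lborel U"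
proof (rule hausdorff_outer_least)
  define n where "n = DIM('a)"
  fix \<delta> :: real assume \<delta>: "0 < \<delta>"
  define K where "K = {(x, r). 0 < r \<and> ball x r \<subseteq> U \<and> 2 * r \<le> \<delta>}"
  obtain C where C: "countable C" "C \<subseteq> K"
     "pairwise (\<lambda>i j. disjnt (ball (fst i) (snd i)) (ball (fst j) (snd j))) C"
     "negligible (U - (\<Union>i \<in> C. ball (fst i) (snd i)))"
  proof (rule Vitali_covering_theorem_balls[of U K fst snd])
    fix x and d :: real assume "x \<in> U" "0 < d"
    then obtain e where "0 < e" "ball x e \<subseteq> U" using U by (meson open_contains_ball)
    then have "(x, min e (min (d/2) (\<delta>/2))) \<in> K"
      using \<delta> \<open>0 < d\<close> by (auto simp: K_def)
    then show "\<exists>i. i \<in> K \<and> x \<in> ball (fst i) (snd i) \<and> snd i < d"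
      using \<open>0 < e\<close> \<open>0 < d\<close> \<delta> by (intro exI[of _ "(x, min e (min (d/2) (\<delta>/2)))"]) auto
  qed
  let ?V = "\<Union>i\<in>C. ball (fst i) (snd i)"
  have "hausdorff_pre n \<delta> ?V \<le> 1 * emeasure lborel U"
  proof (rule hausdorff_pre_countable_family[OF C(1)])
    fix i assume "i \<in> C"
    then obtain x r where i: "i = (x, r)" "0 < r" "ball x r \<subseteq> U" "2 * r \<le> \<delta>" using C(2) by (auto simp: K_def)
    have "hausdorff_pre n \<delta> (ball x r) \<le> hcost n (ball x r)"
      using i \<delta> by (intro hausdorff_pre_single) auto
    also have "\<dots> = emeasure lborel (ball x r)"
      using i by (simp add: hcost_def emeasure_ball hausdorff_const_def unit_ball_vol_def n_def power_mult_distrib)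
    finally show "hausdorff_pre n \<delta> (ball (fst i) (snd i)) \<le> 1 * emeasure lborel (ball (fst i) (snd i))"
      using i by simp
    show "ball (fst i) (snd i) \<subseteq> U" using i by simp
  next
    show "disjoint_family_on (\<lambda>i. ball (fst i) (snd i)) C"
      using C(3) unfolding disjoint_family_on_def pairwise_def disjnt_def by blast
  qed (use U \<delta> in auto)
  moreover have "hausdorff_pre n \<delta> (U - ?V) = 0"
  proof -
    have "U - ?V \<in> sets borel" using U by (intro sets.Diff borel_open open_UN) auto
    then have "hausdorff_outer n (U - ?V) = 0"
      using C(4) unfolding n_def
      by (intro hausdorff_outer_null) (simp add: negligible_iff_null_sets null_sets_completion_iff)
    then show ?thesis using hausdorff_pre_le_outer[OF \<delta>, of n "U - ?V"] by simp
  qed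
  moreover have "hausdorff_pre n \<delta> U \<le> hausdorff_pre n \<delta> (?V \<union> (U - ?V))"
    by (rule hausdorff_pre_mono) blast
  moreover have "hausdorff_pre n \<delta> (?V \<union> (U - ?V)) \<le> hausdorff_pre n \<delta> ?V + hausdorff_pre n \<delta> (U - ?V)"
    using \<delta> by (intro hausdorff_pre_Un) simp
  ultimately have "hausdorff_pre n \<delta> U \<le> emeasure lborel U"
    by simp
  then show "hausdorff_pre DIM('a) \<delta> U \<le> emeasure lborel U" by (simp add: n_def)
qed

theorem hausdorff_outer_eq_lborel:
  fixes A :: "'a::euclidean_space set"
  assumes A: "A \<in> sets borel"
  shows "hausdorff_outer DIM('a) A = emeasure lborel A"
proof (rule antisym[OF _ lborel_le_hausdorff_outer[OF A]])
  show "hausdorff_outer DIM('a) A \<le> emeasure lborel A"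
  proof (rule ennreal_le_epsilon)
    fix e :: real assume e: "0 < e"
    obtain U where U: "open U" "A \<subseteq> U" "emeasure lborel (U - A) < ennreal e"
      using outer_regular_lborel[OF A e] by auto
    have "hausdorff_outer DIM('a) A \<le> hausdorff_outer DIM('a) U" by (rule hausdorff_outer_mono[OF U(2)])
    also have "\<dots> \<le> emeasure lborel U" by (rule hausdorff_outer_open_le[OF U(1)])
    also have "\<dots> = emeasure lborel (A \<union> (U - A))" using U by (simp add: Un_absorb1)
    also have "\<dots> \<le> emeasure lborel A + emeasure lborel (U - A)"
      using A U by (intro emeasure_subadditive) auto
    also have "\<dots> \<le> emeasure lborel A + ennreal e" using U(3) by (intro add_left_mono) simp
    finally show "hausdorff_outer DIM('a) A \<le> emeasure lborel A + ennreal e" .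
  qed
qed

section \<open>Determinants over different index sets\<close>

text \<open>Determinant over an arbitrary index set: common ground for \<open>det\<close>, indexed
  by a finite type, and \<open>det_on\<close>, indexed by sets of naturals.\<close>

definition leibniz_det :: "'i set \<Rightarrow> ('i \<Rightarrow> 'i \<Rightarrow> real) \<Rightarrow> real" where
  "leibniz_det I A = (\<Sum>p | p permutes I. of_int (sign p) * (\<Prod>i\<in>I. A i (p i)))"

lemma det_on_eq_leibniz_det: "det_on = leibniz_det"
  by (intro ext) (simp add: det_on_def leibniz_det_def)

lemma det_eq_leibniz_det: "det A = leibniz_det UNIV (\<lambda>i j. A $ i $ j)"
  by (simp add: det_def leibniz_det_def)

text \<open>Conjugation by the bijection carries permutations of \<open>I\<close> to permutations of
  \<open>J\<close> and preserves signs.\<close>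

lemma leibniz_det_reindex:
  assumes I: "finite I" and f: "bij_betw f I J"
  shows "leibniz_det J A = leibniz_det I (\<lambda>i j. A (f i) (f j))"
proof -
  have inj: "inj_on f I" and J: "J = f ` I" using f by (auto simp: bij_betw_def)
  have "leibniz_det I (\<lambda>i j. A (f i) (f j))
      = (\<Sum>p | p permutes I. of_int (sign (map_permutation I f p)) * (\<Prod>i\<in>J. A i (map_permutation I f p i)))"
    unfolding leibniz_det_def
  proof (rule sum.cong[OF refl])
    fix p assume "p \<in> {p. p permutes I}"
    then have p: "p permutes I" by simp
    have "(\<Prod>i\<in>J. A i (map_permutation I f p i)) = (\<Prod>i\<in>I. A (f i) (map_permutation I f p (f i)))"
      unfolding J by (rule prod.reindex[OF inj, unfolded o_def])
    also have "\<dots> = (\<Prod>i\<in>I. A (f i) (f (p i)))"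
      using inj by (intro prod.cong) (auto simp: map_permutation_apply)
    moreover have "sign (map_permutation I f p) = sign p"
      using p inj I by (intro sign_map_permutation) auto
    ultimately show "of_int (sign p) * (\<Prod>i\<in>I. A (f i) (f (p i))) =
      of_int (sign (map_permutation I f p)) * (\<Prod>i\<in>J. A i (map_permutation I f p i))" by simp
  qed
  also have "\<dots> = leibniz_det J A"
    unfolding leibniz_det_def
  proof (rule sum.reindex_bij_betw[where h="map_permutation I f"
        and g="\<lambda>q. of_int (sign q) * (\<Prod>i\<in>J. A i (q i))"])
    show "bij_betw (map_permutation I f) {p. p permutes I} {q. q permutes J}"
    proof (rule bij_betw_byWitness[where f'="map_permutation J (inv_into I f)"])
      have inv: "bij_betw (inv_into I f) J I" by (rule bij_betw_inv_into[OF f])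
      show "map_permutation I f ` {p. p permutes I} \<subseteq> {q. q permutes J}"
        using map_permutation_permutes[OF f] by blast
      show "map_permutation J (inv_into I f) ` {q. q permutes J} \<subseteq> {p. p permutes I}"
        using map_permutation_permutes[OF inv] by blast
      show "\<forall>p\<in>{p. p permutes I}. map_permutation J (inv_into I f) (map_permutation I f p) = p"
        using f inj J by (auto intro!: map_permutation_compose_inv)
      show "\<forall>q\<in>{q. q permutes J}. map_permutation I f (map_permutation J (inv_into I f) q) = q"
        using inv inj J by (auto intro!: map_permutation_compose_inv simp: f_inv_into_f)
    qed
  qed
  finally show ?thesis by simp
qed

section \<open>Lebesgue measure under linear maps and on hyperplanes\<close>

text \<open>\<open>measure_linear_image\<close> asks for a well-ordered index type. An initial
  segment of the naturals with as many elements as \<open>'n\<close> carries such an order.\<close>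

typedef ('n::finite) ordered_index = "{..<CARD('n)}"
  morphisms rank_of ordered_index_of
  by (auto intro!: exI[of _ 0])

lemma card_ordered_index: "CARD('n::finite ordered_index) = CARD('n)"
  using type_definition.card[OF type_definition_ordered_index[where 'n='n]] by simp

instance ordered_index :: (finite) finite
proof
  have "card (UNIV :: 'a ordered_index set) > 0"
    using type_definition.card[OF type_definition_ordered_index[where 'n='a]] by simp
  then show "finite (UNIV :: 'a ordered_index set)" by (rule card_ge_0_finite)
qed

instantiation ordered_index :: (finite) wellorder
begin

definition less_eq_ordered_index :: "'a ordered_index \<Rightarrow> 'a ordered_index \<Rightarrow> bool" where
  "less_eq_ordered_index x y \<longleftrightarrow> rank_of x \<le> rank_of y"

definition less_ordered_index :: "'a ordered_index \<Rightarrow> 'a ordered_index \<Rightarrow> bool" where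
  "less_ordered_index x y \<longleftrightarrow> rank_of x < rank_of y"

instance
proof
  fix P :: "'a ordered_index \<Rightarrow> bool" and a :: "'a ordered_index"
  assume step: "\<And>x. (\<And>y. y < x \<Longrightarrow> P y) \<Longrightarrow> P x"
  show "P a"
  proof (induction a rule: measure_induct_rule[of rank_of])
    case less: (less a)
    show ?case
    proof (rule step)
      fix y assume "y < a"
      then show "P y" by (intro less.IH) (simp add: less_ordered_index_def)
    qed
  qed
qed (auto simp: less_eq_ordered_index_def less_ordered_index_def rank_of_inject)

end

text \<open>An index type with one element less (unless \<open>'n\<close> is a singleton), so that \<open>real ^ 'n pred_index\<close>
  is isometric to the hyperplanes of \<open>real ^ 'n\<close>.\<close>

typedef ('n::finite) pred_index = "{..<max 1 (CARD('n) - 1)}"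
  by (auto intro!: exI[of _ 0])

lemma card_pred_index: "CARD('n::finite pred_index) = max 1 (CARD('n) - 1)"
  using type_definition.card[OF type_definition_pred_index[where 'n='n]] by simp

instance pred_index :: (finite) finite
proof
  have "card (UNIV :: 'a pred_index set) > 0" by (simp add: card_pred_index)
  then show "finite (UNIV :: 'a pred_index set)" by (rule card_ge_0_finite)
qed

text \<open>Hausdorff measure depends on distances only, hence isometries transport Lebesgue measure
  even between different types of the same dimension.\<close>

lemma lborel_isometry_image:
  fixes f :: "'a::euclidean_space \<Rightarrow> 'b::euclidean_space"
  assumes "DIM('a) = DIM('b)" "A \<in> sets borel" "f ` A \<in> sets borel"
    and "\<And>x y. x \<in> A \<Longrightarrow> y \<in> A \<Longrightarrow> dist (f x) (f y) = dist x y"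
  shows "emeasure lborel (f ` A) = emeasure lborel A"
  using hausdorff_outer_isometry_image[of A f "DIM('b)"] assms
  by (simp flip: hausdorff_outer_eq_lborel)

lemma lborel_lipschitz_image_le:
  fixes f :: "'a::euclidean_space \<Rightarrow> 'a"
  assumes "A \<in> sets borel" "f ` A \<in> sets borel" "0 < L"
    and "\<And>x y. x \<in> A \<Longrightarrow> y \<in> A \<Longrightarrow> dist (f x) (f y) \<le> L * dist x y"
  shows "emeasure lborel (f ` A) \<le> ennreal (L ^ DIM('a)) * emeasure lborel A"
  using hausdorff_outer_lipschitz_image[of L A f "DIM('a)"] assms
  by (simp flip: hausdorff_outer_eq_lborel)

lemma borel_linear_bij_image:
  fixes f :: "'a::euclidean_space \<Rightarrow> 'b::euclidean_space"
  assumes "linear f" "linear g" "\<And>x. g (f x) = x" "\<And>y. f (g y) = y" "A \<in> sets borel"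
  shows "f ` A \<in> sets borel"
proof -
  have "f ` A = g -` A" using assms(3,4) by (auto simp: image_iff) metis
  moreover have "g \<in> borel_measurable borel"
    using assms(2) by (intro borel_measurable_continuous_onI linear_continuous_on) (simp add: linear_conv_bounded_linear)
  ultimately show ?thesis using assms(5) measurable_sets[of g borel borel A] by simp
qed

lemma lborel_linear_image_wellorder:
  fixes f :: "real^'n::{finite,wellorder} \<Rightarrow> real^'n::_"
  assumes "linear f" "linear g" "\<And>x. g (f x) = x" "\<And>y. f (g y) = y" "A \<in> sets borel" "bounded A"
  shows "emeasure lborel (f ` A) = ennreal \<bar>det (matrix f)\<bar> * emeasure lborel A"
proof -
  have B: "f ` A \<in> sets borel" by (rule borel_linear_bij_image[OF assms(1-5)])
  have bd: "bounded (f ` A)" using assms(1,6) by (intro bounded_linear_image) (simp_all add: linear_conv_bounded_linear)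
  have fin: "emeasure lborel (f ` A) = measure lborel (f ` A)" "emeasure lborel A = measure lborel A"
    using emeasure_bounded_finite[OF bd] emeasure_bounded_finite[OF assms(6)]
    by (auto intro!: emeasure_eq_ennreal_measure)
  have "A \<in> lmeasurable" using assms(5,6) by (intro bounded_set_imp_lmeasurable) auto
  from measure_linear_image[OF assms(1) this]
  have "measure lborel (f ` A) = \<bar>det (matrix f)\<bar> * measure lborel A"
    using B assms(5) by (simp add: measure_completion)
  then show ?thesis by (simp add: fin ennreal_mult')
qed

text \<open>Relabelling the coordinates by a bijection with the ordered index type is an isometry,
  so volumes do not change; the determinant does not change because rows and columns are relabelled
  alike.\<close>

lemma lborel_linear_image:
  fixes f :: "real^'n \<Rightarrow> real^'n"
  assumes lin: "linear f" "linear g" and inv: "\<And>x. g (f x) = x" "\<And>y. f (g y) = y"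
    and A: "A \<in> sets borel" "bounded A"
  shows "emeasure lborel (f ` A) = ennreal \<bar>det (matrix f)\<bar> * emeasure lborel A"
proof -
  obtain h :: "'n ordered_index \<Rightarrow> 'n" where h: "bij h"
    using finite_same_card_bij[of "UNIV :: 'n ordered_index set" "UNIV :: 'n set"] card_ordered_index by auto
  define k where "k = inv h"
  have hk: "h (k i) = i" "k (h j) = j" for i j
    using h by (simp_all add: k_def bij_is_surj surj_f_inv_f bij_is_inj)
  define R :: "real^'n \<Rightarrow> real^'n ordered_index" where "R x = (\<chi> j. x $ h j)" for x
  define S :: "real^'n ordered_index \<Rightarrow> real^'n" where "S y = (\<chi> i. y $ k i)" for y
  have RS: "R (S y) = y" "S (R x) = x" for x y by (simp_all add: R_def S_def hk)
  have linR: "linear R" "linear S" by (auto intro!: linearI simp: R_def S_def vec_eq_iff)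
  have normR: "norm (R x) = norm x" for x
    unfolding norm_vec_def L2_set_def R_def
    using sum.reindex_bij_betw[OF h, of "\<lambda>i. (norm (x $ i))\<^sup>2"] by simp
  have distR: "dist (R x) (R y) = dist x y" for x y
    using normR[of "x - y"] linR by (simp add: dist_norm linear_diff)
  let ?f = "R \<circ> f \<circ> S" and ?g = "R \<circ> g \<circ> S"
  have linf: "linear ?f" "linear ?g" using lin linR by (auto intro!: linear_compose)
  have RA: "R ` A \<in> sets borel" using A linR RS by (intro borel_linear_bij_image[of R S]) auto
  have fA: "f ` A \<in> sets borel" by (rule borel_linear_bij_image[OF lin inv A(1)])
  have RfA: "R ` f ` A \<in> sets borel" using fA linR RS by (intro borel_linear_bij_image[of R S]) auto
  have dims: "DIM(real^'n) = DIM(real^'n ordered_index)" by (simp add: card_ordered_index)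
  have "bounded (R ` A)" using A(2) linR by (intro bounded_linear_image) (simp_all add: linear_conv_bounded_linear)
  then have "emeasure lborel (?f ` R ` A) = ennreal \<bar>det (matrix ?f)\<bar> * emeasure lborel (R ` A)"
    using inv RS RA by (intro lborel_linear_image_wellorder[OF linf]) auto
  also have "?f ` R ` A = R ` f ` A" by (simp add: image_comp o_def RS)
  also have "emeasure lborel (R ` f ` A) = emeasure lborel (f ` A)"
    by (rule lborel_isometry_image[OF dims fA RfA distR])
  also have "emeasure lborel (R ` A) = emeasure lborel A"
    by (rule lborel_isometry_image[OF dims A(1) RA distR])
  also have "det (matrix ?f) = det (matrix f)"
  proof -
    have S_axis: "S (axis j 1) = axis (h j) 1" for j
    proof (rule vec_eq_iff[THEN iffD2], rule allI)
      fix i show "S (axis j 1) $ i = axis (h j) 1 $ i"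
        by (simp add: S_def axis_def) (metis hk)
    qed
    have "det (matrix ?f) = leibniz_det UNIV (\<lambda>i j. matrix f $ h i $ h j)"
      by (simp add: det_eq_leibniz_det matrix_def S_axis R_def)
    also have "\<dots> = det (matrix f)"
      using leibniz_det_reindex[OF finite h, of "\<lambda>i j. matrix f $ i $ j"] by (simp add: det_eq_leibniz_det)
    finally show ?thesis .
  qed
  finally show ?thesis .
qed

text \<open>The space \<open>'a\<close> models the hyperplane orthogonal to \<open>e\<close>.
  Together with the coordinate along \<open>e\<close> it is isometric to the whole space; Fubini's
  theorem in \<open>'a \<times> real\<close> becomes integration over parallel hyperplanes, on each
  of which Hausdorff measure is Lebesgue measure of the model.\<close>

lemma lborel_hyperplane_slices_aux:
  fixes Z :: "(real^'n) set"
  assumes dim: "Suc DIM('a::euclidean_space) = CARD('n)" and e: "norm e = 1" and Z: "Z \<in> sets borel"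
  shows "(\<lambda>t. hausdorff_outer (CARD('n) - 1) {w. e \<bullet> w = 0 \<and> w + t *\<^sub>R e \<in> Z}) \<in> borel_measurable lborel"
    and "emeasure lborel Z = (\<integral>\<^sup>+t. hausdorff_outer (CARD('n) - 1) {w. e \<bullet> w = 0 \<and> w + t *\<^sub>R e \<in> Z} \<partial>lborel)"
proof -
  let ?W = "{w. e \<bullet> w = 0}"
  have "e \<noteq> 0" using e by auto
  then have "dim (UNIV :: 'a set) = dim ?W" using dim by (simp add: dim_hyperplane)
  then have d: "dim (UNIV :: 'a set) = dim ?W" .
  obtain f g where f: "linear f" "linear g" "f ` (UNIV::'a set) = ?W" "g ` ?W = UNIV"
     "\<And>x. x \<in> UNIV \<Longrightarrow> norm (f x) = norm x" "\<And>x. x \<in> ?W \<Longrightarrow> norm (g x) = norm x"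
     "\<And>x. x \<in> UNIV \<Longrightarrow> g (f x) = x" "\<And>x. x \<in> ?W \<Longrightarrow> f (g x) = x"
  proof (rule isometries_subspaces[OF subspace_UNIV subspace_hyperplane d], goal_cases)
    case (1 f g)
    show ?case by (rule 1(1)[OF 1(2-9)])
  qed
  note g = f(2)
  note f = f(1,3) f(5)[OF UNIV_I] f(7)[OF UNIV_I] f(8)
  have ef: "e \<bullet> f v = 0" for v using f(2) by blast
  have ee: "e \<bullet> e = 1" using e by (simp add: norm_eq_1)
  define \<Phi> where "\<Phi> p = f (fst p) + snd p *\<^sub>R e" for p :: "'a \<times> real"
  define \<Psi> where "\<Psi> y = (g (y - (e \<bullet> y) *\<^sub>R e), e \<bullet> y)" for y
  have lin\<Phi>: "linear \<Phi>"
    by (rule linearI) (simp_all add: \<Phi>_def linear_add[OF f(1)] linear_cmul[OF f(1)] algebra_simps)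
  have lin\<Psi>: "linear \<Psi>"
    by (rule linearI) (simp_all add: \<Psi>_def linear_diff[OF g] linear_add[OF g] linear_cmul[OF g] inner_add_right algebra_simps)
  have inv: "\<Psi> (\<Phi> p) = p" "\<Phi> (\<Psi> y) = y" for p y
  proof -
    show "\<Psi> (\<Phi> p) = p" by (simp add: \<Psi>_def \<Phi>_def inner_add_right ef ee f(4))
    have "f (g (y - (e \<bullet> y) *\<^sub>R e)) = y - (e \<bullet> y) *\<^sub>R e"
      by (rule f(5)) (simp add: inner_diff_right ee)
    then show "\<Phi> (\<Psi> y) = y" by (simp add: \<Psi>_def \<Phi>_def)
  qed
  have norm\<Phi>: "norm (\<Phi> p) = norm p" for p
  proof -
    have "(norm (\<Phi> p))\<^sup>2 = (norm (f (fst p)))\<^sup>2 + (snd p)\<^sup>2"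
      unfolding \<Phi>_def power2_norm_eq_inner
      using ef[of "fst p"] ee by (simp add: inner_add_left inner_add_right inner_commute power2_eq_square)
    also have "\<dots> = (norm p)\<^sup>2" by (simp add: f(3) norm_prod_def)
    finally show ?thesis by simp
  qed
  have dist\<Phi>: "dist (\<Phi> p) (\<Phi> q) = dist p q" for p q
    using norm\<Phi>[of "p - q"] lin\<Phi> by (simp add: dist_norm linear_diff)
  have dims: "DIM('a \<times> real) = DIM(real^'n)" using dim by simp
  have "\<Psi> ` Z \<in> sets borel" using Z lin\<Phi> lin\<Psi> inv by (intro borel_linear_bij_image[of \<Psi> \<Phi>]) auto
  moreover have \<Phi>Z: "\<Phi> ` \<Psi> ` Z = Z" by (simp add: image_comp o_def inv)
  ultimately have Z\<Psi>: "emeasure lborel Z = emeasure lborel (\<Psi> ` Z)"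
    using lborel_isometry_image[OF dims, of "\<Psi> ` Z" \<Phi>] dist\<Phi> Z by simp
  have \<Psi>Z: "\<Psi> ` Z \<in> sets (lborel \<Otimes>\<^sub>M lborel)"
    using \<open>\<Psi> ` Z \<in> sets borel\<close> by (simp only: lborel_prod sets_lborel)
  have slice: "emeasure lborel ((\<lambda>v. (v, t)) -` (\<Psi> ` Z)) = hausdorff_outer (CARD('n) - 1) {w. e \<bullet> w = 0 \<and> w + t *\<^sub>R e \<in> Z}"
    for t :: real
  proof -
    let ?S = "(\<lambda>v. (v, t)) -` (\<Psi> ` Z)"
    have "?S \<in> sets borel"
      using measurable_sets[of "\<lambda>v::'a. (v, t)" borel borel "\<Psi> ` Z"] \<open>\<Psi> ` Z \<in> sets borel\<close>
      by (simp add: borel_prod[symmetric])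
    then have "emeasure lborel ?S = hausdorff_outer DIM('a) ?S" by (simp add: hausdorff_outer_eq_lborel)
    also have "\<dots> = hausdorff_outer DIM('a) (f ` ?S)"
      using f(3) linear_diff[OF f(1)] by (intro hausdorff_outer_isometry_image[symmetric]) (metis dist_norm)
    also have "f ` ?S = {w. e \<bullet> w = 0 \<and> w + t *\<^sub>R e \<in> Z}"
    proof (intro set_eqI iffI)
      fix w assume "w \<in> f ` ?S"
      then obtain v z where v: "w = f v" "(v, t) = \<Psi> z" "z \<in> Z" by auto
      then have "\<Phi> (v, t) = z" using inv by simp
      then have "f v + t *\<^sub>R e = z" unfolding \<Phi>_def by (simp only: fst_conv snd_conv)
      then show "w \<in> {w. e \<bullet> w = 0 \<and> w + t *\<^sub>R e \<in> Z}" using v(1,3) ef by simp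
    next
      fix w assume w: "w \<in> {w. e \<bullet> w = 0 \<and> w + t *\<^sub>R e \<in> Z}"
      then have fg: "f (g w) = w" using f(5) by simp
      then have "\<Phi> (g w, t) \<in> Z" using w by (simp add: \<Phi>_def)
      then have "g w \<in> ?S" using inv(1)[of "(g w, t)"] by (force intro: rev_image_eqI)
      then show "w \<in> f ` ?S" using fg by force
    qed
    also have "DIM('a) = CARD('n) - 1" using dim by simp
    finally show "emeasure lborel ?S = hausdorff_outer (CARD('n) - 1) {w. e \<bullet> w = 0 \<and> w + t *\<^sub>R e \<in> Z}" .
  qed
  show "(\<lambda>t. hausdorff_outer (CARD('n) - 1) {w. e \<bullet> w = 0 \<and> w + t *\<^sub>R e \<in> Z}) \<in> borel_measurable lborel"
    using lborel_pair.measurable_emeasure_Pair2[OF \<Psi>Z] unfolding slice .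
  show "emeasure lborel Z = (\<integral>\<^sup>+t. hausdorff_outer (CARD('n) - 1) {w. e \<bullet> w = 0 \<and> w + t *\<^sub>R e \<in> Z} \<partial>lborel)"
    unfolding Z\<Psi> slice[symmetric]
    using lborel_pair.emeasure_pair_measure_alt2[OF \<Psi>Z] by (simp only: lborel_prod)
qed

text \<open>In dimension 0 every nonempty set costs 1, since \<open>0 ^ 0 = 1\<close> and the
  constant is 1. This is the surface measure of bodies on the line.\<close>

lemma hausdorff_outer_0_singleton: "hausdorff_outer 0 {x} = 1"
proof (rule antisym)
  have c0: "hausdorff_const 0 = 1" by (simp add: hausdorff_const_def)
  show "hausdorff_outer 0 {x} \<le> 1"
  proof (rule hausdorff_outer_least)
    fix \<delta> :: real assume "0 < \<delta>"
    then have "hausdorff_pre 0 \<delta> {x} \<le> hcost 0 {x}" 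
      using hausdorff_pre_le[of "{x}" "\<lambda>i. if i = 0 then {x} else {}" \<delta> 0]
        suminf_finite[of "{0::nat}" "\<lambda>i. hcost 0 (if i = 0 then {x} else {})"] by (auto split: if_splits)
    then show "hausdorff_pre 0 \<delta> {x} \<le> 1" by (simp add: hcost_def c0)
  qed
  have "1 \<le> hausdorff_pre 0 1 {x}"
  proof (rule hausdorff_pre_greatest)
    fix C assume "{x} \<subseteq> (\<Union>i::nat. C i)"
    then obtain i where "x \<in> C i" by auto
    then have "1 \<le> hcost 0 (C i)" by (auto simp: hcost_def c0)
    also have "\<dots> \<le> (\<Sum>i. hcost 0 (C i))" using sum_le_suminf[of "\<lambda>i. hcost 0 (C i)" "{i}"] by simp
    finally show "1 \<le> (\<Sum>i. hcost 0 (C i))" .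
  qed
  then show "1 \<le> hausdorff_outer 0 {x}" using hausdorff_pre_le_outer[of 1 0 "{x}"] by simp
qed

text \<open>In dimension one the hyperplane is a single point, which no Euclidean space type models
  because their dimension is positive; there each slice is a point or empty and is counted
  directly.\<close>

lemma lborel_hyperplane_slices:
  fixes Z :: "(real^'n) set"
  assumes e: "norm e = 1" and Z: "Z \<in> sets borel"
  shows "(\<lambda>t. hausdorff_outer (CARD('n) - 1) {w. e \<bullet> w = 0 \<and> w + t *\<^sub>R e \<in> Z}) \<in> borel_measurable lborel \<and>
    emeasure lborel Z = (\<integral>\<^sup>+t. hausdorff_outer (CARD('n) - 1) {w. e \<bullet> w = 0 \<and> w + t *\<^sub>R e \<in> Z} \<partial>lborel)"
proof (cases "CARD('n) = 1")
  case False
  have "0 < CARD('n)" by simp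
  with False have "2 \<le> CARD('n)" by linarith
  then have "Suc DIM(real^'n pred_index) = CARD('n)" by (simp add: card_pred_index)
  then have dim: "Suc DIM(real^'n pred_index) = CARD('n)" .
  show ?thesis using lborel_hyperplane_slices_aux[OF dim e Z] by blast
next
  case True
  have "e \<noteq> 0" using e by auto
  have ee: "e \<bullet> e = 1" using e by (simp add: norm_eq_1)
  have "dim {w. e \<bullet> w = 0} = 0" using True \<open>e \<noteq> 0\<close> by (simp add: dim_hyperplane)
  then have W: "{w. e \<bullet> w = 0} = {0}" by (auto simp: dim_eq_0)
  have decomp: "y = (e \<bullet> y) *\<^sub>R e" for y
  proof -
    have "y - (e \<bullet> y) *\<^sub>R e \<in> {w. e \<bullet> w = 0}" by (simp add: inner_diff_right ee)
    then show ?thesis unfolding W by simp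
  qed
  define S where "S = {t. t *\<^sub>R e \<in> Z}"
  have S: "S \<in> sets borel"
    using Z measurable_sets[of "\<lambda>t. t *\<^sub>R e" borel borel Z] by (simp add: S_def vimage_def)
  have im: "(\<lambda>t. t *\<^sub>R e) ` S = Z"
  proof (intro set_eqI iffI)
    fix y assume "y \<in> Z"
    then show "y \<in> (\<lambda>t. t *\<^sub>R e) ` S" using decomp[of y] by (intro image_eqI[of _ _ "e \<bullet> y"]) (auto simp: S_def)
  qed (auto simp: S_def)
  have ZS: "emeasure lborel Z = emeasure lborel S"
  proof -
    have "emeasure lborel ((\<lambda>t. t *\<^sub>R e) ` S) = emeasure lborel S"
    proof (rule lborel_isometry_image)
      show "DIM(real) = DIM(real^'n)" using True by simp
      show "(\<lambda>t. t *\<^sub>R e) ` S \<in> sets borel" unfolding im by (rule Z)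
      show "dist (t *\<^sub>R e) (s *\<^sub>R e) = dist t s" for t s :: real
        using e unfolding dist_norm scaleR_diff_left[symmetric] by simp
    qed (rule S)
    then show ?thesis unfolding im .
  qed
  have slice: "hausdorff_outer (CARD('n) - 1) {w. e \<bullet> w = 0 \<and> w + t *\<^sub>R e \<in> Z} = indicator S t" for t
  proof -
    have "w = 0" if "e \<bullet> w = 0" for w using that W by blast
    then have "{w. e \<bullet> w = 0 \<and> w + t *\<^sub>R e \<in> Z} = (if t \<in> S then {0} else {})"
      by (auto simp: S_def) (metis add_0)
    then show ?thesis using True by (simp add: hausdorff_outer_0_singleton)
  qed
  show ?thesis unfolding slice ZS using S by simp
qed

section \<open>Differential calculus\<close>

text \<open>Mean value inequality for \<open>f\<close> minus its linearisation at \<open>x0\<close>.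
  The estimate is uniform over pairs \<open>x\<close>, \<open>y\<close> near \<open>x0\<close>,
  which is what Lipschitz bounds for charts require.\<close>

lemma strict_derivative:
  fixes f :: "'a::euclidean_space \<Rightarrow> 'b::real_normed_vector"
  assumes G: "open G" "x0 \<in> G" and der: "\<And>x. x \<in> G \<Longrightarrow> (f has_derivative f' x) (at x)"
    and cont: "\<And>v. continuous_on G (\<lambda>x. f' x v)" and e: "0 < e"
  obtains r where "0 < r" "ball x0 r \<subseteq> G"
    "\<And>x y. x \<in> ball x0 r \<Longrightarrow> y \<in> ball x0 r \<Longrightarrow> norm (f x - f y - f' x0 (x - y)) \<le> e * norm (x - y)"
proof -
  define e' where "e' = e / DIM('a)"
  have e': "0 < e'" using e by (simp add: e'_def)
  have "\<forall>b. \<exists>d>0. \<forall>x\<in>ball x0 d. norm (f' x b - f' x0 b) < e'"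
  proof
    fix b
    have "isCont (\<lambda>x. f' x b) x0" using cont[of b] G by (simp add: continuous_on_eq_continuous_at)
    then obtain d where "d > 0" "\<And>x. dist x x0 < d \<Longrightarrow> dist (f' x b) (f' x0 b) < e'"
      using e' unfolding continuous_at_eps_delta by blast
    then show "\<exists>d>0. \<forall>x\<in>ball x0 d. norm (f' x b - f' x0 b) < e'"
      by (intro exI[of _ d]) (auto simp: dist_norm norm_minus_commute)
  qed
  then obtain d where d: "\<And>b. 0 < d b" "\<And>b x. x \<in> ball x0 (d b) \<Longrightarrow> norm (f' x b - f' x0 b) < e'"
    by metis
  obtain r0 where r0: "0 < r0" "ball x0 r0 \<subseteq> G" using G by (meson open_contains_ball)
  \<comment> \<open>Continuity of the derivative is assumed for each direction separately. Finitely
    many basis directions control the operator norm, whence the division of \<open>e\<close> by the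
    dimension in \<open>e'\<close>.\<close>
  define r where "r = Min (insert r0 (d ` Basis))"
  have r: "0 < r" using r0 d(1) by (auto simp: r_def)
  have rle: "r \<le> r0" "\<And>b. b \<in> Basis \<Longrightarrow> r \<le> d b" unfolding r_def by (intro Min_le; simp)+
  have sub: "ball x0 r \<subseteq> G" using r0 rle by (meson subset_ball order_trans)
  have lin: "linear (f' x)" if "x \<in> G" for x using der[OF that] by (rule has_derivative_linear)
  show thesis
  proof (rule that[OF r sub])
    fix x y assume xy: "x \<in> ball x0 r" "y \<in> ball x0 r"
    define h where "h z = f z - f' x0 z" for z
    have "norm (h x - h y) \<le> e * norm (x - y)"
    proof (rule differentiable_bound[OF convex_ball[of x0 r] _ _ xy])
      fix z assume z: "z \<in> ball x0 r"
      then have zG: "z \<in> G" using sub by auto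
      have "bounded_linear (f' x0)" using der[OF G(2)] by (rule has_derivative_bounded_linear)
      then have "(h has_derivative (\<lambda>v. f' z v - f' x0 v)) (at z)"
        unfolding h_def by (intro has_derivative_diff der zG bounded_linear_imp_has_derivative)
      then show "(h has_derivative (\<lambda>v. f' z v - f' x0 v)) (at z within ball x0 r)"
        by (rule has_derivative_at_withinI)
      show "onorm (\<lambda>v. f' z v - f' x0 v) \<le> e"
      proof (rule onorm_le)
        fix v :: 'a
        have dl: "linear (\<lambda>v. f' z v - f' x0 v)" using lin zG G(2) by (intro linear_compose_sub) auto
        have "f' z v - f' x0 v = (\<Sum>b\<in>Basis. (v \<bullet> b) *\<^sub>R (f' z b - f' x0 b))"
          using linear_sum[OF dl, of "\<lambda>b. (v \<bullet> b) *\<^sub>R b" Basis] linear_cmul[OF dl]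
          by (simp add: euclidean_representation)
        also have "norm \<dots> \<le> (\<Sum>b\<in>(Basis::'a set). norm v * e')"
        proof (rule sum_norm_le)
          fix b :: 'a assume b: "b \<in> Basis"
          have "z \<in> ball x0 (d b)" using z rle(2)[OF b] by auto
          then have "norm (f' z b - f' x0 b) \<le> e'" using d(2) by (simp add: less_imp_le)
          then show "norm ((v \<bullet> b) *\<^sub>R (f' z b - f' x0 b)) \<le> norm v * e'"
            using Basis_le_norm[OF b, of v] e' by (simp add: mult_mono)
        qed
        also have "\<dots> = e * norm v" by (simp add: e'_def)
        finally show "norm (f' z v - f' x0 v) \<le> e * norm v" .
      qed
    qed
    moreover have "h x - h y = f x - f y - f' x0 (x - y)"
      using linear_diff[OF lin[OF G(2)]] by (simp add: h_def)
    ultimately show "norm (f x - f y - f' x0 (x - y)) \<le> e * norm (x - y)" by simp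
  qed
qed

text \<open>Serves both normalisations: with \<open>A\<close> the identity it differentiates the
  reciprocal length of the gradient, with \<open>A\<close> multiplication by \<Theta> the reciprocal
  \<Theta>-norm of \<eta>.\<close>

lemma has_derivative_inverse_seminorm:
  fixes y :: "'a::real_normed_vector \<Rightarrow> 'b::real_inner" and A :: "'b \<Rightarrow> 'b"
  assumes y: "(y has_derivative y') (at x)" and A: "bounded_linear A" "\<And>a b. a \<bullet> A b = A a \<bullet> b"
    and pos: "0 < y x \<bullet> A (y x)"
  shows "((\<lambda>x. 1 / sqrt (y x \<bullet> A (y x))) has_derivative
     (\<lambda>v. - (y x \<bullet> A (y' v)) / sqrt (y x \<bullet> A (y x)) ^ 3)) (at x)"
proof -
  let ?q = "y x \<bullet> A (y x)"
  have "((\<lambda>x. A (y x)) has_derivative (\<lambda>v. A (y' v))) (at x)"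
    using bounded_linear.has_derivative[OF A(1) y] .
  then have q: "((\<lambda>x. y x \<bullet> A (y x)) has_derivative (\<lambda>v. y x \<bullet> A (y' v) + y' v \<bullet> A (y x))) (at x)"
    by (rule has_derivative_inner[OF y])
  have "((\<lambda>s. 1 / sqrt s) has_real_derivative (- (1 / (2 * sqrt ?q ^ 3)))) (at ?q)"
    using pos by (auto intro!: derivative_eq_intros simp: field_simps power3_eq_cube)
  from DERIV_compose_FDERIV[OF this q]
  have "((\<lambda>x. 1 / sqrt (y x \<bullet> A (y x))) has_derivative
      (\<lambda>v. (y x \<bullet> A (y' v) + y' v \<bullet> A (y x)) * (- (1 / (2 * sqrt ?q ^ 3))))) (at x)" .
  moreover have "(\<lambda>v. (y x \<bullet> A (y' v) + y' v \<bullet> A (y x)) * (- (1 / (2 * sqrt ?q ^ 3))))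
     = (\<lambda>v. - (y x \<bullet> A (y' v)) / sqrt ?q ^ 3)"
    using A(2) by (auto simp: fun_eq_iff inner_commute field_simps)
  ultimately show ?thesis by simp
qed

lemma smooth_fun_differentiable: "smooth_fun f \<Longrightarrow> f differentiable (at x)"
  unfolding smooth_fun_def by (metis Ck.simps(2))

lemma smooth_fun_frechet_derivative:
  assumes "smooth_fun f" shows "smooth_fun (\<lambda>x. frechet_derivative f (at x) v)"
  using assms unfolding smooth_fun_def by (metis Ck.simps(2))

lemma smooth_fun_continuous_on: "smooth_fun f \<Longrightarrow> continuous_on S f"
  unfolding smooth_fun_def by (metis Ck.simps(1) continuous_on_subset subset_UNIV)

section \<open>Normals and tubes of a convex body with smooth boundary\<close>

locale smooth_convex_body =
  fixes F :: "real^'n \<Rightarrow> real" and u :: real and \<Theta> :: "real^'n^'n"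
  assumes smooth: "smooth_fun F"
    and conv: "convex {y. u \<le> F y}"
    and regular: "\<forall>x \<in> frontier {y. u \<le> F y}. grad F x \<noteq> 0"
    and sym: "transpose \<Theta> = \<Theta>"
    and posdef: "\<forall>v. v \<noteq> 0 \<longrightarrow> v \<bullet> (\<Theta> *v v) > 0"
begin

abbreviation "body \<equiv> {y. u \<le> F y}"
abbreviation "bdry \<equiv> frontier body"

definition "\<Theta>i = matrix_inv \<Theta>"

lemma \<Theta>_sym: "a \<bullet> (\<Theta> *v b) = (\<Theta> *v a) \<bullet> b"
  using sym by (metis dot_lmul_matrix transpose_matrix_vector)

lemma \<Theta>_inv: "\<Theta>i *v (\<Theta> *v v) = v" "\<Theta> *v (\<Theta>i *v v) = v"
proof -
  have "\<forall>x. \<Theta> *v x = 0 \<longrightarrow> x = 0" using posdef by (metis inner_zero_right less_irrefl)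
  then have "invertible \<Theta>" by (simp add: invertible_left_inverse matrix_left_invertible_ker)
  then have "\<Theta> ** \<Theta>i = mat 1 \<and> \<Theta>i ** \<Theta> = mat 1"
    unfolding \<Theta>i_def matrix_inv_def invertible_def by (rule someI_ex)
  then show "\<Theta>i *v (\<Theta> *v v) = v" "\<Theta> *v (\<Theta>i *v v) = v"
    by (simp_all add: matrix_vector_mul_assoc)
qed

lemma \<Theta>i_sym: "a \<bullet> (\<Theta>i *v b) = (\<Theta>i *v a) \<bullet> b"
  by (metis \<Theta>_inv(2) \<Theta>_sym)

text \<open>Squared norm belonging to the inverse of \<Theta>. Its balls are the sets
  \<open>theta_ball\<close>, so it measures the distance from the body.\<close>

definition "q v = v \<bullet> (\<Theta>i *v v)"

lemma q_pos: "v \<noteq> 0 \<Longrightarrow> 0 < q v"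
  unfolding q_def using posdef \<Theta>_inv by (metis inner_commute matrix_vector_mult_0_right)

lemma q_nonneg: "0 \<le> q v" using q_pos[of v] by (cases "v = 0") (auto simp: q_def)

lemma q_scaleR: "q (c *\<^sub>R v) = c\<^sup>2 * q v"
  by (simp add: q_def matrix_vector_mult_scaleR power2_eq_square)

lemma q_diff_scaleR: "q (a - s *\<^sub>R b) = q a - 2 * s * (a \<bullet> (\<Theta>i *v b)) + s\<^sup>2 * q b"
proof -
  have "b \<bullet> (\<Theta>i *v a) = a \<bullet> (\<Theta>i *v b)" by (metis \<Theta>i_sym inner_commute)
  then show ?thesis
    by (simp add: q_def matrix_vector_mult_diff_distrib matrix_vector_mult_scaleR inner_diff_left inner_diff_right
        algebra_simps power2_eq_square)
qed

lemma q_continuous: "continuous_on S q"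
  unfolding q_def by (intro continuous_intros matrix_vector_mult_linear_continuous_on)

text \<open>By homogeneity the constant is the minimum of \<open>q\<close> on the unit sphere, which
  is attained and positive.\<close>

lemma q_coercive: obtains c where "0 < c" "\<And>v. c * (norm v)\<^sup>2 \<le> q v"
proof -
  have "sphere (0::real^'n) 1 \<noteq> {}" by simp
  then obtain v0 where v0: "v0 \<in> sphere 0 1" "\<And>v. v \<in> sphere 0 1 \<Longrightarrow> q v0 \<le> q v"
    using continuous_attains_inf[OF compact_sphere, of "0::real^'n" 1 q] q_continuous by blast
  have "0 < q v0" using v0(1) by (intro q_pos) auto
  moreover have "q v0 * (norm v)\<^sup>2 \<le> q v" for v
  proof (cases "v = 0")
    case False
    then have "q v0 \<le> q ((1 / norm v) *\<^sub>R v)" by (intro v0(2)) auto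
    then show ?thesis using False by (simp add: q_scaleR field_simps)
  qed (simp add: q_def)
  ultimately show ?thesis using that by blast
qed

abbreviation "g \<equiv> grad F"

lemma F_continuous: "continuous_on S F" by (rule smooth_fun_continuous_on[OF smooth])

lemma closed_body: "closed body"
  using F_continuous by (intro closed_Collect_le continuous_intros) auto

lemma bdry_subset: "bdry \<subseteq> body"
  using closed_body by (rule frontier_subset_closed)

lemma closed_bdry: "closed bdry" by (rule frontier_closed)

lemma F_gt_interior: "u < F x \<Longrightarrow> x \<in> interior body"
proof (rule interiorI[of "{y. u < F y}"])
  show "open {y. u < F y}" using F_continuous by (intro open_Collect_less continuous_intros) auto
qed auto

lemma bdry_F: "x \<in> bdry \<Longrightarrow> F x = u"
  using bdry_subset F_gt_interior[of x] by (fastforce simp: frontier_def)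

lemma bdry_g: "x \<in> bdry \<Longrightarrow> g x \<noteq> 0" using regular by blast

lemma grad_inner: "frechet_derivative F (at x) v = g x \<bullet> v"
proof -
  have lin: "linear (frechet_derivative F (at x))"
    using smooth_fun_differentiable[OF smooth] by (rule linear_frechet_derivative)
  have "frechet_derivative F (at x) v = frechet_derivative F (at x) (\<Sum>i\<in>UNIV. v $ i *\<^sub>R axis i 1)"
    by (simp add: basis_expansion scalar_mult_eq_scaleR[symmetric])
  also have "\<dots> = (\<Sum>i\<in>UNIV. v $ i * frechet_derivative F (at x) (axis i 1))"
    by (simp add: linear_sum[OF lin] linear_cmul[OF lin])
  also have "\<dots> = g x \<bullet> v" by (simp add: inner_vec_def grad_def mult.commute)
  finally show ?thesis .
qed

lemma F_has_derivative: "(F has_derivative (\<lambda>v. g x \<bullet> v)) (at x)"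
  using smooth_fun_differentiable[OF smooth] grad_inner
  by (metis (no_types, lifting) ext frechet_derivative_works)

text \<open>The Hessian of \<open>F\<close> at \<open>x\<close> applied to \<open>v\<close>, taken
  componentwise because \<open>smooth_fun\<close> speaks of scalar functions.\<close>

definition "hess x v = (\<chi> i. frechet_derivative (\<lambda>x. g x $ i) (at x) v)"

lemma smooth_g: "smooth_fun (\<lambda>x. g x $ i)"
  unfolding grad_def using smooth_fun_frechet_derivative[OF smooth] by simp

lemma g_has_derivative: "(g has_derivative hess x) (at x)"
proof -
  have "((\<lambda>x. g x $ i) has_derivative (\<lambda>v. hess x v $ i)) (at x)" for i
    using smooth_fun_differentiable[OF smooth_g[of i], of x] by (simp add: hess_def frechet_derivative_works)
  then show ?thesis
    by (subst has_derivative_componentwise_within) (auto simp: Basis_vec_def inner_axis)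
qed

lemma hess_continuous: "continuous_on S (\<lambda>x. hess x v)"
  unfolding hess_def
  using smooth_fun_continuous_on[OF smooth_fun_frechet_derivative[OF smooth_g]] by (intro continuous_on_vec_lambda)

lemma g_continuous: "continuous_on S g"
  by (intro continuous_at_imp_continuous_on ballI has_derivative_continuous[OF g_has_derivative])

text \<open>An open set containing the boundary on which \<eta> and \<nu> are differentiable.
  Derivatives can thus be taken in the full space instead of along the surface.\<close>

definition "reg = {x. g x \<noteq> 0}"

lemma open_reg: "open reg"
  unfolding reg_def using g_continuous by (intro open_Collect_neq continuous_intros) auto

lemma bdry_reg: "bdry \<subseteq> reg" using bdry_g by (auto simp: reg_def)

abbreviation "\<eta> \<equiv> eta F"

lemma norm_\<eta>: "x \<in> reg \<Longrightarrow> norm (\<eta> x) = 1"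
  by (simp add: eta_def reg_def)

lemma \<eta>_nonzero: "x \<in> reg \<Longrightarrow> \<eta> x \<noteq> 0" using norm_\<eta>[of x] by auto

definition "d\<eta> x v = - ((1 / norm (g x)) *\<^sub>R hess x v) + ((g x \<bullet> hess x v) / norm (g x) ^ 3) *\<^sub>R g x"

lemma \<eta>_has_derivative:
  assumes "x \<in> reg" shows "(\<eta> has_derivative d\<eta> x) (at x)"
proof -
  have "((\<lambda>x. 1 / sqrt (g x \<bullet> g x)) has_derivative (\<lambda>v. - (g x \<bullet> hess x v) / sqrt (g x \<bullet> g x) ^ 3)) (at x)"
    using has_derivative_inverse_seminorm[OF g_has_derivative, of "\<lambda>v. v" x] assms
    by (simp add: reg_def bounded_linear_ident)
  then have "((\<lambda>x. - ((1 / norm (g x)) *\<^sub>R g x)) has_derivative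
     (\<lambda>v. - ((1 / norm (g x)) *\<^sub>R hess x v + (- (g x \<bullet> hess x v) / norm (g x) ^ 3) *\<^sub>R g x))) (at x)"
    unfolding norm_eq_sqrt_inner by (intro has_derivative_minus has_derivative_scaleR g_has_derivative)
  then show ?thesis unfolding eta_def[abs_def] d\<eta>_def[abs_def] by simp
qed

lemma \<eta>_continuous: "continuous_on reg \<eta>"
  unfolding eta_def[abs_def] reg_def by (intro continuous_intros g_continuous) auto

lemma d\<eta>_continuous: "continuous_on reg (\<lambda>x. d\<eta> x v)"
  unfolding d\<eta>_def reg_def by (intro continuous_intros g_continuous hess_continuous) auto

definition "h x = theta_norm \<Theta> (\<eta> x)"

lemma h_pos: "x \<in> reg \<Longrightarrow> 0 < h x"
  using \<eta>_nonzero posdef by (simp add: h_def theta_norm_def)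

lemma h_power2: "x \<in> reg \<Longrightarrow> (h x)\<^sup>2 = \<eta> x \<bullet> (\<Theta> *v \<eta> x)"
  using \<eta>_nonzero posdef by (simp add: h_def theta_norm_def less_imp_le)

lemma h_continuous: "continuous_on reg h"
  unfolding h_def[abs_def] theta_norm_def
  by (intro continuous_intros \<eta>_continuous matrix_vector_mult_linear_continuous_on
      continuous_on_compose2[OF matrix_vector_mult_linear_continuous_on[of UNIV \<Theta>]]) auto

definition "\<nu> x = (1 / h x) *\<^sub>R (\<Theta> *v \<eta> x)"

definition "d\<nu> x v = (1 / h x) *\<^sub>R (\<Theta> *v d\<eta> x v) - ((\<eta> x \<bullet> (\<Theta> *v d\<eta> x v)) / h x ^ 3) *\<^sub>R (\<Theta> *v \<eta> x)"

lemma \<nu>_has_derivative: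
  assumes "x \<in> reg" shows "(\<nu> has_derivative d\<nu> x) (at x)"
proof -
  have bl: "bounded_linear (\<lambda>v. \<Theta> *v v)" by (rule matrix_vector_mul_bounded_linear)
  have "((\<lambda>x. 1 / h x) has_derivative (\<lambda>v. - (\<eta> x \<bullet> (\<Theta> *v d\<eta> x v)) / h x ^ 3)) (at x)"
    using has_derivative_inverse_seminorm[OF \<eta>_has_derivative[OF assms] bl \<Theta>_sym] \<eta>_nonzero[OF assms] posdef
    unfolding h_def[abs_def] theta_norm_def by simp
  then have "((\<lambda>x. (1 / h x) *\<^sub>R (\<Theta> *v \<eta> x)) has_derivative
     (\<lambda>v. (1 / h x) *\<^sub>R (\<Theta> *v d\<eta> x v) + (- (\<eta> x \<bullet> (\<Theta> *v d\<eta> x v)) / h x ^ 3) *\<^sub>R (\<Theta> *v \<eta> x))) (at x)"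
    by (intro has_derivative_scaleR bounded_linear.has_derivative[OF bl] \<eta>_has_derivative assms)
  then show ?thesis unfolding \<nu>_def[abs_def] d\<nu>_def[abs_def] by simp
qed

lemma \<nu>_continuous: "continuous_on reg \<nu>"
  by (intro continuous_at_imp_continuous_on ballI has_derivative_continuous[OF \<nu>_has_derivative])

lemma d\<nu>_continuous: "continuous_on reg (\<lambda>x. d\<nu> x v)"
proof -
  have M: "continuous_on reg (\<lambda>x. \<Theta> *v f x)" if "continuous_on reg f" for f
    by (rule continuous_on_compose2[OF matrix_vector_mult_linear_continuous_on[of UNIV \<Theta>] that]) auto
  have "h x \<noteq> 0" if "x \<in> reg" for x using h_pos[OF that] by simp
  then show ?thesis
    unfolding d\<nu>_def by (intro continuous_intros M h_continuous \<eta>_continuous d\<eta>_continuous) auto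
qed

lemma \<Theta>i_\<nu>: "\<Theta>i *v \<nu> x = (1 / h x) *\<^sub>R \<eta> x"
  by (simp add: \<nu>_def matrix_vector_mult_scaleR \<Theta>_inv)

lemma \<eta>_\<nu>: "x \<in> reg \<Longrightarrow> \<eta> x \<bullet> \<nu> x = h x"
  using h_power2[of x] h_pos[of x] by (simp add: \<nu>_def field_simps power2_eq_square)

lemma q_\<nu>: "x \<in> reg \<Longrightarrow> q (\<nu> x) = 1"
  using \<eta>_\<nu>[of x] h_pos[of x] by (simp add: q_def \<Theta>i_\<nu> inner_commute)

text \<open>If \<open>F\<close> decreased initially on the way from \<open>x\<close> to
  \<open>y\<close>, it would fall below the level \<open>u\<close> on a segment that convexity keeps
  in the body.\<close>

lemma normal_inequality:
  assumes x: "x \<in> bdry" and y: "y \<in> body"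
  shows "\<eta> x \<bullet> (y - x) \<le> 0"
proof -
  have "0 \<le> g x \<bullet> (y - x)"
  proof (rule ccontr)
    assume "\<not> 0 \<le> g x \<bullet> (y - x)"
    then have neg: "g x \<bullet> (y - x) < 0" by simp
    have "((\<lambda>s. F (x + s *\<^sub>R (y - x))) has_derivative (\<lambda>s. g x \<bullet> (s *\<^sub>R (y - x)))) (at 0)"
      by (rule has_derivative_compose[of "\<lambda>s. x + s *\<^sub>R (y - x)" _ 0 UNIV F, simplified])
        (auto intro!: derivative_eq_intros F_has_derivative[of x])
    then have "((\<lambda>s. F (x + s *\<^sub>R (y - x))) has_real_derivative (g x \<bullet> (y - x))) (at 0)"
      by (simp add: has_field_derivative_def mult.commute[of _ "g x \<bullet> (y - x)"])
    from DERIV_neg_dec_right[OF this neg] obtain d where d: "0 < d"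
      "\<And>s. 0 < s \<Longrightarrow> s < d \<Longrightarrow> F (x + s *\<^sub>R (y - x)) < F x" by auto
    define s where "s = min (d / 2) 1"
    have s: "0 < s" "s < d" "s \<le> 1" using d(1) by (auto simp: s_def)
    have "x + s *\<^sub>R (y - x) = (1 - s) *\<^sub>R x + s *\<^sub>R y" by (simp add: algebra_simps)
    also have "\<dots> \<in> body" using conv x y bdry_subset s by (intro convexD) auto
    finally show False using d(2)[OF s(1,2)] bdry_F[OF x] by simp
  qed
  then show ?thesis by (simp add: eta_def)
qed

definition "tube p = fst p + snd p *\<^sub>R \<nu> (fst p)"

text \<open>Monotonicity of normals: in the inner product of \<open>\<Theta>i\<close> the offset
  from \<open>x\<close> along \<nu> has a nonpositive product with \<open>x' - x\<close>, and
  likewise with the roles exchanged. The two products add up to \<open>q (x' - x)\<close>.\<close>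

lemma tube_inj:
  assumes x: "x \<in> bdry" "x' \<in> bdry" and t: "0 \<le> t" "0 \<le> t'" and eq: "tube (x, t) = tube (x', t')"
  shows "x = x' \<and> t = t'"
proof -
  have le: "((x + s *\<^sub>R \<nu> x) - x) \<bullet> (\<Theta>i *v (y - x)) \<le> 0" if "x \<in> bdry" "y \<in> bdry" "0 \<le> s" for x y s
  proof -
    have "((x + s *\<^sub>R \<nu> x) - x) \<bullet> (\<Theta>i *v (y - x)) = s * ((1 / h x) * (\<eta> x \<bullet> (y - x)))"
      by (simp add: \<Theta>i_sym matrix_vector_mult_scaleR \<Theta>i_\<nu>)
    moreover have "x \<in> reg" using that bdry_reg by auto
    ultimately show ?thesis
      using normal_inequality[OF that(1), of y] that bdry_subset h_pos[of x]
      by (simp only:) (intro mult_nonneg_nonpos; force)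
  qed
  define z where "z = tube (x, t)"
  have z: "z = x + t *\<^sub>R \<nu> x" "z = x' + t' *\<^sub>R \<nu> x'" using eq by (auto simp: z_def tube_def)
  have "(z - x) \<bullet> (\<Theta>i *v (x' - x)) \<le> 0" "(z - x') \<bullet> (\<Theta>i *v (x - x')) \<le> 0"
    using le[OF x t(1), folded z(1)] le[OF x(2,1) t(2), folded z(2)] by auto
  moreover have "q (x' - x) = (z - x) \<bullet> (\<Theta>i *v (x' - x)) + (z - x') \<bullet> (\<Theta>i *v (x - x'))"
    by (simp add: q_def matrix_vector_mult_diff_distrib inner_diff_left inner_diff_right)
  ultimately have "q (x' - x) \<le> 0" by linarith
  then have xx: "x' = x" using q_pos[of "x' - x"] by force
  have "\<nu> x \<noteq> 0" using q_\<nu>[of x] x bdry_reg by (auto simp: q_def)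
  then show ?thesis using xx z by simp
qed

lemma tube_notin_body:
  assumes "x \<in> bdry" "0 < t" shows "tube (x, t) \<notin> body"
proof
  have reg: "x \<in> reg" using assms bdry_reg by auto
  assume "tube (x, t) \<in> body"
  then have "\<eta> x \<bullet> (tube (x, t) - x) \<le> 0" by (rule normal_inequality[OF assms(1)])
  then show False using \<eta>_\<nu>[OF reg] h_pos[OF reg] assms(2) by (simp add: tube_def mult_le_0_iff)
qed

end

section \<open>Nearest points in the metric of the inverse of \<Theta>, and the curvature of the
  boundary\<close>

context smooth_convex_body
begin

text \<open>The normal cone at a smooth boundary point is a ray: every direction with positive
  product with the gradient enters the body, so \<open>p\<close> is nonpositive on that open
  half-space, which makes it a negative multiple of the gradient.\<close>

lemma normal_direction:
  assumes x: "x \<in> bdry" and p: "p \<noteq> 0" and cone: "\<And>z. z \<in> body \<Longrightarrow> p \<bullet> (z - x) \<le> 0"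
  obtains a where "0 < a" "p = a *\<^sub>R \<eta> x"
proof -
  have g0: "g x \<noteq> 0" using bdry_g[OF x] .
  have half: "p \<bullet> v \<le> 0" if v: "0 < g x \<bullet> v" for v
  proof -
    have "((\<lambda>s. F (x + s *\<^sub>R v)) has_derivative (\<lambda>s. g x \<bullet> (s *\<^sub>R v))) (at 0)"
      by (rule has_derivative_compose[of "\<lambda>s. x + s *\<^sub>R v" _ 0 UNIV F, simplified])
        (auto intro!: derivative_eq_intros F_has_derivative[of x])
    then have "((\<lambda>s. F (x + s *\<^sub>R v)) has_real_derivative (g x \<bullet> v)) (at 0)"
      by (simp add: has_field_derivative_def mult.commute[of _ "g x \<bullet> v"])
    from DERIV_pos_inc_right[OF this v] obtain d where d: "0 < d"
      "\<And>s. 0 < s \<Longrightarrow> s < d \<Longrightarrow> F x < F (x + s *\<^sub>R v)" by auto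
    have "F x < F (x + (d/2) *\<^sub>R v)" using d(1) by (intro d(2)) auto
    then have "x + (d/2) *\<^sub>R v \<in> body" using bdry_F[OF x] by simp
    from cone[OF this] show ?thesis using d(1) by (simp add: mult_le_0_iff)
  qed
  define a where "a = (p \<bullet> g x) / (g x \<bullet> g x)"
  define r where "r = p - a *\<^sub>R g x"
  have gg: "0 < g x \<bullet> g x" using g0 by simp
  have rg: "r \<bullet> g x = 0" using gg by (simp add: r_def a_def inner_diff_left)
  have pr: "p \<bullet> r = r \<bullet> r"
    using rg by (simp add: r_def inner_diff_left inner_diff_right inner_commute algebra_simps)
  \<comment> \<open>The part \<open>r\<close> of \<open>p\<close> orthogonal to the gradient lies
    only on the edge of the half-space. It is tilted inwards by a multiple \<open>s\<close> of the
    gradient, with \<open>s\<close> chosen so that the tilt costs at most \<open>e\<close>.\<close>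
  have "r \<bullet> r \<le> e" if e: "0 < e" for e
  proof -
    define s where "s = e / (\<bar>p \<bullet> g x\<bar> + 1)"
    have s: "0 < s" using e by (simp add: s_def add_nonneg_pos)
    have "p \<bullet> (s *\<^sub>R g x + r) \<le> 0"
      using rg gg s by (intro half) (simp add: inner_add_right inner_commute)
    then have "r \<bullet> r \<le> - (s * (p \<bullet> g x))" by (simp add: inner_add_right pr)
    also have "\<dots> \<le> s * (\<bar>p \<bullet> g x\<bar> + 1)" 
    proof -
      have "s * (- (p \<bullet> g x)) \<le> s * (\<bar>p \<bullet> g x\<bar> + 1)" using s by (intro mult_left_mono) auto
      then show ?thesis by simp
    qed
    also have "\<dots> = e" by (simp add: s_def)
    finally show ?thesis .
  qed
  then have "r \<bullet> r \<le> 0" by (rule field_le_epsilon[of "r \<bullet> r" 0, simplified])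
  then have "r = 0" by (metis inner_eq_zero_iff inner_ge_zero order_antisym)
  then have pa: "p = a *\<^sub>R g x" by (simp add: r_def)
  have "p \<bullet> g x \<le> 0" using gg by (intro half)
  then have "a \<le> 0" using gg by (simp add: a_def divide_nonpos_pos)
  moreover have "a \<noteq> 0" using pa p by auto
  ultimately have "0 < - a * norm (g x)" using g0 by (simp add: mult_neg_pos)
  moreover have "p = (- a * norm (g x)) *\<^sub>R \<eta> x" using g0 by (simp add: pa eta_def)
  ultimately show thesis by (rule that)
qed

text \<open>First-order condition at the minimiser of \<open>q (y - z)\<close>: the vector
  \<open>\<Theta>i *v (y - x)\<close> is an outer normal, hence a multiple of \<eta>, and applying
  \<Theta> makes \<open>y - x\<close> a multiple of \<nu>. As \<open>q (\<nu> x) = 1\<close>, the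
  factor \<open>t\<close> is the distance itself.\<close>

lemma nearest_point:
  assumes ne: "body \<noteq> {}" and y: "y \<notin> body"
  obtains x t where "x \<in> bdry" "0 < t" "y = tube (x, t)" "\<And>z. z \<in> body \<Longrightarrow> t\<^sup>2 \<le> q (y - z)"
proof -
  obtain z0 where z0: "z0 \<in> body" using ne by blast
  obtain c where c: "0 < c" "\<And>v. c * (norm v)\<^sup>2 \<le> q v" using q_coercive by blast
  \<comment> \<open>By coercivity the distance exceeds that of \<open>z0\<close> outside the ball of
    this radius, so the minimum may be sought on a compact set.\<close>
  define R where "R = sqrt (q (y - z0) / c)"
  define S where "S = body \<inter> cball y R"
  have far: "q (y - z0) < q (y - z)" if "z \<notin> cball y R" for z
  proof -
    have "0 \<le> R" using q_nonneg c by (simp add: R_def)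
    have "R < norm (y - z)" using that by (simp add: dist_norm)
    then have "R\<^sup>2 < (norm (y - z))\<^sup>2" using \<open>0 \<le> R\<close> by (intro power_strict_mono) auto
    then have "q (y - z0) < c * (norm (y - z))\<^sup>2" using c q_nonneg by (simp add: R_def field_simps)
    then show ?thesis using c(2)[of "y - z"] by linarith
  qed
  have "compact S" unfolding S_def using closed_body by (intro closed_Int_compact) auto
  moreover have z0S: "z0 \<in> S" using z0 far[of z0] by (auto simp: S_def)
  moreover have "continuous_on S (\<lambda>z. q (y - z))"
    by (rule continuous_on_compose2[OF q_continuous[of UNIV]]) (auto intro!: continuous_intros)
  ultimately obtain x where x: "x \<in> S" "\<And>z. z \<in> S \<Longrightarrow> q (y - x) \<le> q (y - z)"
    using continuous_attains_inf[of S "\<lambda>z. q (y - z)"] by blast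
  have min: "q (y - x) \<le> q (y - z)" if "z \<in> body" for z
    using x(2)[of z] x(2)[OF z0S] far[of z] that by (cases "z \<in> S") (auto simp: S_def)
  have xb: "x \<in> body" using x(1) by (simp add: S_def)
  have yx: "y - x \<noteq> 0" using xb y by auto
  have first_order: "(y - x) \<bullet> (\<Theta>i *v (z - x)) \<le> 0" if z: "z \<in> body" for z
  proof (rule ccontr)
    let ?B = "(y - x) \<bullet> (\<Theta>i *v (z - x))"
    assume "\<not> ?B \<le> 0"
    then have B: "0 < ?B" by simp
    \<comment> \<open>A step so short that the quadratic term \<open>s * q (z - x)\<close> stays
      below the linear gain \<open>?B\<close>, and at most 1 to remain on the segment.\<close>
    define s where "s = min 1 (?B / (q (z - x) + 1))"
    have q1: "0 < q (z - x) + 1" using q_nonneg[of "z - x"] by linarith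
    have s: "0 < s" "s \<le> 1" using B q1 by (auto simp: s_def)
    have "s * (q (z - x) + 1) \<le> ?B"
    proof -
      have "s * (q (z - x) + 1) \<le> (?B / (q (z - x) + 1)) * (q (z - x) + 1)"
        using q1 by (intro mult_right_mono) (auto simp: s_def)
      then show ?thesis using q1 by simp
    qed
    then have sq: "s * q (z - x) < ?B" using s by (simp add: algebra_simps)
    have "x + s *\<^sub>R (z - x) = (1 - s) *\<^sub>R x + s *\<^sub>R z" by (simp add: algebra_simps)
    also have "\<dots> \<in> body" using conv xb z s by (intro convexD) auto
    finally have "q (y - x) \<le> q ((y - x) - s *\<^sub>R (z - x))"
      using min[of "x + s *\<^sub>R (z - x)"] by (simp add: algebra_simps)
    then have "2 * s * ?B \<le> s\<^sup>2 * q (z - x)" unfolding q_diff_scaleR by simp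
    then have "2 * ?B \<le> s * q (z - x)" using s by (simp add: power2_eq_square)
    then show False using sq B by linarith
  qed
  have p: "\<Theta>i *v (y - x) \<noteq> 0" using \<Theta>_inv(2)[of "y - x"] yx by (metis matrix_vector_mult_0_right)
  have cone: "(\<Theta>i *v (y - x)) \<bullet> (z - x) \<le> 0" if "z \<in> body" for z
    using first_order[OF that] by (simp add: \<Theta>i_sym)
  have xX: "x \<in> bdry"
  proof (rule ccontr)
    assume "x \<notin> bdry"
    then have "x \<in> interior body" using xb closed_body by (auto simp: frontier_def)
    then obtain e where e: "0 < e" "ball x e \<subseteq> body" by (meson mem_interior)
    define d where "d = e / (2 * norm (y - x))"
    have d: "0 < d" using e yx by (simp add: d_def)
    have "x + d *\<^sub>R (y - x) \<in> ball x e" using e yx by (simp add: d_def dist_norm)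
    then have "(y - x) \<bullet> (\<Theta>i *v (d *\<^sub>R (y - x))) \<le> 0"
      using first_order[of "x + d *\<^sub>R (y - x)"] e by auto
    then have "d * q (y - x) \<le> 0" by (simp add: q_def matrix_vector_mult_scaleR)
    then show False using d q_pos[OF yx] by (simp add: mult_le_0_iff)
  qed
  obtain a where a: "0 < a" "\<Theta>i *v (y - x) = a *\<^sub>R \<eta> x" using normal_direction[OF xX p cone] by blast
  have reg: "x \<in> reg" using xX bdry_reg by auto
  have "y - x = a *\<^sub>R (\<Theta> *v \<eta> x)" using a(2) \<Theta>_inv(2)[of "y - x"] by (simp add: matrix_vector_mult_scaleR)
  also have "\<dots> = (a * h x) *\<^sub>R \<nu> x" using h_pos[OF reg] by (simp add: \<nu>_def)
  finally have yx': "y - x = (a * h x) *\<^sub>R \<nu> x" .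
  show thesis
  proof (rule that[OF xX])
    show "0 < a * h x" using a h_pos[OF reg] by simp
    show "y = tube (x, a * h x)" using yx' by (simp add: tube_def algebra_simps)
    show "(a * h x)\<^sup>2 \<le> q (y - z)" if "z \<in> body" for z
      using min[OF that] by (simp add: yx' q_scaleR q_\<nu>[OF reg])
  qed
qed

text \<open>Minimality of \<open>t\<close> among all points of the body, as provided by
  \<open>nearest_point\<close>, turns membership of \<open>y - a\<close> in the ball into
  \<open>t \<le> \<epsilon>\<close>. Conversely \<open>q (t *\<^sub>R \<nu> x)\<close> is just the
  square of \<open>t\<close>.\<close>

lemma body_plus_ball:
  assumes \<epsilon>: "0 < \<epsilon>"
  shows "minkowski_sum body (theta_ball \<Theta> \<epsilon>) = body \<union> tube ` (bdry \<times> {0<..\<epsilon>})"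
proof (intro set_eqI iffI)
  fix y assume "y \<in> minkowski_sum body (theta_ball \<Theta> \<epsilon>)"
  then obtain a b where ab: "a \<in> body" "q b \<le> \<epsilon>\<^sup>2" "y = a + b"
    by (auto simp: minkowski_sum_def theta_ball_def q_def \<Theta>i_def)
  show "y \<in> body \<union> tube ` (bdry \<times> {0<..\<epsilon>})"
  proof (cases "y \<in> body")
    case False
    then obtain x t where xt: "x \<in> bdry" "0 < t" "y = tube (x, t)" "\<And>z. z \<in> body \<Longrightarrow> t\<^sup>2 \<le> q (y - z)"
      using nearest_point ab(1) by (metis empty_iff)
    have "t\<^sup>2 \<le> q (y - a)" by (rule xt(4)[OF ab(1)])
    moreover have "y - a = b" using ab(3) by simp
    ultimately have "t\<^sup>2 \<le> \<epsilon>\<^sup>2" using ab(2) by simp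
    then have "t \<le> \<epsilon>" using \<epsilon> by (intro power2_le_imp_le[of t \<epsilon>]) auto
    then show ?thesis using xt(1-3) by auto
  qed auto
next
  fix y assume "y \<in> body \<union> tube ` (bdry \<times> {0<..\<epsilon>})"
  then consider "y \<in> body" | x t where "x \<in> bdry" "0 < t" "t \<le> \<epsilon>" "y = x + t *\<^sub>R \<nu> x"
    by (auto simp: tube_def)
  then show "y \<in> minkowski_sum body (theta_ball \<Theta> \<epsilon>)"
  proof cases
    case 1
    moreover have "0 \<in> theta_ball \<Theta> \<epsilon>" by (simp add: theta_ball_def)
    ultimately show ?thesis unfolding minkowski_sum_def using add_0_right[of y] by force
  next
    case 2
    then have "q (t *\<^sub>R \<nu> x) \<le> \<epsilon>\<^sup>2"
      using q_\<nu>[of x] bdry_reg by (auto simp: q_scaleR intro!: power_mono)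
    then have "t *\<^sub>R \<nu> x \<in> theta_ball \<Theta> \<epsilon>" by (simp add: theta_ball_def q_def \<Theta>i_def)
    then show ?thesis using 2 bdry_subset unfolding minkowski_sum_def by blast
  qed
qed

lemma tube_disjoint_body: "body \<inter> tube ` (bdry \<times> {0<..\<epsilon>}) = {}"
  using tube_notin_body by force

text \<open>A positive second derivative in a tangential direction \<open>w\<close> would raise
  \<open>F\<close> above \<open>u\<close> on both sides of \<open>x\<close> along \<open>w\<close>;
  then \<open>x\<close> would be the midpoint of two interior points and so interior.\<close>

lemma hess_nonpos:
  assumes x: "x \<in> bdry" and w: "g x \<bullet> w = 0"
  shows "hess x w \<bullet> w \<le> 0"
proof (rule ccontr)
  assume "\<not> hess x w \<bullet> w \<le> 0"
  then have pos: "0 < hess x w \<bullet> w" by simp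
  have F1: "((\<lambda>s. F (x + s *\<^sub>R v)) has_real_derivative (g (x + s *\<^sub>R v) \<bullet> v)) (at s)" for s v
  proof -
    have "((\<lambda>s. F (x + s *\<^sub>R v)) has_derivative (\<lambda>r. g (x + s *\<^sub>R v) \<bullet> (r *\<^sub>R v))) (at s)"
      by (rule has_derivative_compose[of "\<lambda>s. x + s *\<^sub>R v" _ s UNIV F, simplified])
        (auto intro!: derivative_eq_intros F_has_derivative)
    then show ?thesis by (simp add: has_field_derivative_def mult.commute[of _ "g (x + s *\<^sub>R v) \<bullet> v"])
  qed
  have g1: "((\<lambda>s. g (x + s *\<^sub>R v) \<bullet> v) has_real_derivative (hess x v \<bullet> v)) (at 0)" for v
  proof -
    have "((\<lambda>s. g (x + s *\<^sub>R v)) has_derivative (\<lambda>r. hess x (r *\<^sub>R v))) (at 0)"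
      by (rule has_derivative_compose[of "\<lambda>s. x + s *\<^sub>R v" _ 0 UNIV g, simplified])
        (auto intro!: derivative_eq_intros g_has_derivative[of x])
    then have "((\<lambda>s. g (x + s *\<^sub>R v) \<bullet> v) has_derivative (\<lambda>r. hess x (r *\<^sub>R v) \<bullet> v)) (at 0)"
      by (rule has_derivative_inner_left)
    moreover have "hess x (r *\<^sub>R v) = r *\<^sub>R hess x v" for r
      using linear_cmul[OF has_derivative_linear[OF g_has_derivative]] .
    ultimately show ?thesis by (simp add: has_field_derivative_def mult.commute[of _ "hess x v \<bullet> v"])
  qed
  have side: "\<exists>d>0. \<forall>s. 0 < s \<and> s < d \<longrightarrow> u < F (x + s *\<^sub>R v)"
    if v: "0 < hess x v \<bullet> v" "g x \<bullet> v = 0" for v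
  proof -
    obtain d where d: "0 < d" "\<And>s. 0 < s \<Longrightarrow> s < d \<Longrightarrow> g x \<bullet> v < g (x + s *\<^sub>R v) \<bullet> v"
      using DERIV_pos_inc_right[OF g1 v(1)] by auto
    have "u < F (x + s *\<^sub>R v)" if s: "0 < s" "s < d" for s
    proof -
      obtain z where z: "0 < z" "z < s" "F (x + s *\<^sub>R v) - F (x + 0 *\<^sub>R v) = (s - 0) * (g (x + z *\<^sub>R v) \<bullet> v)"
        using MVT2[OF s(1), of "\<lambda>s. F (x + s *\<^sub>R v)" "\<lambda>s. g (x + s *\<^sub>R v) \<bullet> v"] F1 by auto
      have "0 < g (x + z *\<^sub>R v) \<bullet> v" using d(2)[of z] z s v(2) by simp
      then have "0 < s * (g (x + z *\<^sub>R v) \<bullet> v)" using s by (intro mult_pos_pos)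
      then show ?thesis using z bdry_F[OF x] by simp
    qed
    then show ?thesis using d(1) by blast
  qed
  have "linear (hess x)" by (rule has_derivative_linear[OF g_has_derivative])
  then have "hess x (- w) = - hess x w" by (rule linear_neg)
  then obtain d1 d2 where d: "0 < d1" "0 < d2" "\<And>s. 0 < s \<Longrightarrow> s < d1 \<Longrightarrow> u < F (x + s *\<^sub>R w)"
    "\<And>s. 0 < s \<Longrightarrow> s < d2 \<Longrightarrow> u < F (x + s *\<^sub>R (- w))"
    using side[of w] side[of "- w"] pos w by auto
  define s where "s = min d1 d2 / 2"
  have s: "0 < s" "s < d1" "s < d2" using d(1,2) by (auto simp: s_def min_def)
  have "x + s *\<^sub>R w \<in> interior body" "x + s *\<^sub>R (- w) \<in> interior body"
    using d(3)[OF s(1,2)] d(4)[OF s(1,3)] by (auto intro: F_gt_interior)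
  then have "(1/2) *\<^sub>R (x + s *\<^sub>R w) + (1/2) *\<^sub>R (x + s *\<^sub>R (- w)) \<in> interior body"
    using convex_interior[OF conv] by (intro convexD) auto
  moreover have "(1/2) *\<^sub>R (x + s *\<^sub>R w) + (1/2) *\<^sub>R (x + s *\<^sub>R (- w)) = x"
    by (simp add: vec_eq_iff field_simps)
  ultimately show False using x by (auto simp: frontier_def)
qed

text \<open>On tangent vectors the normalisation of the gradient contributes only a multiple of the
  gradient, so the form is minus the Hessian divided by the length of the gradient.\<close>

lemma d\<eta>_nonneg:
  assumes x: "x \<in> bdry" and w: "\<eta> x \<bullet> w = 0"
  shows "0 \<le> d\<eta> x w \<bullet> w"
proof -
  have g0: "g x \<noteq> 0" by (rule bdry_g[OF x])
  then have gw: "g x \<bullet> w = 0" using w by (simp add: eta_def)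
  have "d\<eta> x w \<bullet> w = - (hess x w \<bullet> w) / norm (g x)"
    by (simp add: d\<eta>_def inner_diff_left gw)
  then show ?thesis using hess_nonpos[OF x gw] g0 by (simp add: divide_nonpos_pos)
qed

text \<open>Gram-Schmidt in the inner product of \<open>\<Theta>i\<close>, starting from \<nu> at
  the last index. Existence is what lets the \<open>SOME\<close> in \<open>frame\<close> meet its
  specification.\<close>

lemma frame_exists:
  assumes reg: "x \<in> reg"
  shows "\<exists>E. is_frame \<Theta> (\<eta> x) E"
proof -
  define N where "N = CARD('n) - 1"
  have N: "Suc N = CARD('n)" by (simp add: N_def)
  \<comment> \<open>The last index \<open>N\<close> and the first \<open>m\<close> indices are
    filled; at \<open>m = N\<close> the system is complete.\<close>
  define ON where "ON m E \<longleftrightarrow> E N = \<nu> x \<and> (\<forall>i\<in>insert N {..<m}. \<forall>j\<in>insert N {..<m}.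
    E i \<bullet> (\<Theta>i *v E j) = (if i = j then 1 else 0))" for m and E :: "nat \<Rightarrow> real^'n"
  have "m \<le> N \<Longrightarrow> \<exists>E. ON m E" for m
  proof (induction m)
    case 0
    have "ON 0 (\<lambda>_. \<nu> x)" using q_\<nu>[OF reg] by (simp add: ON_def q_def)
    then show ?case by blast
  next
    case (Suc m)
    then obtain E where E: "ON m E" by auto
    let ?I = "insert N {..<m}"
    have card: "card ?I < CARD('n)" using Suc.prems N by (simp add: card_insert_if)
    have "dim ((\<lambda>i. \<Theta>i *v E i) ` ?I) \<le> card ((\<lambda>i. \<Theta>i *v E i) ` ?I)" by (rule dim_le_card') simp
    also have "\<dots> \<le> card ?I" by (rule card_image_le) simp
    finally have "dim ((\<lambda>i. \<Theta>i *v E i) ` ?I) < DIM(real^'n)" using card by simp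
    then obtain v where v: "v \<noteq> 0" "\<And>y. y \<in> span ((\<lambda>i. \<Theta>i *v E i) ` ?I) \<Longrightarrow> orthogonal v y"
      using orthogonal_to_subspace_exists by blast
    have v0: "v \<bullet> (\<Theta>i *v E i) = 0" "E i \<bullet> (\<Theta>i *v v) = 0" if "i \<in> ?I" for i
    proof -
      show "v \<bullet> (\<Theta>i *v E i) = 0" using v(2)[OF span_base[OF imageI[OF that]]] by (simp add: orthogonal_def)
      then show "E i \<bullet> (\<Theta>i *v v) = 0" by (metis \<Theta>i_sym inner_commute)
    qed
    define e where "e = (1 / sqrt (q v)) *\<^sub>R v"
    have e: "e \<bullet> (\<Theta>i *v e) = 1"
      using q_pos[OF v(1)] q_scaleR[of "1 / sqrt (q v)" v] by (simp add: e_def q_def[symmetric] power_divide)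
    have e0: "e \<bullet> (\<Theta>i *v E i) = 0" "E i \<bullet> (\<Theta>i *v e) = 0" if "i \<in> ?I" for i
      using v0[OF that] by (simp_all add: e_def matrix_vector_mult_scaleR)
    have mI: "m \<notin> ?I" using Suc.prems by auto
    have ins: "insert N {..<Suc m} = insert m ?I" by auto
    have "ON (Suc m) (E(m := e))"
      unfolding ON_def ins
    proof (intro conjI ballI)
      show "(E(m := e)) N = \<nu> x" using E Suc.prems by (simp add: ON_def)
      fix i j assume ij: "i \<in> insert m ?I" "j \<in> insert m ?I"
      show "(E(m := e)) i \<bullet> (\<Theta>i *v (E(m := e)) j) = (if i = j then 1 else 0)"
      proof (cases "i = m")
        case True
        then show ?thesis using ij mI e e0 by (cases "j = m") auto
      next
        case im: False
        then have iI: "i \<in> ?I" using ij by auto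
        show ?thesis
        proof (cases "j = m")
          case True
          then show ?thesis using im e0(2)[OF iI] by simp
        next
          case False
          then have "j \<in> ?I" using ij by auto
          then have "E i \<bullet> (\<Theta>i *v E j) = (if i = j then 1 else 0)"
            using E iI unfolding ON_def by blast
          then show ?thesis using im False by simp
        qed
      qed
    qed
    then show ?case by blast
  qed
  then obtain E where E: "ON N E" by blast
  have "insert N {..<N} = {..<CARD('n)}" unfolding N[symmetric] by auto
  with E have "is_frame \<Theta> (\<eta> x) E"
    unfolding is_frame_def ON_def \<Theta>i_def[symmetric] N_def[symmetric] by (simp add: \<nu>_def h_def)
  then show ?thesis by blast
qed

abbreviation "E x \<equiv> frame \<Theta> F x"

lemma frame_orthonormal:
  assumes "x \<in> reg" "i < CARD('n)" "j < CARD('n)"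
  shows "E x i \<bullet> (\<Theta>i *v E x j) = (if i = j then 1 else 0)"
proof -
  have "is_frame \<Theta> (\<eta> x) (E x)" unfolding frame_def using frame_exists[OF assms(1)] by (rule someI_ex)
  then show ?thesis using assms by (auto simp: is_frame_def \<Theta>i_def)
qed

lemma frame_last: "x \<in> reg \<Longrightarrow> E x (CARD('n) - 1) = \<nu> x"
proof -
  assume "x \<in> reg"
  then have "is_frame \<Theta> (\<eta> x) (E x)" unfolding frame_def by (rule someI_ex[OF frame_exists])
  then show ?thesis by (simp add: is_frame_def \<nu>_def h_def)
qed

lemma frame_tangent:
  assumes "x \<in> reg" "i < CARD('n) - 1"
  shows "\<eta> x \<bullet> E x i = 0"
proof -
  have "E x i \<bullet> (\<Theta>i *v \<nu> x) = 0"
    using frame_orthonormal[of x i "CARD('n) - 1"] frame_last assms by simp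
  then show ?thesis using h_pos[OF assms(1)] by (simp add: \<Theta>i_\<nu> inner_commute)
qed

end

section \<open>The Jacobian of the tube map\<close>

text \<open>A permutation moving \<open>N\<close> meets the vanishing part of the row or of the
  column of \<open>N\<close>, so only permutations of \<open>S\<close> contribute.\<close>

lemma leibniz_det_unit_border:
  assumes S: "finite S" "N \<notin> S" and unit: "(\<forall>r\<in>S. b r N = 0) \<or> (\<forall>c\<in>S. b N c = 0)"
  shows "leibniz_det (insert N S) b = b N N * leibniz_det S b"
proof -
  have zero: "(\<Prod>i\<in>insert N S. b i (p i)) = 0" if p: "p permutes insert N S" "p N \<noteq> N" for p
    using unit
  proof
    assume col: "\<forall>r\<in>S. b r N = 0"
    obtain r where r: "p r = N" using permutes_surj[OF p(1)] by (metis surjD)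
    then have "r \<in> S" using p permutes_in_image[OF p(1), of r] by auto
    then show ?thesis using col r S by (intro prod_zero) auto
  next
    assume row: "\<forall>c\<in>S. b N c = 0"
    have "p N \<in> S" using permutes_in_image[OF p(1), of N] p(2) by auto
    then show ?thesis using row S by (intro prod_zero) auto
  qed
  have "leibniz_det (insert N S) b = (\<Sum>p | p permutes S. of_int (sign p) * (\<Prod>i\<in>insert N S. b i (p i)))"
    unfolding leibniz_det_def
  proof (rule sum.mono_neutral_right)
    show "finite {p. p permutes insert N S}" using S by (simp add: finite_permutations)
    show "{p. p permutes S} \<subseteq> {p. p permutes insert N S}" by (auto intro: permutes_subset)
    show "\<forall>p\<in>{p. p permutes insert N S} - {p. p permutes S}. of_int (sign p) * (\<Prod>i\<in>insert N S. b i (p i)) = 0"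
    proof
      fix p assume p: "p \<in> {p. p permutes insert N S} - {p. p permutes S}"
      then have "p N \<noteq> N" using permutes_superset[of p "insert N S" S] by auto
      then show "of_int (sign p) * (\<Prod>i\<in>insert N S. b i (p i)) = 0" using zero[of p] p by simp
    qed
  qed
  also have "\<dots> = (\<Sum>p | p permutes S. b N N * (of_int (sign p) * (\<Prod>i\<in>S. b i (p i))))"
    using S by (intro sum.cong) (auto simp: permutes_not_in)
  also have "\<dots> = b N N * leibniz_det S b" by (simp add: leibniz_det_def sum_distrib_left)
  finally show ?thesis .
qed

text \<open>Each product is expanded according to the set \<open>T\<close> of rows that contribute
  \<open>t * A\<close>. On the other rows the identity forces fixed points, so the permutation lives
  on \<open>T\<close> and yields a principal minor.\<close>

lemma leibniz_det_identity_plus: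
  fixes t :: real
  assumes S: "finite S"
  shows "leibniz_det S (\<lambda>i j. (if i = j then 1 else 0) + t * A i j) = (\<Sum>T\<in>Pow S. t ^ card T * leibniz_det T A)"
proof -
  let ?d = "\<lambda>i j. (if i = j then 1 else 0) :: real"
  have "leibniz_det S (\<lambda>i j. ?d i j + t * A i j)
     = (\<Sum>p | p permutes S. \<Sum>T\<in>Pow S. of_int (sign p) * ((\<Prod>i\<in>T. t * A i (p i)) * (\<Prod>i\<in>S - T. ?d i (p i))))"
    unfolding leibniz_det_def
    using prod_add[OF S, of "\<lambda>i. t * A i (_ i)"]
    by (intro sum.cong) (auto simp: add.commute prod_add[OF S] sum_distrib_left)
  also have "\<dots> = (\<Sum>T\<in>Pow S. \<Sum>p | p permutes S. of_int (sign p) * ((\<Prod>i\<in>T. t * A i (p i)) * (\<Prod>i\<in>S - T. ?d i (p i))))"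
    by (rule sum.swap)
  also have "\<dots> = (\<Sum>T\<in>Pow S. t ^ card T * leibniz_det T A)"
  proof (rule sum.cong[OF refl])
    fix T assume "T \<in> Pow S"
    then have T: "T \<subseteq> S" "finite T" using S by (auto intro: finite_subset)
    have "(\<Sum>p | p permutes S. of_int (sign p) * ((\<Prod>i\<in>T. t * A i (p i)) * (\<Prod>i\<in>S - T. ?d i (p i))))
      = (\<Sum>p | p permutes T. of_int (sign p) * ((\<Prod>i\<in>T. t * A i (p i)) * (\<Prod>i\<in>S - T. ?d i (p i))))"
    proof (rule sum.mono_neutral_right)
      show "finite {p. p permutes S}" using S by (simp add: finite_permutations)
      show "{p. p permutes T} \<subseteq> {p. p permutes S}" using T by (auto intro: permutes_subset)
      show "\<forall>p\<in>{p. p permutes S} - {p. p permutes T}.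
        of_int (sign p) * ((\<Prod>i\<in>T. t * A i (p i)) * (\<Prod>i\<in>S - T. ?d i (p i))) = 0"
      proof
        fix p assume p: "p \<in> {p. p permutes S} - {p. p permutes T}"
        then obtain i where "i \<in> S - T" "p i \<noteq> i" using permutes_superset[of p S T] by auto
        then have "(\<Prod>i\<in>S - T. ?d i (p i)) = 0" using S by (intro prod_zero bexI[of _ i]) auto
        then show "of_int (sign p) * ((\<Prod>i\<in>T. t * A i (p i)) * (\<Prod>i\<in>S - T. ?d i (p i))) = 0" by simp
      qed
    qed
    also have "\<dots> = (\<Sum>p | p permutes T. t ^ card T * (of_int (sign p) * (\<Prod>i\<in>T. A i (p i))))"
    proof (rule sum.cong[OF refl])
      fix p assume "p \<in> {p. p permutes T}"
      then have "p i = i" if "i \<in> S - T" for i using that by (auto simp: permutes_not_in)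
      then have "(\<Prod>i\<in>S - T. ?d i (p i)) = 1" by (intro prod.neutral) auto
      then show "of_int (sign p) * ((\<Prod>i\<in>T. t * A i (p i)) * (\<Prod>i\<in>S - T. ?d i (p i)))
         = t ^ card T * (of_int (sign p) * (\<Prod>i\<in>T. A i (p i)))"
        by (simp add: prod.distrib)
    qed
    finally show "(\<Sum>p | p permutes S. of_int (sign p) * ((\<Prod>i\<in>T. t * A i (p i)) * (\<Prod>i\<in>S - T. ?d i (p i))))
      = t ^ card T * leibniz_det T A" by (simp add: leibniz_det_def sum_distrib_left)
  qed
  finally show ?thesis .
qed

lemma leibniz_det_identity_plus_detr:
  "leibniz_det {..<N} (\<lambda>i j. (if i = j then 1 else 0) + t * A i j) = (\<Sum>j<Suc N. t ^ j * detr j N A)"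
proof -
  have "(\<Sum>T\<in>Pow {..<N}. t ^ card T * leibniz_det T A)
     = (\<Sum>j\<in>{..<Suc N}. \<Sum>T\<in>{T \<in> Pow {..<N}. card T = j}. t ^ card T * leibniz_det T A)"
  proof (rule sum.group[symmetric])
    show "card ` Pow {..<N} \<subseteq> {..<Suc N}"
      using card_mono[of "{..<N}"] by (force simp: less_Suc_eq_le)
  qed auto
  also have "\<dots> = (\<Sum>j<Suc N. t ^ j * detr j N A)"
    by (intro sum.cong) (auto simp: detr_def det_on_eq_leibniz_det sum_distrib_left intro!: sum.cong)
  finally show ?thesis by (simp add: leibniz_det_identity_plus)
qed

lemma detr_0 [simp]: "detr 0 m A = 1"
proof -
  have "{S. S \<subseteq> {..<m} \<and> card S = 0} = {{}}" by (auto dest: finite_subset)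
  moreover have "{p. p permutes ({}::nat set)} = {id}" by auto
  ultimately show ?thesis by (simp add: detr_def det_on_def)
qed

lemma leibniz_det_identity: "finite (S :: 'a set) \<Longrightarrow> leibniz_det S (\<lambda>i j. if i = j then 1 else 0) = 1"
proof -
  assume S: "finite S"
  have "leibniz_det S (\<lambda>i j. (if i = j then 1 else 0) + 0 * (0::real)) = (\<Sum>T\<in>Pow S. 0 ^ card T * leibniz_det T (\<lambda>i j. 0))"
    by (rule leibniz_det_identity_plus[OF S])
  also have "\<dots> = (\<Sum>T\<in>{{} :: 'a set}. 0 ^ card T * leibniz_det T (\<lambda>i j. 0))"
    using S by (intro sum.mono_neutral_right) (auto simp: power_0_left dest: finite_subset)
  also have "\<dots> = 1"
  proof -
    have "{p. p permutes ({}::'a set)} = {id}" by auto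
    then show ?thesis by (simp add: leibniz_det_def)
  qed
  finally show ?thesis by simp
qed

context smooth_convex_body
begin

text \<open>Derivative of the tube map once a tangent vector and \<open>dt\<close> are combined into
  one vector of the whole space: the component along \<eta> plays the role of \<open>dt\<close> and
  is sent to \<nu>, the tangential rest moves with the surface. No frame enters.\<close>

definition "tubeD x t v = (v - (\<eta> x \<bullet> v) *\<^sub>R \<eta> x) + t *\<^sub>R d\<nu> x (v - (\<eta> x \<bullet> v) *\<^sub>R \<eta> x) + (\<eta> x \<bullet> v) *\<^sub>R \<nu> x"

text \<open>The local Steiner polynomial; its coefficients are, up to factorials, the curvature
  densities \<open>Mstar_dens\<close>, and \<open>h\<close> accounts for \<nu> not being the unit
  normal.\<close>

definition "jac x t = h x * (\<Sum>j<CARD('n). t ^ j * detr j (CARD('n) - 1) (curv_mat \<Theta> F x))"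

lemma linear_d\<nu>: "x \<in> reg \<Longrightarrow> linear (d\<nu> x)"
  using \<nu>_has_derivative by (rule has_derivative_linear)

lemma linear_tubeD:
  assumes "x \<in> reg" shows "linear (tubeD x t)"
proof -
  have P: "linear (\<lambda>v. v - (\<eta> x \<bullet> v) *\<^sub>R \<eta> x)"
    by (rule linearI) (simp_all add: inner_add_right algebra_simps)
  have "linear (\<lambda>v. d\<nu> x (v - (\<eta> x \<bullet> v) *\<^sub>R \<eta> x))"
    using linear_compose[OF P linear_d\<nu>[OF assms]] by (simp add: o_def)
  moreover have "linear (\<lambda>v. (\<eta> x \<bullet> v) *\<^sub>R \<nu> x)"
    by (rule linearI) (simp_all add: inner_add_right algebra_simps)
  ultimately show ?thesis
    unfolding tubeD_def[abs_def] using P by (intro linear_compose_add linear_compose_scale_right) auto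
qed

text \<open>The second term of \<open>d\<nu>\<close> is a multiple of
  \<open>\<Theta> *v \<eta> x\<close>, whose product with \<open>w\<close> in the metric of
  \<open>\<Theta>i\<close> is that of \<eta> with \<open>w\<close>, hence 0.\<close>

lemma d\<nu>_tangential:
  assumes "\<eta> x \<bullet> w = 0"
  shows "d\<nu> x v \<bullet> (\<Theta>i *v w) = (1 / h x) * (d\<eta> x v \<bullet> w)"
  using assms by (simp add: \<Theta>i_sym d\<nu>_def matrix_vector_mult_diff_distrib matrix_vector_mult_scaleR \<Theta>_inv inner_diff_left)

lemma curv_mat_eq:
  assumes "x \<in> reg" "j < CARD('n) - 1"
  shows "curv_mat \<Theta> F x i j = d\<nu> x (E x i) \<bullet> (\<Theta>i *v E x j)"
  using d\<nu>_tangential[OF frame_tangent[OF assms], of "E x i"] frechet_derivative_at[OF \<eta>_has_derivative[OF assms(1)]]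
  by (simp add: curv_mat_def h_def)

text \<open>The map is written from the basis of tangential frame vectors and \<eta>, with matrix
  \<open>Q\<close>, to the frame itself, with matrix \<open>M\<close>. In these bases it is the
  identity plus \<open>t\<close> times the transposed curvature matrix, bordered by a unit column;
  the change of basis contributes \<open>h\<close>.\<close>

lemma det_tubeD:
  assumes reg: "x \<in> reg"
  shows "det (matrix (tubeD x t)) = jac x t"
proof -
  define N where "N = CARD('n) - 1"
  have N: "Suc N = CARD('n)" by (simp add: N_def)
  obtain e :: "nat \<Rightarrow> 'n" where e: "bij_betw e {..<CARD('n)} UNIV"
    using ex_bij_betw_nat_finite[of "UNIV :: 'n set"] by (auto simp: atLeast0LessThan)
  define k where "k = inv_into {..<CARD('n)} e"
  have k: "e (k c) = c" "k c < CARD('n)" for c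
    using e by (auto simp: k_def bij_betw_def f_inv_into_f) (metis UNIV_I bij_betw_def e inv_into_into lessThan_iff)
  have ke: "k (e i) = i" if "i < CARD('n)" for i
    using e that by (auto simp: k_def bij_betw_def inv_into_f_f)
  \<comment> \<open>Frames and curvature matrices are indexed by naturals but \<open>det\<close> by
    \<open>'n\<close>; \<open>e\<close> and \<open>k\<close> translate between them,
    \<open>mat'\<close> and \<open>cols\<close> build the matrices.\<close>
  define mat' where "mat' b = (\<chi> r c. b (k r) (k c))" for b :: "nat \<Rightarrow> nat \<Rightarrow> real"
  have det_mat': "det (mat' b) = leibniz_det {..<Suc N} b" for b
  proof -
    have "det (mat' b) = leibniz_det {..<Suc N} (\<lambda>i j. b (k (e i)) (k (e j)))"
    proof -
      have "det (mat' b) = leibniz_det UNIV (\<lambda>i j. b (k i) (k j))"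
        by (simp add: det_eq_leibniz_det leibniz_det_def mat'_def)
      then show ?thesis using leibniz_det_reindex[OF _ e, of "\<lambda>i j. b (k i) (k j)"] by (simp add: N)
    qed
    also have "\<dots> = leibniz_det {..<Suc N} b"
      unfolding leibniz_det_def N
    proof (intro sum.cong refl arg_cong2[where f="(*)"] prod.cong)
      fix p i assume "p \<in> {p. p permutes {..<CARD('n)}}" and i: "i \<in> {..<CARD('n)}"
      then have "p i < CARD('n)" using permutes_in_image[of p "{..<CARD('n)}" i] by auto
      then show "b (k (e i)) (k (e (p i))) = b i (p i)" using i ke by simp
    qed
    finally show ?thesis .
  qed
  define cols where "cols f = (\<chi> r c. f (k c) $ r)" for f :: "nat \<Rightarrow> real^'n"
  have cols_mat': "cols f ** mat' b = cols (\<lambda>c. \<Sum>i<CARD('n). b i c *\<^sub>R f i)" for f b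
  proof -
    have "(\<Sum>r\<in>UNIV. f (k r) $ a * b (k r) (k c)) = (\<Sum>i<CARD('n). b i (k c) * f i $ a)" for a c
    proof -
      have "(\<Sum>r\<in>UNIV. f (k r) $ a * b (k r) (k c)) = (\<Sum>i<CARD('n). f (k (e i)) $ a * b (k (e i)) (k c))"
        using sum.reindex_bij_betw[OF e, of "\<lambda>r. f (k r) $ a * b (k r) (k c)"] by simp
      also have "\<dots> = (\<Sum>i<CARD('n). b i (k c) * f i $ a)"
        using ke by (intro sum.cong) (auto simp: mult.commute)
      finally show ?thesis .
    qed
    then show ?thesis by (simp add: matrix_matrix_mult_def cols_def mat'_def vec_eq_iff)
  qed
  have cols_cong: "cols f = cols f'" if "\<And>i. i < CARD('n) \<Longrightarrow> f i = f' i" for f f'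
    using that k by (simp add: cols_def)
  define e' where "e' i = (if i = N then \<eta> x else E x i)" for i
  define M where "M = cols (E x)"
  define Q where "Q = cols e'"
  have mul_transpose: "(transpose (cols f) *v y) $ c = f (k c) \<bullet> y" for f y c
    by (simp add: transpose_def matrix_vector_mult_def cols_def inner_vec_def)
  have left: "(transpose M ** \<Theta>i) ** M = mat 1"
  proof -
    have "((transpose M ** \<Theta>i) ** M) $ a $ c = (if a = c then 1 else 0)" for a c
    proof -
      have "((transpose M ** \<Theta>i) ** M) $ a $ c = (((transpose M ** \<Theta>i) ** M) *v axis c 1) $ a"
        by (simp add: matrix_vector_mult_basis column_def)
      also have "\<dots> = (transpose M *v (\<Theta>i *v (M *v axis c 1))) $ a"
        by (simp add: matrix_vector_mul_assoc matrix_mul_assoc)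
      also have "M *v axis c 1 = E x (k c)"
        by (simp add: matrix_vector_mult_basis column_def M_def cols_def vec_eq_iff)
      also have "(transpose M *v (\<Theta>i *v E x (k c))) $ a = (if k a = k c then 1 else 0)"
        unfolding M_def mul_transpose using frame_orthonormal[OF reg] k by simp
      also have "(k a = k c) = (a = c)" using k(1) by metis
      finally show ?thesis .
    qed
    then show ?thesis by (simp add: mat_def vec_eq_iff)
  qed
  then have right: "M ** (transpose M ** \<Theta>i) = mat 1" by (simp add: matrix_left_right_inverse)
  \<comment> \<open>The vectors \<open>\<Theta>i *v E x i\<close> form the dual basis of the frame,
    because \<open>transpose M ** \<Theta>i\<close> is inverse to \<open>M\<close>.\<close>
  have expand: "v = (\<Sum>i<CARD('n). (v \<bullet> (\<Theta>i *v E x i)) *\<^sub>R E x i)" for v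
  proof -
    have "v = (M ** (transpose M ** \<Theta>i)) *v v" unfolding right by simp
    then have "v = M *v (transpose M *v (\<Theta>i *v v))"
      by (simp only: matrix_vector_mul_assoc matrix_mul_assoc)
    also have "\<dots> = (\<Sum>c\<in>UNIV. (E x (k c) \<bullet> (\<Theta>i *v v)) *\<^sub>R E x (k c))"
    proof -
      have m1: "M *v y = (\<Sum>c\<in>UNIV. y $ c *\<^sub>R E x (k c))" for y
        unfolding M_def matrix_mult_sum by (simp add: column_def cols_def scalar_mult_eq_scaleR)
      have m2: "(transpose M *v (\<Theta>i *v v)) $ c = E x (k c) \<bullet> (\<Theta>i *v v)" for c
        unfolding M_def by (rule mul_transpose)
      show ?thesis unfolding m1 m2 ..
    qed
    also have "\<dots> = (\<Sum>i<CARD('n). (E x (k (e i)) \<bullet> (\<Theta>i *v v)) *\<^sub>R E x (k (e i)))"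
      using sum.reindex_bij_betw[OF e, of "\<lambda>c. (E x (k c) \<bullet> (\<Theta>i *v v)) *\<^sub>R E x (k c)"] by simp
    also have "\<dots> = (\<Sum>i<CARD('n). (v \<bullet> (\<Theta>i *v E x i)) *\<^sub>R E x i)"
    proof (rule sum.cong[OF refl])
      fix i assume "i \<in> {..<CARD('n)}"
      then have "k (e i) = i" using ke by simp
      moreover have "E x i \<bullet> (\<Theta>i *v v) = v \<bullet> (\<Theta>i *v E x i)" by (simp only: \<Theta>i_sym inner_commute)
      ultimately show "(E x (k (e i)) \<bullet> (\<Theta>i *v v)) *\<^sub>R E x (k (e i)) = (v \<bullet> (\<Theta>i *v E x i)) *\<^sub>R E x i"
        by simp
    qed
    finally show ?thesis .
  qed
  have EN: "E x N = \<nu> x" unfolding N_def by (rule frame_last[OF reg])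
  have tang: "\<eta> x \<bullet> E x i = 0" if "i < N" for i using frame_tangent[OF reg] that by (simp add: N_def)
  have \<eta>\<eta>: "\<eta> x \<bullet> \<eta> x = 1" using norm_\<eta>[OF reg] by (simp add: norm_eq_1)
  text \<open>Both bases agree except for the last vector, where \<open>\<eta> \<bullet> \<nu> = h\<close>; hence \<open>det M = h * det Q\<close>.\<close>
  define w where "w = \<nu> x - h x *\<^sub>R \<eta> x"
  define cc where "cc i c = (if c = N then (if i = N then h x else w \<bullet> (\<Theta>i *v E x i)) else (if i = c then 1 else 0))" for i c
  have sumN: "(\<Sum>i<CARD('n). f i) = (\<Sum>i<N. f i) + f N" for f :: "nat \<Rightarrow> real^'n"
    unfolding N[symmetric] by simp
  have wN: "w \<bullet> (\<Theta>i *v E x N) = 0"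
  proof -
    have "w \<bullet> \<eta> x = \<eta> x \<bullet> \<nu> x - h x * (\<eta> x \<bullet> \<eta> x)"
      unfolding w_def inner_diff_left by (simp add: inner_commute)
    then have "w \<bullet> \<eta> x = 0" using \<eta>_\<nu>[OF reg] \<eta>\<eta> by simp
    then show ?thesis by (simp add: EN \<Theta>i_\<nu>)
  qed
  have "M = Q ** mat' cc"
    unfolding M_def Q_def cols_mat'
  proof (rule cols_cong)
    fix c assume c: "c < CARD('n)"
    show "E x c = (\<Sum>i<CARD('n). cc i c *\<^sub>R e' i)"
    proof (cases "c = N")
      case True
      have "(\<Sum>i<CARD('n). cc i c *\<^sub>R e' i) = (\<Sum>i<N. (w \<bullet> (\<Theta>i *v E x i)) *\<^sub>R E x i) + h x *\<^sub>R \<eta> x"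
        unfolding sumN using True by (simp add: cc_def e'_def)
      also have "(\<Sum>i<N. (w \<bullet> (\<Theta>i *v E x i)) *\<^sub>R E x i) = w"
        using expand[of w] unfolding sumN wN by simp
      finally show ?thesis using True EN by (simp add: w_def)
    next
      case False
      have "(\<Sum>i<CARD('n). cc i c *\<^sub>R e' i) = (\<Sum>i<CARD('n). if i = c then e' i else 0)"
        using False by (intro sum.cong) (auto simp: cc_def)
      then show ?thesis using False c by (simp add: e'_def)
    qed
  qed
  then have "det M = det Q * det (mat' cc)" by (simp add: det_mul)
  also have "det (mat' cc) = h x"
  proof -
    have "leibniz_det (insert N {..<N}) cc = cc N N * leibniz_det {..<N} cc"
      by (rule leibniz_det_unit_border) (auto simp: cc_def)
    also have "leibniz_det {..<N} cc = leibniz_det {..<N} (\<lambda>i j. if i = j then 1 else 0)"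
      unfolding leibniz_det_def
    proof (intro sum.cong refl arg_cong2[where f="(*)"] prod.cong)
      fix p i assume "p \<in> {p. p permutes {..<N}}" "i \<in> {..<N}"
      then have "p i < N" using permutes_in_image[of p "{..<N}" i] by auto
      then show "cc i (p i) = (if i = p i then 1 else 0)" by (simp add: cc_def)
    qed
    moreover have "cc N N = h x" by (simp add: cc_def)
    ultimately show ?thesis by (simp add: det_mat' lessThan_Suc leibniz_det_identity)
  qed
  finally have detM: "det M = h x * det Q" by simp
  define b where "b i c = (if i = c then 1 else 0) + (if c = N then 0 else t * (d\<nu> x (E x c) \<bullet> (\<Theta>i *v E x i)))" for i c
  have bN: "b N N = 1" by (simp add: b_def)
  have "matrix (tubeD x t) ** Q = M ** mat' b"
  proof -
    have lin: "linear (tubeD x t)" by (rule linear_tubeD[OF reg])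
    have "matrix (tubeD x t) ** Q = cols (\<lambda>c. tubeD x t (e' c))"
    proof -
      have "(matrix (tubeD x t) ** Q) *v axis c 1 = cols (\<lambda>c. tubeD x t (e' c)) *v axis c 1" for c
      proof -
        have "Q *v axis c 1 = e' (k c)"
          by (simp add: matrix_vector_mult_basis column_def Q_def cols_def vec_eq_iff)
        then have "(matrix (tubeD x t) ** Q) *v axis c 1 = tubeD x t (e' (k c))"
          
          unfolding matrix_vector_mul_assoc[symmetric] by (simp add: fun_cong[OF matrix_vector_mul(2)[OF lin]])
        then show ?thesis
          by (simp add: matrix_vector_mult_basis column_def cols_def vec_eq_iff)
      qed
      then show ?thesis by (simp add: matrix_vector_mult_basis column_def vec_eq_iff)
    qed
    also have "\<dots> = cols (\<lambda>c. \<Sum>i<CARD('n). b i c *\<^sub>R E x i)"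
    proof (rule cols_cong)
      fix c assume c: "c < CARD('n)"
      show "tubeD x t (e' c) = (\<Sum>i<CARD('n). b i c *\<^sub>R E x i)"
      proof (cases "c = N")
        case True
        have "d\<nu> x 0 = 0" by (rule linear_0[OF linear_d\<nu>[OF reg]])
        then have "tubeD x t (e' c) = \<nu> x" using True by (simp add: tubeD_def e'_def \<eta>\<eta>)
        moreover have "(\<Sum>i<CARD('n). b i c *\<^sub>R E x i) = (\<Sum>i<CARD('n). if i = N then E x i else 0)"
          using True by (intro sum.cong) (auto simp: b_def)
        ultimately show ?thesis using EN N by simp
      next
        case False
        then have cN: "c < N" using c N by simp
        have "tubeD x t (e' c) = E x c + t *\<^sub>R d\<nu> x (E x c)"
          using False tang[OF cN] by (simp add: tubeD_def e'_def)
        also have "\<dots> = (\<Sum>i<CARD('n). if i = c then E x i else 0) + t *\<^sub>R (\<Sum>i<CARD('n). (d\<nu> x (E x c) \<bullet> (\<Theta>i *v E x i)) *\<^sub>R E x i)"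
          using c expand[of "d\<nu> x (E x c)", symmetric] by simp
        also have "\<dots> = (\<Sum>i<CARD('n). b i c *\<^sub>R E x i)"
          unfolding scaleR_sum_right sum.distrib[symmetric] using False
          by (intro sum.cong) (auto simp: b_def algebra_simps)
        finally show ?thesis .
      qed
    qed
    finally show ?thesis by (simp add: M_def cols_mat')
  qed
  then have "det (matrix (tubeD x t)) * det Q = det M * det (mat' b)" by (metis det_mul)
  moreover have "det Q \<noteq> 0"
  proof -
    have "det ((transpose M ** \<Theta>i) ** M) = 1" unfolding left by simp
    then have "det M \<noteq> 0" by (auto simp: det_mul)
    then show ?thesis using detM by auto
  qed
  moreover have "det (mat' b) = (\<Sum>j<CARD('n). t ^ j * detr j (CARD('n) - 1) (curv_mat \<Theta> F x))"
  proof -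
    \<comment> \<open>Column \<open>c\<close> of \<open>b\<close> holds the image of
      \<open>E x c\<close>, so its entries are those of \<open>curv_mat\<close> with the indices
      exchanged.\<close>
    have "det (mat' b) = det (transpose (mat' b))" by simp
    also have "transpose (mat' b) = mat' (\<lambda>r c. b c r)" by (simp add: transpose_def mat'_def vec_eq_iff)
    also have "det \<dots> = leibniz_det (insert N {..<N}) (\<lambda>r c. b c r)" by (simp add: det_mat' lessThan_Suc)
    also have "\<dots> = b N N * leibniz_det {..<N} (\<lambda>r c. b c r)"
      by (rule leibniz_det_unit_border) (auto simp: b_def)
    also have "leibniz_det {..<N} (\<lambda>r c. b c r)
        = leibniz_det {..<N} (\<lambda>i j. (if i = j then 1 else 0) + t * curv_mat \<Theta> F x i j)"
      unfolding leibniz_det_def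
    proof (intro sum.cong refl arg_cong2[where f="(*)"] prod.cong)
      fix p i assume "p \<in> {p. p permutes {..<N}}" "i \<in> {..<N}"
      then have "p i < N" "i < N" using permutes_in_image[of p "{..<N}" i] by auto
      then show "b (p i) i = (if i = p i then 1 else 0) + t * curv_mat \<Theta> F x i (p i)"
        using curv_mat_eq[OF reg, of "p i" i] by (simp add: b_def N_def)
    qed
    finally show ?thesis unfolding leibniz_det_identity_plus_detr N bN by (simp add: N_def)
  qed
  ultimately show ?thesis using detM by (simp add: jac_def)
qed

text \<open>Pairing the equation with \<open>\<Theta>i *v p\<close>, where \<open>p\<close> is the
  tangential part, leaves \<open>q p\<close> plus a nonnegative multiple of
  \<open>d\<eta> x p \<bullet> p\<close>. By convexity both terms are nonnegative, so
  \<open>p = 0\<close>, and then the normal component vanishes too.\<close>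

lemma tubeD_inj:
  assumes x: "x \<in> bdry" and t: "0 \<le> t"
  shows "inj (tubeD x t)"
proof -
  have reg: "x \<in> reg" using x bdry_reg by auto
  have "v = 0" if v: "tubeD x t v = 0" for v
  proof -
    define \<sigma> where "\<sigma> = \<eta> x \<bullet> v"
    define p where "p = v - \<sigma> *\<^sub>R \<eta> x"
    have np: "\<eta> x \<bullet> p = 0" using norm_\<eta>[OF reg] by (simp add: p_def \<sigma>_def inner_diff_right norm_eq_1)
    have "0 = (p + t *\<^sub>R d\<nu> x p + \<sigma> *\<^sub>R \<nu> x) \<bullet> (\<Theta>i *v p)" using v by (simp add: tubeD_def p_def \<sigma>_def)
    also have "\<dots> = q p + t * ((1 / h x) * (d\<eta> x p \<bullet> p))"
      using d\<nu>_tangential[OF np, of p] np by (simp add: inner_add_left q_def \<Theta>i_sym[of "\<nu> x"] \<Theta>i_\<nu>)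
    finally have "q p = - (t * ((1 / h x) * (d\<eta> x p \<bullet> p)))" by linarith
    also have "\<dots> \<le> 0" using t h_pos[OF reg] d\<eta>_nonneg[OF x np] by (simp add: divide_nonneg_pos)
    finally have p0: "p = 0" using q_pos[of p] by force
    have "d\<nu> x 0 = 0" by (rule linear_0[OF linear_d\<nu>[OF reg]])
    with v have "p + t *\<^sub>R d\<nu> x p + \<sigma> *\<^sub>R \<nu> x = 0" by (simp add: tubeD_def p_def \<sigma>_def)
    then have "\<sigma> *\<^sub>R \<nu> x = 0" using p0 \<open>d\<nu> x 0 = 0\<close> by simp
    moreover have "\<nu> x \<noteq> 0" using q_\<nu>[OF reg] by (auto simp: q_def)
    ultimately show "v = 0" using p0 by (simp add: p_def)
  qed
  then show ?thesis using linear_injective_0[OF linear_tubeD[OF reg]] by blast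
qed

text \<open>The polynomial starts at \<open>jac x 0 = h x > 0\<close>; a zero at some
  \<open>s\<close> would make \<open>tubeD x s\<close> singular.\<close>

lemma jac_pos:
  assumes x: "x \<in> bdry" and t: "0 \<le> t"
  shows "0 < jac x t"
proof (rule ccontr)
  have reg: "x \<in> reg" using x bdry_reg by auto
  assume "\<not> 0 < jac x t"
  then have neg: "jac x t \<le> 0" by simp
  have "jac x 0 = h x"
  proof -
    have "(\<Sum>j<CARD('n). 0 ^ j * detr j (CARD('n) - 1) (curv_mat \<Theta> F x))
       = (\<Sum>j<CARD('n). if j = 0 then 1 else 0)"
      by (intro sum.cong) (auto simp: power_0_left)
    then show ?thesis by (simp add: jac_def)
  qed
  then have "0 \<le> jac x 0" using h_pos[OF reg] by simp
  moreover have "continuous_on {0..t} (jac x)" unfolding jac_def[abs_def] by (intro continuous_intros)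
  ultimately obtain s where s: "0 \<le> s" "s \<le> t" "jac x s = 0"
    using IVT2'[of "jac x" t 0 0] neg t by auto
  have "det (matrix (tubeD x s)) \<noteq> 0"
    using det_nz_iff_inj[OF linear_tubeD[OF reg]] tubeD_inj[OF x s(1)] by blast
  then show False using det_tubeD[OF reg] s(3) by simp
qed

text \<open>The defining formula involves arbitrarily chosen frames. Continuity comes from the
  determinant of \<open>tubeD\<close>, whose matrix entries are continuous.\<close>

lemma jac_continuous: "continuous_on (reg \<times> UNIV) (\<lambda>(x, t). jac x t)"
proof -
  have expand: "d\<nu> x v = (\<Sum>b\<in>Basis. (v \<bullet> b) *\<^sub>R d\<nu> x b)" if "x \<in> reg" for x v
    using linear_sum[OF linear_d\<nu>[OF that], of "\<lambda>b. (v \<bullet> b) *\<^sub>R b" Basis] linear_cmul[OF linear_d\<nu>[OF that]]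
    by (simp add: euclidean_representation)
  have fst: "continuous_on (reg \<times> UNIV) (\<lambda>p. f (fst p))" if "continuous_on reg f"
    for f :: "real^'n \<Rightarrow> real^'n"
    by (rule continuous_on_compose2[OF that]) (auto intro!: continuous_intros)
  have ent: "continuous_on (reg \<times> UNIV) (\<lambda>p. tubeD (fst p) (snd p) v)" for v
  proof -
    have "continuous_on (reg \<times> UNIV) (\<lambda>p. (v - (\<eta> (fst p) \<bullet> v) *\<^sub>R \<eta> (fst p))
      + snd p *\<^sub>R (\<Sum>b\<in>Basis. ((v - (\<eta> (fst p) \<bullet> v) *\<^sub>R \<eta> (fst p)) \<bullet> b) *\<^sub>R d\<nu> (fst p) b)
      + (\<eta> (fst p) \<bullet> v) *\<^sub>R \<nu> (fst p))"
      by (intro continuous_intros fst[OF \<eta>_continuous] fst[OF \<nu>_continuous] fst[OF d\<nu>_continuous])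
    then show ?thesis
      by (rule continuous_on_eq) (auto simp: tubeD_def expand[symmetric])
  qed
  have "continuous_on (reg \<times> UNIV) (\<lambda>p. det (matrix (tubeD (fst p) (snd p))))"
    unfolding det_def matrix_def by (simp, intro continuous_intros ent)
  then show ?thesis
    by (rule continuous_on_eq) (auto simp: det_tubeD)
qed

end

section \<open>The area formula for the tube map\<close>

text \<open>The inverse is continuous on the compact image, so the image of a Borel set is a
  preimage under a Borel function.\<close>

lemma borel_image_inj_compact:
  fixes f :: "'a::euclidean_space \<Rightarrow> 'b::euclidean_space"
  assumes D: "compact D" and f: "continuous_on D f" "inj_on f D" and C: "C \<subseteq> D" "C \<in> sets borel"
  shows "f ` C \<in> sets borel"
proof -
  define k where "k = the_inv_into D f"
  have k: "k (f x) = x" if "x \<in> D" for x using f(2) that by (simp add: k_def the_inv_into_f_f)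
  have fD: "f ` D \<in> sets borel" using compact_continuous_image[OF f(1) D] by (intro borel_closed compact_imp_closed)
  have "continuous_on (f ` D) k" by (rule continuous_on_inv[OF f(1) D]) (simp add: k)
  then have "k \<in> borel_measurable (restrict_space borel (f ` D))"
    by (rule borel_measurable_continuous_on_restrict)
  from measurable_sets[OF this C(2)] have "k -` C \<inter> f ` D \<in> sets (restrict_space borel (f ` D))"
    by (simp add: space_restrict_space)
  then have "k -` C \<inter> f ` D \<in> sets borel" using fD by (simp add: sets_restrict_space_iff)
  moreover have "k -` C \<inter> f ` D = f ` C" using k C(1) by (auto simp: image_iff)
  ultimately show ?thesis by simp
qed

lemma hausdorff_outer_expanding:
  fixes f :: "'a::metric_space \<Rightarrow> 'b::metric_space"
  assumes l: "0 < l" and ex: "\<And>x y. x \<in> A \<Longrightarrow> y \<in> A \<Longrightarrow> l * dist x y \<le> dist (f x) (f y)"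
  shows "hausdorff_outer s A \<le> ennreal ((1 / l) ^ s) * hausdorff_outer s (f ` A)"
proof -
  have inj: "inj_on f A"
  proof (rule inj_onI)
    fix x y assume "x \<in> A" "y \<in> A" "f x = f y"
    then have "l * dist x y \<le> 0" using ex[of x y] by simp
    then show "x = y" using l by (simp add: mult_le_0_iff)
  qed
  define k where "k = the_inv_into A f"
  have k: "k (f x) = x" if "x \<in> A" for x using inj that by (simp add: k_def the_inv_into_f_f)
  have "hausdorff_outer s (k ` (f ` A)) \<le> ennreal ((1 / l) ^ s) * hausdorff_outer s (f ` A)"
  proof (rule hausdorff_outer_lipschitz_image)
    fix x y assume "x \<in> f ` A" "y \<in> f ` A"
    then show "dist (k x) (k y) \<le> 1 / l * dist x y" using ex l k by (auto simp: field_simps)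
  qed (use l in auto)
  moreover have "k ` (f ` A) = A" using k by (auto simp: image_iff)
  ultimately show ?thesis by simp
qed

text \<open>\<open>Li \<circ> f\<close> is so close to the identity that it changes distances by
  factors between \<open>1 - \<delta>\<close> and \<open>1 + \<delta>\<close>; the linear map
  \<open>L\<close> then accounts for the determinant exactly.\<close>

lemma near_linear_image_measure:
  fixes f L Li :: "real^'n \<Rightarrow> real^'n"
  assumes L: "linear L" "linear Li" "\<And>x. Li (L x) = x" "\<And>y. L (Li y) = y"
    and B: "\<And>v. norm (Li v) \<le> B * norm v" and \<delta>: "0 < \<delta>" "\<delta> < 1" "B * e \<le> \<delta>" "0 \<le> B"
    and near: "\<And>p q. p \<in> S \<Longrightarrow> q \<in> S \<Longrightarrow> norm (f p - f q - L (p - q)) \<le> e * norm (p - q)"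
    and S: "S \<in> sets borel" "f ` S \<in> sets borel" "bounded (f ` S)"
  shows "emeasure lborel (f ` S) \<le> ennreal (\<bar>det (matrix L)\<bar> * (1 + \<delta>) ^ CARD('n)) * emeasure lborel S"
    and "ennreal \<bar>det (matrix L)\<bar> * emeasure lborel S \<le> ennreal ((1 / (1 - \<delta>)) ^ CARD('n)) * emeasure lborel (f ` S)"
proof -
  define k where "k p = Li (f p)" for p
  have kS: "k ` S = Li ` f ` S" by (simp add: k_def image_image)
  have borel: "k ` S \<in> sets borel" unfolding kS using L S(2) by (intro borel_linear_bij_image[of Li L]) auto
  have bd: "bounded (k ` S)"
    unfolding kS using L(2) by (intro bounded_linear_image[OF S(3)]) (simp add: linear_conv_bounded_linear)
  have close: "norm ((k p - k q) - (p - q)) \<le> \<delta> * norm (p - q)" if "p \<in> S" "q \<in> S" for p q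
  proof -
    have "(k p - k q) - (p - q) = Li (f p - f q - L (p - q))"
      using L by (simp add: k_def linear_diff)
    also have "norm \<dots> \<le> B * norm (f p - f q - L (p - q))" by (rule B)
    also have "\<dots> \<le> B * (e * norm (p - q))" using near[OF that] \<delta>(4) by (intro mult_left_mono)
    also have "\<dots> = (B * e) * norm (p - q)" by simp
    also have "\<dots> \<le> \<delta> * norm (p - q)" using \<delta>(3) by (intro mult_right_mono) auto
    finally show ?thesis .
  qed
  have up: "dist (k p) (k q) \<le> (1 + \<delta>) * dist p q" if "p \<in> S" "q \<in> S" for p q
    using close[OF that] norm_triangle_ineq2[of "k p - k q" "p - q"] by (simp add: dist_norm algebra_simps)
  have low: "(1 - \<delta>) * dist p q \<le> dist (k p) (k q)" if "p \<in> S" "q \<in> S" for p q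
    using close[OF that] norm_triangle_ineq2[of "p - q" "k p - k q"]
    by (simp add: dist_norm algebra_simps norm_minus_commute)
  have "f ` S = L ` k ` S" using L by (simp add: k_def image_image)
  then have fS: "emeasure lborel (f ` S) = ennreal \<bar>det (matrix L)\<bar> * emeasure lborel (k ` S)"
    using lborel_linear_image[OF L borel bd] by simp
  have "emeasure lborel (k ` S) \<le> ennreal ((1 + \<delta>) ^ CARD('n)) * emeasure lborel S"
    using lborel_lipschitz_image_le[OF S(1) borel _ up] \<delta> by simp
  then have "emeasure lborel (f ` S) \<le> ennreal \<bar>det (matrix L)\<bar> * (ennreal ((1 + \<delta>) ^ CARD('n)) * emeasure lborel S)"
    unfolding fS by (intro mult_left_mono) auto
  then show "emeasure lborel (f ` S) \<le> ennreal (\<bar>det (matrix L)\<bar> * (1 + \<delta>) ^ CARD('n)) * emeasure lborel S"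
    using \<delta> by (simp add: ennreal_mult mult.assoc)
  have "hausdorff_outer CARD('n) S \<le> ennreal ((1 / (1 - \<delta>)) ^ CARD('n)) * hausdorff_outer CARD('n) (k ` S)"
    using \<delta> low by (intro hausdorff_outer_expanding) auto
  then have "emeasure lborel S \<le> ennreal ((1 / (1 - \<delta>)) ^ CARD('n)) * emeasure lborel (k ` S)"
    using hausdorff_outer_eq_lborel[OF S(1)] hausdorff_outer_eq_lborel[OF borel] by simp
  then have "ennreal \<bar>det (matrix L)\<bar> * emeasure lborel S
     \<le> ennreal \<bar>det (matrix L)\<bar> * (ennreal ((1 / (1 - \<delta>)) ^ CARD('n)) * emeasure lborel (k ` S))"
    by (rule mult_left_mono) simp
  then show "ennreal \<bar>det (matrix L)\<bar> * emeasure lborel S \<le> ennreal ((1 / (1 - \<delta>)) ^ CARD('n)) * emeasure lborel (f ` S)"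
    unfolding fS by (simp add: mult.left_commute)
qed

section \<open>Surface measure and local charts of the tube\<close>

context smooth_convex_body
begin

text \<open>Surface measure, kept as a measure on all Borel sets of the space so that no subspace
  has to be carried along.\<close>

definition "bm = density (hausdorff_measure (CARD('n) - 1)) (indicator bdry)"

lemma sets_bm [simp, measurable_cong]: "sets bm = sets borel" by (simp add: bm_def)

lemma space_bm [simp]: "space bm = UNIV" by (simp add: bm_def)

lemma bdry_borel [measurable, simp]: "bdry \<in> sets borel" using closed_bdry by (rule borel_closed)

lemma emeasure_bm:
  assumes "A \<in> sets borel" "A \<subseteq> bdry"
  shows "emeasure bm A = hausdorff_outer (CARD('n) - 1) A"
proof -
  have "emeasure bm A = (\<integral>\<^sup>+x. indicator bdry x * indicator A x \<partial>hausdorff_measure (CARD('n) - 1))"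
    unfolding bm_def using assms by (intro emeasure_density) auto
  also have "\<dots> = (\<integral>\<^sup>+x. indicator A x \<partial>hausdorff_measure (CARD('n) - 1))"
    using assms by (intro nn_integral_cong) (auto split: split_indicator)
  also have "\<dots> = hausdorff_outer (CARD('n) - 1) A" using assms by (simp add: emeasure_hausdorff_measure)
  finally show ?thesis .
qed

definition "Q = bm \<Otimes>\<^sub>M (lborel :: real measure)"

lemma sets_Q [simp, measurable_cong]: "sets Q = sets borel"
proof -
  have "sets Q = sets (borel \<Otimes>\<^sub>M borel)" unfolding Q_def by (intro sets_pair_measure_cong) auto
  then show ?thesis by (simp only: borel_prod)
qed

lemma space_Q [simp]: "space Q = UNIV" by (simp add: Q_def space_pair_measure)

lemma tube_continuous: "continuous_on (reg \<times> UNIV) tube"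
  unfolding tube_def[abs_def]
  by (intro continuous_intros continuous_on_compose2[OF \<nu>_continuous]) auto

text \<open>\<open>F\<close> is constant on the boundary, so strict differentiability of
  \<open>F\<close> makes chords nearly tangential; strict differentiability of \<nu> makes the tube
  map nearly equal to \<open>tubeD x0 t0\<close> of the projected chord plus the difference of times
  along the normal.\<close>

lemma chart_estimates:
  assumes x0: "x0 \<in> bdry" and t0: "0 < t0"
  obtains A where "0 < A"
    "\<And>e. 0 < e \<Longrightarrow> e \<le> 1 \<Longrightarrow> \<exists>r>0. r \<le> e \<and> ball x0 r \<subseteq> reg \<and>
      (\<forall>x x' t t'. x \<in> bdry \<inter> ball x0 r \<longrightarrow> x' \<in> bdry \<inter> ball x0 r \<longrightarrow> \<bar>t - t0\<bar> \<le> r \<longrightarrow>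
        \<bar>\<eta> x0 \<bullet> (x - x')\<bar> \<le> e * norm (x - x') \<and>
        norm (tube (x, t) - tube (x', t')
            - tubeD x0 t0 ((x - x') - (\<eta> x0 \<bullet> (x - x')) *\<^sub>R \<eta> x0 + (t - t') *\<^sub>R \<eta> x0))
          \<le> e * A * (norm (x - x') + \<bar>t - t'\<bar>))"
proof -
  have reg0: "x0 \<in> reg" using x0 bdry_reg by auto
  have n1: "norm (\<eta> x0) = 1" by (rule norm_\<eta>[OF reg0])
  have nn: "\<eta> x0 \<bullet> \<eta> x0 = 1" using n1 by (simp add: norm_eq_1)
  have lin: "linear (d\<nu> x0)" by (rule linear_d\<nu>[OF reg0])
  obtain D where D: "0 < D" "\<And>v. norm (d\<nu> x0 v) \<le> D * norm v"
    using linear_bounded_pos[OF lin] by blast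
  \<comment> \<open>Sum of the coefficients \<open>1\<close>, \<open>t0\<close>,
    \<open>t0 * D\<close> and \<open>D + 1\<close> of the error terms proportional to the chord; the
    remaining error term has coefficient 1, which is at most \<open>A\<close>.\<close>
  define A where "A = 2 + t0 + t0 * D + D"
  have A: "0 < A" using D t0 by (simp add: A_def add_pos_pos)
  show thesis
  proof (rule that[OF A])
    fix e :: real assume e: "0 < e" "e \<le> 1"
    have g0: "0 < norm (g x0)" using bdry_g[OF x0] by simp
    have contg: "continuous_on UNIV (\<lambda>x. g x \<bullet> v)" for v by (intro continuous_intros g_continuous)
    obtain r1 where r1: "0 < r1"
      "\<And>x y. x \<in> ball x0 r1 \<Longrightarrow> y \<in> ball x0 r1 \<Longrightarrow> norm (F x - F y - g x0 \<bullet> (x - y)) \<le> (e * norm (g x0)) * norm (x - y)"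
      using strict_derivative[OF open_UNIV UNIV_I, of F "\<lambda>x v. g x \<bullet> v" "e * norm (g x0)" x0]
        F_has_derivative contg e g0 by (metis mult_pos_pos)
    obtain r2 where r2: "0 < r2" "ball x0 r2 \<subseteq> reg"
      "\<And>x y. x \<in> ball x0 r2 \<Longrightarrow> y \<in> ball x0 r2 \<Longrightarrow> norm (\<nu> x - \<nu> y - d\<nu> x0 (x - y)) \<le> e * norm (x - y)"
      by (rule strict_derivative[OF open_reg reg0, of \<nu> d\<nu> e]) (use \<nu>_has_derivative d\<nu>_continuous e in auto)
    have "isCont \<nu> x0" using \<nu>_continuous open_reg reg0 by (simp add: continuous_on_eq_continuous_at)
    then obtain r3 where r3: "0 < r3" "\<And>x. dist x x0 < r3 \<Longrightarrow> dist (\<nu> x) (\<nu> x0) < e"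
      using e(1) unfolding continuous_at_eps_delta by blast
    define r where "r = min (min r1 r2) (min r3 e)"
    have r: "0 < r" "r \<le> r1" "r \<le> r2" "r \<le> r3" "r \<le> e" using r1(1) r2(1) r3(1) e by (auto simp: r_def)
    have main: "\<bar>\<eta> x0 \<bullet> (x - x')\<bar> \<le> e * norm (x - x') \<and>
        norm (tube (x, t) - tube (x', t')
            - tubeD x0 t0 ((x - x') - (\<eta> x0 \<bullet> (x - x')) *\<^sub>R \<eta> x0 + (t - t') *\<^sub>R \<eta> x0))
          \<le> e * A * (norm (x - x') + \<bar>t - t'\<bar>)"
      if x: "x \<in> bdry \<inter> ball x0 r" "x' \<in> bdry \<inter> ball x0 r" and t: "\<bar>t - t0\<bar> \<le> r" for x x' t t'
    proof -
      let ?d = "x - x'" and ?s = "\<eta> x0 \<bullet> (x - x')"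
      have "norm (F x - F x' - g x0 \<bullet> ?d) \<le> (e * norm (g x0)) * norm ?d"
        using x r by (intro r1(2)) auto
      then have "\<bar>g x0 \<bullet> ?d\<bar> \<le> (e * norm (g x0)) * norm ?d" using bdry_F x by auto
      then have s: "\<bar>?s\<bar> \<le> e * norm ?d" using g0 by (simp add: eta_def abs_mult field_simps)
      have \<nu>1: "norm (\<nu> x - \<nu> x' - d\<nu> x0 ?d) \<le> e * norm ?d" using x r by (intro r2(3)) auto
      have \<nu>2: "norm (\<nu> x - \<nu> x') \<le> (D + 1) * norm ?d"
      proof -
        have "norm (\<nu> x - \<nu> x') \<le> norm (\<nu> x - \<nu> x' - d\<nu> x0 ?d) + norm (d\<nu> x0 ?d)"
          using norm_triangle_ineq[of "\<nu> x - \<nu> x' - d\<nu> x0 ?d" "d\<nu> x0 ?d"] by simp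
        also have "\<dots> \<le> e * norm ?d + D * norm ?d" using \<nu>1 D(2)[of ?d] by linarith
        also have "\<dots> \<le> (D + 1) * norm ?d"
          using mult_right_mono[OF e(2), of "norm ?d"] by (simp add: algebra_simps)
        finally show ?thesis .
      qed
      have \<nu>3: "norm (\<nu> x' - \<nu> x0) \<le> e"
        using r3(2)[of x'] x r by (simp add: dist_norm norm_minus_commute less_imp_le)
      define p where "p = ?d - ?s *\<^sub>R \<eta> x0"
      have np: "\<eta> x0 \<bullet> p = 0" by (simp add: p_def inner_diff_right nn)
      have n2: "\<eta> x0 \<bullet> (p + (t - t') *\<^sub>R \<eta> x0) = t - t'" by (simp add: inner_add_right np nn)
      have "tubeD x0 t0 (p + (t - t') *\<^sub>R \<eta> x0) = p + t0 *\<^sub>R d\<nu> x0 p + (t - t') *\<^sub>R \<nu> x0"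
        unfolding tubeD_def n2 by simp
      also have "d\<nu> x0 p = d\<nu> x0 ?d - ?s *\<^sub>R d\<nu> x0 (\<eta> x0)"
        by (simp add: p_def linear_diff[OF lin] linear_cmul[OF lin])
      finally have Leq: "tubeD x0 t0 (p + (t - t') *\<^sub>R \<eta> x0)
        = p + t0 *\<^sub>R (d\<nu> x0 ?d - ?s *\<^sub>R d\<nu> x0 (\<eta> x0)) + (t - t') *\<^sub>R \<nu> x0" .
      \<comment> \<open>Exact decomposition of the error: the normal part of the chord, the
        nonlinearity of \<nu>, the effect of the normal part through \<open>d\<nu>\<close>, and the
        shifts of \<open>t\<close> from \<open>t0\<close> and of the base point from
        \<open>x0\<close>. Each carries a factor \<open>e\<close>.\<close>
      have eq: "tube (x, t) - tube (x', t') - tubeD x0 t0 (p + (t - t') *\<^sub>R \<eta> x0)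
        = ?s *\<^sub>R \<eta> x0 + t0 *\<^sub>R (\<nu> x - \<nu> x' - d\<nu> x0 ?d) + (t0 * ?s) *\<^sub>R d\<nu> x0 (\<eta> x0)
          + (t - t0) *\<^sub>R (\<nu> x - \<nu> x') + (t - t') *\<^sub>R (\<nu> x' - \<nu> x0)"
        unfolding Leq by (simp add: tube_def p_def algebra_simps)
      have "norm (?s *\<^sub>R \<eta> x0) \<le> e * norm ?d" using s n1 by simp
      moreover have "norm (t0 *\<^sub>R (\<nu> x - \<nu> x' - d\<nu> x0 ?d)) \<le> t0 * (e * norm ?d)"
        using t0 \<nu>1 by (simp add: mult_left_mono)
      moreover have "norm ((t0 * ?s) *\<^sub>R d\<nu> x0 (\<eta> x0)) \<le> t0 * (e * norm ?d) * D"
      proof -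
        have "(t0 * \<bar>?s\<bar>) * norm (d\<nu> x0 (\<eta> x0)) \<le> (t0 * (e * norm ?d)) * D"
          using t0 s D(2)[of "\<eta> x0"] n1 e by (intro mult_mono mult_left_mono mult_nonneg_nonneg) auto
        then show ?thesis using t0 by (simp add: abs_mult)
      qed
      moreover have "norm ((t - t0) *\<^sub>R (\<nu> x - \<nu> x')) \<le> e * ((D + 1) * norm ?d)"
        using t r \<nu>2 e by (auto intro!: mult_mono)
      moreover have "norm ((t - t') *\<^sub>R (\<nu> x' - \<nu> x0)) \<le> \<bar>t - t'\<bar> * e"
        using \<nu>3 by (auto intro!: mult_left_mono)
      ultimately have "norm (tube (x, t) - tube (x', t') - tubeD x0 t0 (p + (t - t') *\<^sub>R \<eta> x0))
         \<le> e * norm ?d + t0 * (e * norm ?d) + t0 * (e * norm ?d) * D + e * ((D + 1) * norm ?d) + \<bar>t - t'\<bar> * e"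
        unfolding eq by (intro norm_triangle_le add_mono)
      also have "\<dots> = e * A * norm ?d + e * \<bar>t - t'\<bar>" by (simp add: A_def algebra_simps)
      also have "\<dots> \<le> e * A * norm ?d + e * A * \<bar>t - t'\<bar>"
      proof -
        have "1 \<le> A" using D t0 by (simp add: A_def)
        then have "e * 1 * \<bar>t - t'\<bar> \<le> e * A * \<bar>t - t'\<bar>"
          using e by (intro mult_right_mono mult_left_mono) auto
        then show ?thesis by simp
      qed
      finally show ?thesis using s by (simp add: p_def algebra_simps)
    qed
    have "ball x0 r \<subseteq> reg" using r2(2) r(3) by (meson subset_ball order_trans)
    then show "\<exists>r>0. r \<le> e \<and> ball x0 r \<subseteq> reg \<and>
      (\<forall>x x' t t'. x \<in> bdry \<inter> ball x0 r \<longrightarrow> x' \<in> bdry \<inter> ball x0 r \<longrightarrow> \<bar>t - t0\<bar> \<le> r \<longrightarrow>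
        \<bar>\<eta> x0 \<bullet> (x - x')\<bar> \<le> e * norm (x - x') \<and>
        norm (tube (x, t) - tube (x', t')
            - tubeD x0 t0 ((x - x') - (\<eta> x0 \<bullet> (x - x')) *\<^sub>R \<eta> x0 + (t - t') *\<^sub>R \<eta> x0))
          \<le> e * A * (norm (x - x') + \<bar>t - t'\<bar>))"
      using main r by (intro exI[of _ r]) blast
  qed
qed

end

text \<open>The two products are the total losses of the two inequalities in
  \<open>tube_local\<close>, caused by the near-linear map, the projection and the variation of
  \<open>jac\<close>. Both tend to 1 with \<delta>.\<close>

lemma exists_small_distortion:
  assumes "1 < (\<kappa>::real)"
  obtains \<delta> :: real where "0 < \<delta>" "\<delta> \<le> 1 / 2" "(1 + \<delta>) ^ n * (1 / (1 - \<delta>)) \<le> \<kappa>"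
    "(1 + \<delta>) * (1 / (1 - \<delta>)) ^ m * (1 / (1 - \<delta>)) ^ n \<le> \<kappa>"
proof -
  have "((\<lambda>\<delta>::real. (1 + \<delta>) ^ n * (1 / (1 - \<delta>))) \<longlongrightarrow> (1 + 0) ^ n * (1 / (1 - 0))) (at_right 0)"
    "((\<lambda>\<delta>::real. (1 + \<delta>) * (1 / (1 - \<delta>)) ^ m * (1 / (1 - \<delta>)) ^ n) \<longlongrightarrow> (1 + 0) * (1 / (1 - 0)) ^ m * (1 / (1 - 0)) ^ n) (at_right 0)"
    by (intro tendsto_intros; simp)+
  then have "\<forall>\<^sub>F \<delta> in at_right 0. (1 + \<delta>) ^ n * (1 / (1 - \<delta>)) < \<kappa>"
    "\<forall>\<^sub>F \<delta> in at_right 0. (1 + \<delta>) * (1 / (1 - \<delta>)) ^ m * (1 / (1 - \<delta>)) ^ n < \<kappa>"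
    using assms by (auto dest!: order_tendstoD(2))
  moreover have "\<forall>\<^sub>F \<delta>::real in at_right 0. 0 < \<delta> \<and> \<delta> < 1 / 2"
    by (auto simp: eventually_at_right_field intro!: exI[of _ "1/2"])
  ultimately have "\<forall>\<^sub>F \<delta> in at_right 0. (1 + \<delta>) ^ n * (1 / (1 - \<delta>)) < \<kappa> \<and>
      (1 + \<delta>) * (1 / (1 - \<delta>)) ^ m * (1 / (1 - \<delta>)) ^ n < \<kappa> \<and> 0 < \<delta> \<and> \<delta> < 1 / 2"
    by eventually_elim auto
  then obtain \<delta> where "(1 + \<delta>) ^ n * (1 / (1 - \<delta>)) < \<kappa> \<and>
      (1 + \<delta>) * (1 / (1 - \<delta>)) ^ m * (1 / (1 - \<delta>)) ^ n < \<kappa> \<and> 0 < \<delta> \<and> \<delta> < 1 / 2"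
    using eventually_happens'[OF trivial_limit_at_right_real] by blast
  then show thesis by (intro that[of \<delta>]) auto
qed

context smooth_convex_body
begin

text \<open>The cut-off outside \<open>reg\<close>, beyond which no continuity of \<open>jac\<close>
  is known, makes the weight Borel on the whole product.\<close>

definition "jacf p = ennreal (indicator (reg \<times> UNIV) p * jac (fst p) (snd p))"

lemma jacf_measurable [measurable]: "jacf \<in> borel_measurable borel"
proof -
  have "continuous_on (reg \<times> UNIV) (\<lambda>p. jac (fst p) (snd p))"
    using jac_continuous by (simp add: case_prod_unfold)
  then have "(\<lambda>p. indicator (reg \<times> UNIV) p *\<^sub>R jac (fst p) (snd p)) \<in> borel_measurable borel"
    using open_reg by (intro borel_measurable_continuous_on_indicator) (auto intro!: borel_open open_Times)
  then show ?thesis unfolding jacf_def[abs_def] by simp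
qed

lemma jacf_eq: "x \<in> reg \<Longrightarrow> jacf (x, t) = ennreal (jac x t)" by (simp add: jacf_def)

lemma emeasure_Q:
  assumes "sigma_finite_measure bm" "C \<in> sets borel"
  shows "emeasure Q C = (\<integral>\<^sup>+t. emeasure bm ((\<lambda>x. (x, t)) -` C) \<partial>lborel)"
proof -
  interpret pair_sigma_finite bm "lborel :: real measure"
    using assms(1) lborel.sigma_finite_measure_axioms by (rule pair_sigma_finite.intro)
  have "C \<in> sets (bm \<Otimes>\<^sub>M (lborel :: real measure))" using assms(2) sets_Q unfolding Q_def by simp
  then show ?thesis unfolding Q_def by (rule emeasure_pair_measure_alt2)
qed

text \<open>Both sides are compared with the volume of S(C), where \<open>S\<close> projects
  boundary points to the tangent hyperplane at \<open>x0\<close> and adds \<open>t\<close> times the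
  normal. From S(C) to the tube the map is nearly linear. S(C) and \<open>Q\<close> are compared
  slice by slice, since the hyperplane slices of S(C) are the projections of the slices of
  \<open>C\<close>.\<close>

lemma tube_local:
  assumes sf: "sigma_finite_measure bm" and x0: "x0 \<in> bdry" and t0: "0 < t0" and \<kappa>: "1 < \<kappa>"
  obtains \<rho> where "0 < \<rho>" "\<rho> < t0"
    "\<And>C. C \<in> sets borel \<Longrightarrow> C \<subseteq> (bdry \<inter> cball x0 \<rho>) \<times> cball t0 \<rho> \<Longrightarrow>
      tube ` C \<in> sets borel \<and>
      emeasure lborel (tube ` C) \<le> ennreal \<kappa> * (\<integral>\<^sup>+p. jacf p * indicator C p \<partial>Q) \<and>
      (\<integral>\<^sup>+p. jacf p * indicator C p \<partial>Q) \<le> ennreal \<kappa> * emeasure lborel (tube ` C)"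
proof -
  define n where "n = CARD('n)"
  have reg0: "x0 \<in> reg" using x0 bdry_reg by auto
  define n0 where "n0 = \<eta> x0"
  have n1: "norm n0 = 1" unfolding n0_def by (rule norm_\<eta>[OF reg0])
  have nn: "n0 \<bullet> n0 = 1" using n1 by (simp add: norm_eq_1)
  define J0 where "J0 = jac x0 t0"
  have J0: "0 < J0" unfolding J0_def using jac_pos[OF x0] t0 by simp
  define L where "L = tubeD x0 t0"
  have linL: "linear L" unfolding L_def by (rule linear_tubeD[OF reg0])
  have "inj L" unfolding L_def using tubeD_inj[OF x0] t0 by simp
  then obtain Li where Li: "linear Li" "\<And>x. Li (L x) = x" "\<And>x. L (Li x) = x"
    using linear_injective_isomorphism[OF linL] by blast
  obtain B where B: "0 < B" "\<And>v. norm (Li v) \<le> B * norm v" using linear_bounded_pos[OF Li(1)] by blast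
  have detL: "det (matrix L) = J0" unfolding L_def J0_def by (rule det_tubeD[OF reg0])
  obtain \<delta> where \<delta>: "0 < \<delta>" "\<delta> \<le> 1 / 2" "(1 + \<delta>) ^ n * (1 / (1 - \<delta>)) \<le> \<kappa>"
    "(1 + \<delta>) * (1 / (1 - \<delta>)) ^ (n - 1) * (1 / (1 - \<delta>)) ^ n \<le> \<kappa>"
    by (rule exists_small_distortion[OF \<kappa>])
  obtain A where A: "0 < A"
    "\<And>e. 0 < e \<Longrightarrow> e \<le> 1 \<Longrightarrow> \<exists>r>0. r \<le> e \<and> ball x0 r \<subseteq> reg \<and>
      (\<forall>x x' t t'. x \<in> bdry \<inter> ball x0 r \<longrightarrow> x' \<in> bdry \<inter> ball x0 r \<longrightarrow> \<bar>t - t0\<bar> \<le> r \<longrightarrow>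
        \<bar>n0 \<bullet> (x - x')\<bar> \<le> e * norm (x - x') \<and>
        norm (tube (x, t) - tube (x', t') - L ((x - x') - (n0 \<bullet> (x - x')) *\<^sub>R n0 + (t - t') *\<^sub>R n0))
          \<le> e * A * (norm (x - x') + \<bar>t - t'\<bar>))"
    unfolding L_def n0_def using chart_estimates[OF x0 t0] by blast
  \<comment> \<open>The bound \<delta> makes the projection almost isometric; the second bound gives
    \<open>3 * e * A * B \<le> \<delta>\<close>, with the 3 from \<open>S_low\<close>.\<close>
  define e where "e = min \<delta> (\<delta> / (3 * A * B))"
  have e: "0 < e" "e \<le> 1" "e \<le> \<delta>" using \<delta> A(1) B(1) by (auto simp: e_def)
  have eAB: "B * (3 * e * A) \<le> \<delta>"
  proof -
    have "(3 * A * B) * e \<le> (3 * A * B) * (\<delta> / (3 * A * B))"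
      using A(1) B(1) by (intro mult_left_mono) (auto simp: e_def)
    then show ?thesis using A(1) B(1) by (simp add: algebra_simps)
  qed
  obtain r where r: "0 < r" "ball x0 r \<subseteq> reg"
    and chart: "\<And>x x' t t'. x \<in> bdry \<inter> ball x0 r \<Longrightarrow> x' \<in> bdry \<inter> ball x0 r \<Longrightarrow> \<bar>t - t0\<bar> \<le> r \<Longrightarrow>
        \<bar>n0 \<bullet> (x - x')\<bar> \<le> e * norm (x - x') \<and>
        norm (tube (x, t) - tube (x', t') - L ((x - x') - (n0 \<bullet> (x - x')) *\<^sub>R n0 + (t - t') *\<^sub>R n0))
          \<le> e * A * (norm (x - x') + \<bar>t - t'\<bar>)"
    using A(2)[OF e(1,2)] by blast
  have "isCont (\<lambda>(x, t). jac x t) (x0, t0)"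
    using jac_continuous open_reg reg0 by (simp add: continuous_on_eq_continuous_at open_Times)
  then have "\<forall>d>0. \<exists>r>0. \<forall>p. dist p (x0, t0) < r \<longrightarrow> dist (jac (fst p) (snd p)) J0 < d"
    by (simp add: continuous_at_eps_delta case_prod_unfold J0_def)
  moreover have "0 < \<delta> * J0" using \<delta>(1) J0 by simp
  ultimately obtain r' where r': "0 < r'"
    "\<And>p. dist p (x0, t0) < r' \<Longrightarrow> dist (jac (fst p) (snd p)) J0 < \<delta> * J0"
    by blast
  \<comment> \<open>Small enough for the chart, for \<open>jac\<close> to stay within relative error
    \<delta> of \<open>J0\<close> (two coordinates, hence \<open>2 * \<rho> < r'\<close>), and for
    \<open>t\<close> to stay positive.\<close>
  define \<rho> where "\<rho> = min (r / 2) (min (r' / 3) (t0 / 2))"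
  have \<rho>: "0 < \<rho>" "\<rho> < r" "2 * \<rho> < r'" "\<rho> < t0" using r(1) r'(1) t0 by (auto simp: \<rho>_def)
  define D where "D = (bdry \<inter> cball x0 \<rho>) \<times> cball t0 \<rho>"
  have cD: "compact D" unfolding D_def using closed_bdry by (intro compact_Times closed_Int_compact) auto
  have Dreg: "D \<subseteq> reg \<times> UNIV" using bdry_reg by (auto simp: D_def)
  define P where "P x = x - (n0 \<bullet> x) *\<^sub>R n0" for x
  have nP: "n0 \<bullet> P x = 0" for x by (simp add: P_def inner_diff_right nn)
  have Pd: "P x - P y = (x - y) - (n0 \<bullet> (x - y)) *\<^sub>R n0" for x y
    by (simp add: P_def inner_diff_right algebra_simps)
  have pyth: "(norm (P x - P y + s *\<^sub>R n0))\<^sup>2 = (norm (P x - P y))\<^sup>2 + s\<^sup>2" for x y s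
  proof -
    have "n0 \<bullet> (P x - P y) = 0" by (simp add: inner_diff_right nP)
    then have "orthogonal (P x - P y) (s *\<^sub>R n0)" by (simp add: orthogonal_def inner_commute)
    from norm_add_Pythagorean[OF this] show ?thesis by (simp add: n1)
  qed
  have Ple: "norm (P x - P y) \<le> norm (x - y)" for x y
  proof (rule power2_le_imp_le)
    show "(norm (P x - P y))\<^sup>2 \<le> (norm (x - y))\<^sup>2"
    proof -
      have "P x - P y + (n0 \<bullet> (x - y)) *\<^sub>R n0 = x - y" unfolding Pd by (rule diff_add_cancel)
      then have "(norm (x - y))\<^sup>2 = (norm (P x - P y))\<^sup>2 + (n0 \<bullet> (x - y))\<^sup>2"
        using pyth[of x y "n0 \<bullet> (x - y)"] by (simp only:)
      then show ?thesis using zero_le_power2[of "n0 \<bullet> (x - y)"] by linarith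
    qed
  qed auto
  have Pge: "(1 - \<delta>) * norm (x - y) \<le> norm (P x - P y)"
    if "x \<in> bdry \<inter> cball x0 \<rho>" "y \<in> bdry \<inter> cball x0 \<rho>" for x y
  proof -
    have "\<bar>n0 \<bullet> (x - y)\<bar> \<le> e * norm (x - y)" using chart[of x y t0 t0] that \<rho> r by auto
    also have "\<dots> \<le> \<delta> * norm (x - y)" using e by (intro mult_right_mono) auto
    finally have "norm (x - y) - \<delta> * norm (x - y) \<le> norm (x - y) - norm ((n0 \<bullet> (x - y)) *\<^sub>R n0)" by (simp add: n1)
    also have "\<dots> \<le> norm (P x - P y)" unfolding Pd by (rule norm_triangle_ineq2)
    finally show ?thesis by (simp add: algebra_simps)
  qed
  define S where "S p = P (fst p) + snd p *\<^sub>R n0" for p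
  have Sd: "S p - S p' = (P (fst p) - P (fst p')) + (snd p - snd p') *\<^sub>R n0" for p p'
    by (simp add: S_def algebra_simps)
  \<comment> \<open>As \<delta> \<le> 1/2, a chord is at most twice its projection; the time
    difference adds one more, which gives 3.\<close>
  have S_low: "norm (fst p - fst p') + \<bar>snd p - snd p'\<bar> \<le> 3 * norm (S p - S p')" if "p \<in> D" "p' \<in> D" for p p'
  proof -
    have "(norm (P (fst p) - P (fst p')))\<^sup>2 \<le> (norm (S p - S p'))\<^sup>2" "(snd p - snd p')\<^sup>2 \<le> (norm (S p - S p'))\<^sup>2"
      unfolding Sd pyth by auto
    then have "norm (P (fst p) - P (fst p')) \<le> norm (S p - S p')" "\<bar>snd p - snd p'\<bar> \<le> norm (S p - S p')"
      unfolding abs_le_square_iff[symmetric] by auto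
    moreover have "(1/2) * norm (fst p - fst p') \<le> (1 - \<delta>) * norm (fst p - fst p')"
      using \<delta> by (intro mult_right_mono) auto
    moreover have "(1 - \<delta>) * norm (fst p - fst p') \<le> norm (P (fst p) - P (fst p'))"
      using that by (intro Pge) (auto simp: D_def)
    ultimately show ?thesis by linarith
  qed
  have S_inj: "inj_on S D"
  proof (rule inj_onI)
    fix p p' assume "p \<in> D" "p' \<in> D" "S p = S p'"
    then have "norm (fst p - fst p') + \<bar>snd p - snd p'\<bar> \<le> 0" using S_low[of p p'] by simp
    then have "norm (fst p - fst p') = 0" "\<bar>snd p - snd p'\<bar> = 0" using norm_ge_zero[of "fst p - fst p'"] by linarith+
    then show "p = p'" by (simp add: prod_eq_iff)
  qed
  have S_cont: "continuous_on D S" unfolding S_def[abs_def] P_def by (intro continuous_intros)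
  have T_inj: "inj_on tube D"
  proof (rule inj_onI)
    fix p p' assume "p \<in> D" "p' \<in> D" "tube p = tube p'"
    then show "p = p'"
      using tube_inj[of "fst p" "fst p'" "snd p" "snd p'"] \<rho>(4) by (auto simp: D_def dist_real_def)
  qed
  have T_cont: "continuous_on D tube" using tube_continuous Dreg by (rule continuous_on_subset)
  define k where "k = the_inv_into D S"
  have k: "k (S p) = p" if "p \<in> D" for p using S_inj that by (simp add: k_def the_inv_into_f_f)
  have JD: "(1 - \<delta>) * J0 \<le> jac (fst p) (snd p)" "jac (fst p) (snd p) \<le> (1 + \<delta>) * J0" if "p \<in> D" for p
  proof -
    have "dist p (x0, t0) \<le> dist (fst p) x0 + dist (snd p) t0"
      unfolding dist_prod_def fst_conv snd_conv by (rule sqrt_sum_squares_le_sum) auto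
    also have "\<dots> < r'" using that \<rho> by (auto simp: D_def dist_commute)
    finally have "dist (jac (fst p) (snd p)) J0 < \<delta> * J0" by (rule r'(2))
    then show "(1 - \<delta>) * J0 \<le> jac (fst p) (snd p)" "jac (fst p) (snd p) \<le> (1 + \<delta>) * J0"
      by (auto simp: dist_real_def algebra_simps)
  qed
  show thesis
  proof (rule that[OF \<rho>(1,4)])
    fix C assume C: "C \<in> sets borel" "C \<subseteq> (bdry \<inter> cball x0 \<rho>) \<times> cball t0 \<rho>"
    have CD: "C \<subseteq> D" using C(2) by (simp add: D_def)
    have TC: "tube ` C \<in> sets borel" by (rule borel_image_inj_compact[OF cD T_cont T_inj CD C(1)])
    have SC: "S ` C \<in> sets borel" by (rule borel_image_inj_compact[OF cD S_cont S_inj CD C(1)])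
    have bdT: "bounded (tube ` C)"
      using compact_continuous_image[OF T_cont cD] CD by (meson bounded_subset compact_imp_bounded image_mono)
    have fS: "(tube \<circ> k) ` S ` C = tube ` C" using k CD by (force simp: image_image)
    have near: "norm ((tube \<circ> k) a - (tube \<circ> k) b - L (a - b)) \<le> (3 * e * A) * norm (a - b)"
      if ab: "a \<in> S ` C" "b \<in> S ` C" for a b
    proof -
      obtain p p' where p: "p \<in> D" "p' \<in> D" "a = S p" "b = S p'" using ab CD by blast
      have "norm (tube p - tube p' - L (S p - S p')) \<le> e * A * (norm (fst p - fst p') + \<bar>snd p - snd p'\<bar>)"
        using chart[of "fst p" "fst p'" "snd p" "snd p'"] p(1,2) \<rho>(2)
        unfolding Sd Pd by (auto simp: D_def dist_real_def abs_minus_commute)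
      also have "\<dots> \<le> e * A * (3 * norm (S p - S p'))"
        using S_low[OF p(1,2)] e(1) A(1) by (intro mult_left_mono) auto
      finally show ?thesis using p k by (simp add: algebra_simps)
    qed
    have \<delta>1: "\<delta> < 1" using \<delta> by simp
    have B0: "0 \<le> B" using B by simp
    note nl = near_linear_image_measure[OF linL Li B(2) \<delta>(1) \<delta>1 eAB B0 near SC, unfolded fS, OF _ _ TC bdT, folded n_def]
    have m1: "emeasure lborel (tube ` C) \<le> ennreal (J0 * (1 + \<delta>) ^ n) * emeasure lborel (S ` C)"
      using nl(1) detL J0 by simp
    have m2: "ennreal J0 * emeasure lborel (S ` C) \<le> ennreal ((1 / (1 - \<delta>)) ^ n) * emeasure lborel (tube ` C)"
      using nl(2) detL J0 by simp
    define sl where "sl t = (\<lambda>x. (x, t)) -` C" for t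
    have slB: "sl t \<in> sets borel" for t
      using measurable_sets[of "\<lambda>x::real^'n. (x, t)" borel borel C] C(1) unfolding sl_def
      by (simp add: borel_measurable_continuous_onI continuous_on_Pair)
    have slD: "sl t \<subseteq> bdry \<inter> cball x0 \<rho>" for t using C(2) by (auto simp: sl_def)
    have slP: "{w. n0 \<bullet> w = 0 \<and> w + t *\<^sub>R n0 \<in> S ` C} = P ` sl t" for t
    proof (intro set_eqI iffI)
      fix w assume w: "w \<in> {w. n0 \<bullet> w = 0 \<and> w + t *\<^sub>R n0 \<in> S ` C}"
      then obtain p where p: "p \<in> C" "w + t *\<^sub>R n0 = P (fst p) + snd p *\<^sub>R n0" by (auto simp: S_def)
      then have "n0 \<bullet> (w + t *\<^sub>R n0) = n0 \<bullet> (P (fst p) + snd p *\<^sub>R n0)" by simp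
      then have "t = snd p" using w by (simp add: inner_add_right nP nn)
      then show "w \<in> P ` sl t" using p by (auto simp: sl_def intro!: image_eqI[of _ _ "fst p"])
    next
      fix w assume "w \<in> P ` sl t"
      then obtain x where x: "(x, t) \<in> C" "w = P x" by (auto simp: sl_def)
      then have "w + t *\<^sub>R n0 = S (x, t)" by (simp add: S_def)
      then show "w \<in> {w. n0 \<bullet> w = 0 \<and> w + t *\<^sub>R n0 \<in> S ` C}" using x nP by auto
    qed
    have SCm: "emeasure lborel (S ` C) = (\<integral>\<^sup>+t. hausdorff_outer (n - 1) (P ` sl t) \<partial>lborel)"
      unfolding lborel_hyperplane_slices[OF n1 SC, THEN conjunct2] slP n_def ..
    have bms: "emeasure bm (sl t) = hausdorff_outer (n - 1) (sl t)" for t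
      unfolding n_def using slB slD by (intro emeasure_bm) auto
    have QC: "emeasure Q C = (\<integral>\<^sup>+t. hausdorff_outer (n - 1) (sl t) \<partial>lborel)"
      using emeasure_Q[OF sf C(1)] unfolding sl_def[symmetric] bms .
    have m3: "emeasure lborel (S ` C) \<le> emeasure Q C"
      unfolding SCm QC
    proof (rule nn_integral_mono)
      fix t
      show "hausdorff_outer (n - 1) (P ` sl t) \<le> hausdorff_outer (n - 1) (sl t)"
        using hausdorff_outer_lipschitz_image[of 1 "sl t" P "n - 1"] Ple by (simp add: dist_norm)
    qed
    have slmeas: "(\<lambda>t. hausdorff_outer (n - 1) (P ` sl t)) \<in> borel_measurable lborel"
      using lborel_hyperplane_slices[OF n1 SC, THEN conjunct1] unfolding slP n_def .
    have m4: "emeasure Q C \<le> ennreal ((1 / (1 - \<delta>)) ^ (n - 1)) * emeasure lborel (S ` C)"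
    proof -
      have "emeasure Q C \<le> (\<integral>\<^sup>+t. ennreal ((1 / (1 - \<delta>)) ^ (n - 1)) * hausdorff_outer (n - 1) (P ` sl t) \<partial>lborel)"
        unfolding QC
      proof (rule nn_integral_mono)
        fix t
        show "hausdorff_outer (n - 1) (sl t) \<le> ennreal ((1 / (1 - \<delta>)) ^ (n - 1)) * hausdorff_outer (n - 1) (P ` sl t)"
          using slD[of t] \<delta>1 by (intro hausdorff_outer_expanding) (auto simp: dist_norm intro!: Pge)
      qed
      also have "\<dots> = ennreal ((1 / (1 - \<delta>)) ^ (n - 1)) * emeasure lborel (S ` C)"
        unfolding SCm by (rule nn_integral_cmult[OF slmeas])
      finally show ?thesis .
    qed
    let ?I = "\<integral>\<^sup>+p. jacf p * indicator C p \<partial>Q"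
    have jacD: "jacf p = ennreal (jac (fst p) (snd p))" if "p \<in> C" for p
      using that CD Dreg by (auto simp: jacf_def)
    have m5: "ennreal J0 * emeasure Q C \<le> ennreal (1 / (1 - \<delta>)) * ?I"
    proof -
      have "ennreal J0 * emeasure Q C = (\<integral>\<^sup>+p. ennreal J0 * indicator C p \<partial>Q)"
        using C(1) by (simp add: nn_integral_cmult_indicator)
      also have "\<dots> \<le> (\<integral>\<^sup>+p. ennreal (1 / (1 - \<delta>)) * (jacf p * indicator C p) \<partial>Q)"
      proof (rule nn_integral_mono)
        fix p
        show "ennreal J0 * indicator C p \<le> ennreal (1 / (1 - \<delta>)) * (jacf p * indicator C p)"
        proof (cases "p \<in> C")
          case True
          then have "J0 \<le> (1 / (1 - \<delta>)) * jac (fst p) (snd p)"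
            using JD(1)[of p] CD \<delta>1 by (auto simp: field_simps)
          then show ?thesis using True jacD[OF True] \<delta>1 by (simp add: ennreal_mult'[symmetric] ennreal_leI)
        qed simp
      qed
      also have "\<dots> = ennreal (1 / (1 - \<delta>)) * ?I" using C(1)
        by (intro nn_integral_cmult) (simp add: measurable_cong_sets[OF sets_Q refl])
      finally show ?thesis .
    qed
    have m6: "?I \<le> ennreal ((1 + \<delta>) * J0) * emeasure Q C"
    proof -
      have "?I \<le> (\<integral>\<^sup>+p. ennreal ((1 + \<delta>) * J0) * indicator C p \<partial>Q)"
        using JD(2) CD jacD by (intro nn_integral_mono) (auto simp: ennreal_leI split: split_indicator)
      also have "\<dots> = ennreal ((1 + \<delta>) * J0) * emeasure Q C"
        using C(1) by (simp add: nn_integral_cmult_indicator)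
      finally show ?thesis .
    qed
    have "emeasure lborel (tube ` C) \<le> ennreal (J0 * (1 + \<delta>) ^ n) * emeasure Q C"
      using m1 m3 by (meson mult_left_mono order_trans zero_le)
    also have "\<dots> = ennreal ((1 + \<delta>) ^ n) * (ennreal J0 * emeasure Q C)"
      using J0 \<delta> by (simp add: ennreal_mult ac_simps)
    also have "\<dots> \<le> ennreal ((1 + \<delta>) ^ n) * (ennreal (1 / (1 - \<delta>)) * ?I)" by (intro mult_left_mono m5) auto
    also have "\<dots> = ennreal ((1 + \<delta>) ^ n * (1 / (1 - \<delta>))) * ?I"
      using \<delta> by (subst ennreal_mult) (auto simp: mult.assoc)
    also have "\<dots> \<le> ennreal \<kappa> * ?I" using \<delta>(3) by (intro mult_right_mono ennreal_leI) auto
    finally have r1: "emeasure lborel (tube ` C) \<le> ennreal \<kappa> * ?I" .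
    have "?I \<le> ennreal ((1 + \<delta>) * J0) * (ennreal ((1 / (1 - \<delta>)) ^ (n - 1)) * emeasure lborel (S ` C))"
      using m6 m4 by (meson mult_left_mono order_trans zero_le)
    also have "\<dots> = ennreal ((1 + \<delta>) * (1 / (1 - \<delta>)) ^ (n - 1)) * (ennreal J0 * emeasure lborel (S ` C))"
      using J0 \<delta> by (simp add: ennreal_mult ac_simps)
    also have "\<dots> \<le> ennreal ((1 + \<delta>) * (1 / (1 - \<delta>)) ^ (n - 1)) * (ennreal ((1 / (1 - \<delta>)) ^ n) * emeasure lborel (tube ` C))"
      by (intro mult_left_mono m2) auto
    also have "\<dots> = ennreal ((1 + \<delta>) * (1 / (1 - \<delta>)) ^ (n - 1) * (1 / (1 - \<delta>)) ^ n) * emeasure lborel (tube ` C)"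
      using \<delta> by (subst (2) ennreal_mult) (auto simp: mult.assoc)
    also have "\<dots> \<le> ennreal \<kappa> * emeasure lborel (tube ` C)" using \<delta>(4) by (intro mult_right_mono ennreal_leI) auto
    finally have r2: "?I \<le> ennreal \<kappa> * emeasure lborel (tube ` C)" .
    show "tube ` C \<in> sets borel \<and> emeasure lborel (tube ` C) \<le> ennreal \<kappa> * ?I \<and> ?I \<le> ennreal \<kappa> * emeasure lborel (tube ` C)"
      using TC r1 r2 by blast
  qed
qed

end

lemma ennreal_le_mult_gt_one:
  fixes a b :: ennreal
  assumes "\<And>\<kappa>. 1 < \<kappa> \<Longrightarrow> a \<le> ennreal \<kappa> * b"
  shows "a \<le> b"
proof (cases b)
  case (real r)
  show ?thesis
  proof (rule ennreal_le_epsilon)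
    fix e :: real assume e: "0 < e"
    define \<kappa> where "\<kappa> = 1 + e / (r + 1)"
    have "1 < \<kappa>" using e real by (simp add: \<kappa>_def)
    then have "a \<le> ennreal \<kappa> * b" by (rule assms)
    also have "\<dots> = ennreal (\<kappa> * r)" using \<open>1 < \<kappa>\<close> real by (simp add: ennreal_mult)
    also have "\<dots> \<le> ennreal (r + e)"
    proof (rule ennreal_leI)
      have "e * r / (r + 1) \<le> e" using e real by (simp add: field_simps)
      then show "\<kappa> * r \<le> r + e" by (simp add: \<kappa>_def algebra_simps)
    qed
    also have "\<dots> = b + ennreal e" using real e by simp
    finally show "a \<le> b + ennreal e" .
  qed
qed simp

section \<open>The area formula on the whole shell\<close>

context smooth_convex_body
begin

lemma tube_inj_on: "inj_on tube (bdry \<times> {0<..})"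
proof (rule inj_onI)
  fix p p' assume "p \<in> bdry \<times> {0<..}" "p' \<in> bdry \<times> {0<..}" "tube p = tube p'"
  then show "p = p'" using tube_inj[of "fst p" "fst p'" "snd p" "snd p'"] by auto
qed

text \<open>The neighbourhoods of \<open>tube_local\<close> are thinned to countably many by
  Lindelof's theorem and made disjoint. Both sides are countably additive, the volume of the image
  because \<open>tube\<close> is injective, and \<kappa> is the same on all pieces.\<close>

lemma tube_measure_approx:
  assumes sf: "sigma_finite_measure bm" and \<kappa>: "1 < \<kappa>"
    and Z: "Z \<in> sets borel" "Z \<subseteq> bdry \<times> {0<..}"
  shows "tube ` Z \<in> sets borel \<and>
    emeasure lborel (tube ` Z) \<le> ennreal \<kappa> * (\<integral>\<^sup>+p. jacf p * indicator Z p \<partial>Q) \<and>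
    (\<integral>\<^sup>+p. jacf p * indicator Z p \<partial>Q) \<le> ennreal \<kappa> * emeasure lborel (tube ` Z)"
proof (cases "Z = {}")
  case False
  define good where "good C \<longleftrightarrow> tube ` C \<in> sets borel \<and>
      emeasure lborel (tube ` C) \<le> ennreal \<kappa> * (\<integral>\<^sup>+p. jacf p * indicator C p \<partial>Q) \<and>
      (\<integral>\<^sup>+p. jacf p * indicator C p \<partial>Q) \<le> ennreal \<kappa> * emeasure lborel (tube ` C)" for C
  have "\<exists>\<rho>>0. \<forall>C. C \<in> sets borel \<longrightarrow> C \<subseteq> (bdry \<inter> cball (fst p) \<rho>) \<times> cball (snd p) \<rho> \<longrightarrow> good C"
    if p: "p \<in> bdry \<times> {0<..}" for p
  proof -
    have "fst p \<in> bdry" "0 < snd p" using p by auto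
    then show ?thesis
    proof (rule tube_local[OF sf _ _ \<kappa>], goal_cases)
      case (1 \<rho>)
      have "good C" if "C \<in> sets borel" "C \<subseteq> (bdry \<inter> cball (fst p) \<rho>) \<times> cball (snd p) \<rho>" for C
        unfolding good_def by (rule 1(3)[OF that])
      then show ?case using 1(1) by blast
    qed
  qed
  then obtain R where R: "\<And>p. p \<in> bdry \<times> {0<..} \<Longrightarrow> 0 < R p"
    "\<And>p C. p \<in> bdry \<times> {0<..} \<Longrightarrow> C \<in> sets borel \<Longrightarrow> C \<subseteq> (bdry \<inter> cball (fst p) (R p)) \<times> cball (snd p) (R p) \<Longrightarrow> good C"
    by metis
  define \<U> where "\<U> p = ball (fst p) (R p) \<times> ball (snd p) (R p)" for p
  have "open S" if "S \<in> \<U> ` (bdry \<times> {0<..})" for S using that by (auto simp: \<U>_def intro: open_Times)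
  then obtain \<F> where \<F>: "\<F> \<subseteq> \<U> ` (bdry \<times> {0<..})" "countable \<F>" "\<Union>\<F> = \<Union>(\<U> ` (bdry \<times> {0<..}))"
    using Lindelof by metis
  have ZF: "Z \<subseteq> \<Union>\<F>"
  proof
    fix p assume "p \<in> Z"
    then have "p \<in> bdry \<times> {0<..}" using Z by blast
    moreover from this have "p \<in> \<U> p" using R(1)[of p] by (simp add: \<U>_def mem_Times_iff)
    ultimately show "p \<in> \<Union>\<F>" unfolding \<F>(3) by blast
  qed
  then have "\<F> \<noteq> {}" using False by auto
  define U where "U = from_nat_into \<F>"
  have U: "range U = \<F>" using \<F>(2) \<open>\<F> \<noteq> {}\<close> by (simp add: U_def)
  have oU: "open (U i)" for i using \<F>(1) U \<open>\<And>S. S \<in> \<U> ` (bdry \<times> {0<..}) \<Longrightarrow> open S\<close> by blast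
  define V where "V i = Z \<inter> disjointed U i" for i
  have disjU: "disjointed U i \<in> sets borel" for i
  proof -
    have "range U \<subseteq> sets borel" using oU by auto
    then show ?thesis using sets.range_disjointed_sets[of U borel] by blast
  qed
  have V: "V i \<in> sets borel" for i unfolding V_def using Z(1) disjU by auto
  have VZ: "(\<Union>i. V i) = Z"
  proof -
    have "(\<Union>i. V i) = Z \<inter> (\<Union>i. disjointed U i)" by (auto simp: V_def)
    also have "\<dots> = Z" unfolding UN_disjointed_eq using ZF U by auto
    finally show ?thesis .
  qed
  have Vdisj: "disjoint_family V"
    using disjoint_family_disjointed[of U] unfolding disjoint_family_on_def V_def by blast
  have goodV: "good (V i)" for i
  proof -
    have "U i \<in> \<F>" using U by blast
    then obtain p where p: "p \<in> bdry \<times> {0<..}" "U i = \<U> p" using \<F>(1) by blast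
    have "V i \<subseteq> U i" using disjointed_subset[of U i] by (auto simp: V_def)
    have "V i \<subseteq> (bdry \<inter> cball (fst p) (R p)) \<times> cball (snd p) (R p)"
    proof
      fix z assume "z \<in> V i"
      then have "z \<in> bdry \<times> {0<..}" "z \<in> ball (fst p) (R p) \<times> ball (snd p) (R p)"
        using \<open>V i \<subseteq> U i\<close> Z(2) unfolding p(2) \<U>_def V_def by blast+
      then show "z \<in> (bdry \<inter> cball (fst p) (R p)) \<times> cball (snd p) (R p)"
        by (auto simp: mem_Times_iff)
    qed
    then show ?thesis by (rule R(2)[OF p(1) V])
  qed
  have tE: "tube ` Z = (\<Union>i. tube ` V i)" unfolding VZ[symmetric] by blast
  have tV: "tube ` V i \<in> sets borel" for i using goodV by (simp add: good_def)
  have tdisj: "disjoint_family (\<lambda>i. tube ` V i)"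
    unfolding disjoint_family_on_def
  proof (intro ballI impI)
    fix i j :: nat assume "i \<noteq> j"
    then have "V i \<inter> V j = {}" using Vdisj by (auto simp: disjoint_family_on_def)
    moreover have "V i \<subseteq> bdry \<times> {0<..}" "V j \<subseteq> bdry \<times> {0<..}" using Z(2) unfolding V_def by blast+
    ultimately show "tube ` V i \<inter> tube ` V j = {}"
      using inj_on_image_Int[OF tube_inj_on, of "V i" "V j"] by simp
  qed
  have T: "(\<Sum>i. emeasure lborel (tube ` V i)) = emeasure lborel (tube ` Z)"
    unfolding tE using tV tdisj by (intro suminf_emeasure) auto
  define \<mu> where "\<mu> = density Q jacf"
  have jQ: "jacf \<in> borel_measurable Q" using jacf_measurable by (simp add: measurable_cong_sets[OF sets_Q refl])
  have \<mu>: "emeasure \<mu> A = (\<integral>\<^sup>+p. jacf p * indicator A p \<partial>Q)" if "A \<in> sets borel" for A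
    unfolding \<mu>_def using jQ that by (intro emeasure_density) auto
  have I: "(\<Sum>i. emeasure \<mu> (V i)) = emeasure \<mu> Z"
    using suminf_emeasure[of V \<mu>] V Vdisj VZ by (auto simp: \<mu>_def)
  have "emeasure lborel (tube ` Z) \<le> (\<Sum>i. ennreal \<kappa> * emeasure \<mu> (V i))"
    unfolding T[symmetric] using goodV \<mu>[OF V] by (intro suminf_le) (auto simp: good_def)
  also have "\<dots> = ennreal \<kappa> * emeasure \<mu> Z" using I by simp
  finally have r1: "emeasure lborel (tube ` Z) \<le> ennreal \<kappa> * emeasure \<mu> Z" .
  have "emeasure \<mu> Z \<le> (\<Sum>i. ennreal \<kappa> * emeasure lborel (tube ` V i))"
    unfolding I[symmetric] using goodV \<mu>[OF V] by (intro suminf_le) (auto simp: good_def)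
  also have "\<dots> = ennreal \<kappa> * emeasure lborel (tube ` Z)" using T by simp
  finally have r2: "emeasure \<mu> Z \<le> ennreal \<kappa> * emeasure lborel (tube ` Z)" .
  have "tube ` Z \<in> sets borel" unfolding tE using tV by auto
  then show ?thesis using r1 r2 \<mu>[OF Z(1)] by simp
qed simp

lemma tube_measure:
  assumes sf: "sigma_finite_measure bm" and Z: "Z \<in> sets borel" "Z \<subseteq> bdry \<times> {0<..}"
  shows "tube ` Z \<in> sets borel" "emeasure lborel (tube ` Z) = (\<integral>\<^sup>+p. jacf p * indicator Z p \<partial>Q)"
proof -
  show "tube ` Z \<in> sets borel" using tube_measure_approx[OF sf _ Z, of 2] by simp
  show "emeasure lborel (tube ` Z) = (\<integral>\<^sup>+p. jacf p * indicator Z p \<partial>Q)"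
  proof (rule antisym)
    show "emeasure lborel (tube ` Z) \<le> (\<integral>\<^sup>+p. jacf p * indicator Z p \<partial>Q)"
      by (rule ennreal_le_mult_gt_one) (rule tube_measure_approx[OF sf _ Z, THEN conjunct2, THEN conjunct1])
    show "(\<integral>\<^sup>+p. jacf p * indicator Z p \<partial>Q) \<le> emeasure lborel (tube ` Z)"
      by (rule ennreal_le_mult_gt_one) (rule tube_measure_approx[OF sf _ Z, THEN conjunct2, THEN conjunct2])
  qed
qed

lemma \<eta>_measurable [measurable]: "\<eta> \<in> borel_measurable borel"
proof -
  have [measurable]: "g \<in> borel_measurable borel" using g_continuous by (rule borel_measurable_continuous_onI)
  show ?thesis unfolding eta_def[abs_def] by measurable
qed

lemma \<Theta>_mult_measurable [measurable]: "(\<lambda>v. \<Theta> *v v) \<in> borel_measurable borel"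
  by (intro borel_measurable_continuous_onI matrix_vector_mult_linear_continuous_on)

lemma h_measurable [measurable]: "h \<in> borel_measurable borel"
  unfolding h_def[abs_def] theta_norm_def by measurable

lemma \<nu>_measurable [measurable]: "\<nu> \<in> borel_measurable borel"
  unfolding \<nu>_def[abs_def] by measurable

lemma tube_measurable [measurable]: "tube \<in> borel_measurable borel"
  unfolding tube_def[abs_def] borel_prod[symmetric] by measurable

text \<open>Lebesgue measure on the shell is the image under \<open>tube\<close> of the product
  measure weighted by \<open>jacf\<close>: the two agree on Borel sets by
  \<open>tube_measure\<close> applied to preimages. The inner integral is over \<open>t\<close>,
  where the expansion is made.\<close>

lemma nn_integral_tube:
  assumes sf: "sigma_finite_measure bm" and f [measurable]: "f \<in> borel_measurable borel"
  shows "(\<integral>\<^sup>+y. f y * indicator (tube ` (bdry \<times> {0<..\<epsilon>})) y \<partial>lborel)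
    = (\<integral>\<^sup>+x. (\<integral>\<^sup>+t. f (tube (x, t)) * (jacf (x, t) * indicator (bdry \<times> {0<..\<epsilon>}) (x, t)) \<partial>lborel) \<partial>bm)"
proof -
  define Y where "Y = bdry \<times> {0<..\<epsilon>}"
  have Y: "Y \<in> sets borel" "Y \<subseteq> bdry \<times> {0<..}"
    unfolding Y_def by (auto intro!: borel_Times)
  have tY: "tube ` Y \<in> sets borel" by (rule tube_measure(1)[OF sf Y])
  have tQ: "tube \<in> Q \<rightarrow>\<^sub>M borel" using tube_measurable by (simp add: measurable_cong_sets[OF sets_Q refl])
  have jY: "(\<lambda>p. jacf p * indicator Y p) \<in> borel_measurable Q"
    using jacf_measurable Y by (simp add: measurable_cong_sets[OF sets_Q refl])
  have eq: "density lborel (indicator (tube ` Y)) = distr (density Q (\<lambda>p. jacf p * indicator Y p)) borel tube"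
  proof (rule measure_eqI)
    fix B assume "B \<in> sets (density lborel (indicator (tube ` Y)))"
    then have B: "B \<in> sets borel" by simp
    have tB: "tube -` B \<in> sets borel" using measurable_sets[OF tube_measurable B] by simp
    have "emeasure (density lborel (indicator (tube ` Y))) B = emeasure lborel (tube ` Y \<inter> B)"
      using tY B by (subst emeasure_density) (auto simp flip: indicator_inter_arith)
    also have "tube ` Y \<inter> B = tube ` (Y \<inter> tube -` B)" by blast
    also have "emeasure lborel \<dots> = (\<integral>\<^sup>+p. jacf p * indicator (Y \<inter> tube -` B) p \<partial>Q)"
      using Y tB by (intro tube_measure(2)[OF sf]) auto
    also have "\<dots> = (\<integral>\<^sup>+p. (jacf p * indicator Y p) * indicator (tube -` B) p \<partial>Q)"
      by (intro nn_integral_cong) (auto split: split_indicator)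
    also have "\<dots> = emeasure (density Q (\<lambda>p. jacf p * indicator Y p)) (tube -` B)"
      using jY tB by (intro emeasure_density[symmetric]) auto
    also have "\<dots> = emeasure (distr (density Q (\<lambda>p. jacf p * indicator Y p)) borel tube) B"
      using B tQ by (subst emeasure_distr) auto
    finally show "emeasure (density lborel (indicator (tube ` Y))) B
      = emeasure (distr (density Q (\<lambda>p. jacf p * indicator Y p)) borel tube) B" .
  qed simp
  have "(\<integral>\<^sup>+y. f y * indicator (tube ` Y) y \<partial>lborel) = (\<integral>\<^sup>+y. f y \<partial>density lborel (indicator (tube ` Y)))"
    using tY by (subst nn_integral_density) (auto simp: mult.commute)
  also have "\<dots> = (\<integral>\<^sup>+p. f (tube p) \<partial>density Q (\<lambda>p. jacf p * indicator Y p))"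
    unfolding eq using tQ by (subst nn_integral_distr) auto
  also have "\<dots> = (\<integral>\<^sup>+p. f (tube p) * (jacf p * indicator Y p) \<partial>Q)"
    using jY tQ by (subst nn_integral_density) (auto simp: mult.commute)
  also have "\<dots> = (\<integral>\<^sup>+x. (\<integral>\<^sup>+t. f (tube (x, t)) * (jacf (x, t) * indicator Y (x, t)) \<partial>lborel) \<partial>bm)"
  proof -
    have "(\<lambda>p. f (tube p) * (jacf p * indicator Y p)) \<in> borel_measurable Q"
      by (rule borel_measurable_times_ennreal[OF measurable_compose[OF tQ f] jY])
    then show ?thesis unfolding Q_def by (intro lborel.nn_integral_fst[symmetric])
  qed
  finally show ?thesis unfolding Y_def .
qed

end

section \<open>Taylor expansion of the Gaussian density along the normals\<close>

lemma poly_gauss_has_derivative: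
  fixes y :: real
  shows "((\<lambda>y. poly p y * exp (- y\<^sup>2 / 2)) has_real_derivative poly (pderiv p - pCons 0 p) y * exp (- y\<^sup>2 / 2)) (at y)"
proof -
  have "((\<lambda>y::real. exp (- y\<^sup>2 / 2)) has_real_derivative (- y) * exp (- y\<^sup>2 / 2)) (at y)"
    by (auto intro!: derivative_eq_intros)
  from DERIV_mult[OF poly_DERIV[of p y] this]
  show ?thesis by (rule DERIV_cong) (simp add: algebra_simps)
qed

text \<open>By the recursion from \<open>p\<close> to \<open>p' - y p\<close>; up to sign these are
  the Hermite polynomials. The form yields differentiability and growth bounds.\<close>

lemma higher_deriv_gauss:
  "\<exists>p. \<forall>y. (deriv ^^ k) (\<lambda>t::real. exp (- t\<^sup>2 / 2)) y = poly p y * exp (- y\<^sup>2 / 2)"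
proof (induction k)
  case 0
  show ?case by (rule exI[of _ "[:1:]"]) simp
next
  case (Suc k)
  then obtain p where "\<forall>y. (deriv ^^ k) (\<lambda>t::real. exp (- t\<^sup>2 / 2)) y = poly p y * exp (- y\<^sup>2 / 2)"
    by blast
  then have p: "(deriv ^^ k) (\<lambda>t::real. exp (- t\<^sup>2 / 2)) = (\<lambda>y. poly p y * exp (- y\<^sup>2 / 2))"
    by (intro ext) (rule spec)
  have "deriv (\<lambda>y. poly p y * exp (- y\<^sup>2 / 2)) y = poly (pderiv p - pCons 0 p) y * exp (- y\<^sup>2 / 2)" for y :: real
    by (rule DERIV_imp_deriv[OF poly_gauss_has_derivative])
  then show ?case unfolding funpow.simps o_apply p by blast
qed

lemma higher_deriv_gauss_has_derivative:
  "((deriv ^^ k) (\<lambda>t::real. exp (- t\<^sup>2 / 2)) has_real_derivative (deriv ^^ Suc k) (\<lambda>t. exp (- t\<^sup>2 / 2)) y) (at y)"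
proof -
  obtain p where "\<forall>y. (deriv ^^ k) (\<lambda>t::real. exp (- t\<^sup>2 / 2)) y = poly p y * exp (- y\<^sup>2 / 2)"
    using higher_deriv_gauss[of k] by blast
  then have p: "(deriv ^^ k) (\<lambda>t::real. exp (- t\<^sup>2 / 2)) = (\<lambda>y. poly p y * exp (- y\<^sup>2 / 2))"
    by (intro ext) (rule spec)
  have "(deriv ^^ Suc k) (\<lambda>t::real. exp (- t\<^sup>2 / 2)) y = poly (pderiv p - pCons 0 p) y * exp (- y\<^sup>2 / 2)"
    unfolding funpow.simps o_apply p by (rule DERIV_imp_deriv[OF poly_gauss_has_derivative])
  with poly_gauss_has_derivative[of p y] show ?thesis unfolding p by (simp only:)
qed

lemma poly_growth: "\<exists>C d. 0 \<le> C \<and> (\<forall>y::real. \<bar>poly p y\<bar> \<le> C * (1 + \<bar>y\<bar>) ^ d)"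
proof (induction p)
  case 0
  show ?case by (intro exI[of _ 0]) simp
next
  case (pCons a p)
  then obtain C d where C: "0 \<le> C" "\<And>y. \<bar>poly p y\<bar> \<le> C * (1 + \<bar>y\<bar>) ^ d" by blast
  have "\<bar>poly (pCons a p) y\<bar> \<le> (\<bar>a\<bar> + C) * (1 + \<bar>y\<bar>) ^ Suc d" for y
  proof -
    have "\<bar>poly (pCons a p) y\<bar> \<le> \<bar>a\<bar> + \<bar>y\<bar> * \<bar>poly p y\<bar>"
      by (simp add: abs_mult[symmetric] abs_triangle_ineq)
    also have "\<dots> \<le> \<bar>a\<bar> * (1 + \<bar>y\<bar>) ^ Suc d + (1 + \<bar>y\<bar>) * (C * (1 + \<bar>y\<bar>) ^ d)"
    proof (intro add_mono mult_mono C(2))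
      have "1 \<le> (1 + \<bar>y\<bar>) ^ Suc d" by (rule one_le_power) simp
      then show "\<bar>a\<bar> \<le> \<bar>a\<bar> * (1 + \<bar>y\<bar>) ^ Suc d" using mult_left_mono[of 1 _ "\<bar>a\<bar>"] by simp
    qed (use C(1) in auto)
    also have "\<dots> = (\<bar>a\<bar> + C) * (1 + \<bar>y\<bar>) ^ Suc d" by (simp add: algebra_simps)
    finally show ?thesis .
  qed
  then show ?case using C(1) by (intro exI[of _ "\<bar>a\<bar> + C"] exI[of _ "Suc d"]) auto
qed

text \<open>From \<open>s ^ M \<le> fact M * exp s\<close> and the square
  \<open>(s - b - 1)\<^sup>2 \<ge> 0\<close>, which bounds the exponent
  \<open>s - (s - b)\<^sup>2 / 2\<close> by \<open>b + 1 / 2\<close>.\<close>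

lemma power_gauss_bounded:
  fixes b s :: real
  assumes "0 \<le> s"
  shows "s ^ M * exp (- (s - b)\<^sup>2 / 2) \<le> fact M * exp (b + 1 / 2)"
proof -
  have "s ^ M \<le> fact M * exp s"
  proof -
    have "s ^ M / fact M \<le> exp s"
      using sum_le_suminf[OF summable_exp_generic[of s], of "{M}"] assms
      by (simp add: exp_def divide_inverse mult.commute)
    then show ?thesis by (simp add: field_simps)
  qed
  then have "s ^ M * exp (- (s - b)\<^sup>2 / 2) \<le> (fact M * exp s) * exp (- (s - b)\<^sup>2 / 2)"
    by (intro mult_right_mono) auto
  also have "\<dots> = fact M * exp (s - (s - b)\<^sup>2 / 2)"
    unfolding mult.assoc exp_add[symmetric] by simp
  also have "\<dots> \<le> fact M * exp (b + 1 / 2)"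
  proof (intro mult_left_mono)
    have "0 \<le> (s - b - 1)\<^sup>2" by simp
    then have "s - (s - b)\<^sup>2 / 2 \<le> b + 1 / 2" by (simp add: power2_eq_square field_simps)
    then show "exp (s - (s - b)\<^sup>2 / 2) \<le> exp (b + 1 / 2)" by simp
  qed auto
  finally show ?thesis .
qed

context smooth_convex_body
begin

text \<open>On \<open>reg\<close>, \<open>nrm\<close> is the quotient of lengths occurring in
  \<open>Ml\<close>, and \<open>cmp\<close> is the argument of the Hermite polynomials there, the
  component of \<open>x\<close> in the direction of \<nu>.\<close>

definition "nrm x = norm (\<nu> x)"
definition "cmp x = x \<bullet> ((1 / norm (\<Theta> *v \<eta> x)) *\<^sub>R (\<Theta> *v \<eta> x))"

text \<open>On \<open>reg\<close> this is the \<open>k\<close>-th derivative in \<open>t\<close> of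
  the Gaussian density along the normal line: splitting off the part of \<open>x\<close> orthogonal
  to \<nu> leaves a one-dimensional Gaussian in \<open>cmp x + nrm x * t\<close>.\<close>

definition "Gk k x t = (2 * pi) powr (- real CARD('n) / 2) * exp (- ((norm x)\<^sup>2 - (cmp x)\<^sup>2) / 2) * nrm x ^ k *
   (deriv ^^ k) (\<lambda>t::real. exp (- t\<^sup>2 / 2)) (cmp x + nrm x * t)"

lemma nrm_eq: "x \<in> reg \<Longrightarrow> nrm x = norm (\<Theta> *v \<eta> x) / h x"
  using h_pos[of x] by (simp add: nrm_def \<nu>_def)

lemma nrm_pos: "x \<in> reg \<Longrightarrow> 0 < nrm x"
  using q_\<nu>[of x] by (auto simp: nrm_def q_def)

lemma norm_tube:
  assumes reg: "x \<in> reg"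
  shows "(norm (x + t *\<^sub>R \<nu> x))\<^sup>2 = (norm x)\<^sup>2 - (cmp x)\<^sup>2 + (cmp x + nrm x * t)\<^sup>2"
proof -
  have "norm (\<Theta> *v \<eta> x) \<noteq> 0" using nrm_pos[OF reg] by (auto simp: nrm_eq[OF reg])
  then have xv: "x \<bullet> \<nu> x = cmp x * nrm x"
    using h_pos[OF reg] by (simp add: cmp_def nrm_eq[OF reg] \<nu>_def)
  have "(norm (x + t *\<^sub>R \<nu> x))\<^sup>2 = (norm x)\<^sup>2 + 2 * t * (x \<bullet> \<nu> x) + t\<^sup>2 * (nrm x)\<^sup>2"
    unfolding nrm_def power2_norm_eq_inner
    by (simp add: inner_add_left inner_add_right inner_commute power2_eq_square)
  then show ?thesis by (simp add: xv power2_eq_square algebra_simps)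
qed

lemma Gk_0:
  assumes "x \<in> reg" shows "Gk 0 x t = gauss_dens (x + t *\<^sub>R \<nu> x)"
  unfolding Gk_def gauss_dens_def norm_tube[OF assms]
  by (simp add: exp_add[symmetric] diff_divide_distrib add_divide_distrib)

lemma Gk_at_0: "Gk k x 0 = (-1) ^ k * nrm x ^ k * hermite k (cmp x) * gauss_dens x"
proof -
  have "(deriv ^^ k) (\<lambda>t::real. exp (- t\<^sup>2 / 2)) (cmp x)
     = (-1) ^ k * hermite k (cmp x) * exp (- (cmp x)\<^sup>2 / 2)"
    by (simp add: hermite_def exp_minus field_simps flip: power_mult_distrib)
  moreover have "exp (- ((norm x)\<^sup>2 - (cmp x)\<^sup>2) / 2) * exp (- (cmp x)\<^sup>2 / 2) = exp (- (norm x)\<^sup>2 / 2)"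
    by (simp add: exp_add[symmetric] diff_divide_distrib)
  ultimately show ?thesis by (simp add: Gk_def gauss_dens_def algebra_simps)
qed

lemma Gk_derivative: "(Gk k x has_real_derivative Gk (Suc k) x t) (at t)"
proof -
  have "((\<lambda>t. (deriv ^^ k) (\<lambda>t::real. exp (- t\<^sup>2 / 2)) (cmp x + nrm x * t))
     has_real_derivative (deriv ^^ Suc k) (\<lambda>t::real. exp (- t\<^sup>2 / 2)) (cmp x + nrm x * t) * nrm x) (at t)"
    by (rule DERIV_chain2[OF higher_deriv_gauss_has_derivative]) (auto intro!: derivative_eq_intros)
  from DERIV_cmult[OF this, of "(2 * pi) powr (- real CARD('n) / 2) * exp (- ((norm x)\<^sup>2 - (cmp x)\<^sup>2) / 2) * nrm x ^ k"]
  show ?thesis unfolding Gk_def[abs_def] by (simp add: algebra_simps)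
qed

lemma Gk_taylor:
  "\<exists>s. \<bar>s\<bar> \<le> \<bar>t\<bar> \<and> Gk 0 x t = (\<Sum>k<P. Gk k x 0 / fact k * t ^ k) + Gk P x s / fact P * t ^ P"
  using Maclaurin_all_le[of "\<lambda>k. Gk k x" "Gk 0 x" t P] Gk_derivative by auto

text \<open>Coercivity of \<open>q\<close> together with \<open>q (\<nu> x) = 1\<close>.\<close>

lemma nrm_bounded: obtains R where "0 \<le> R" "\<And>x. x \<in> reg \<Longrightarrow> nrm x \<le> R"
proof -
  obtain c where c: "0 < c" "\<And>v. c * (norm v)\<^sup>2 \<le> q v" using q_coercive by blast
  have "nrm x \<le> sqrt (1 / c)" if "x \<in> reg" for x
  proof (rule real_le_rsqrt)
    show "(nrm x)\<^sup>2 \<le> 1 / c" using c(2)[of "\<nu> x"] q_\<nu>[OF that] c(1) by (simp add: nrm_def field_simps)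
  qed
  then show ?thesis using that[of "sqrt (1 / c)"] c(1) by simp
qed

lemma h_bounded: obtains H where "0 \<le> H" "\<And>x. x \<in> reg \<Longrightarrow> h x \<le> H"
proof -
  obtain K where K: "\<And>v. norm (\<Theta> *v v) \<le> norm v * K" "0 \<le> K"
    using bounded_linear.nonneg_bounded[OF matrix_vector_mul_bounded_linear[of \<Theta>]] by blast
  have "h x \<le> sqrt K" if "x \<in> reg" for x
  proof (rule real_le_rsqrt)
    have "(h x)\<^sup>2 \<le> norm (\<eta> x) * norm (\<Theta> *v \<eta> x)" unfolding h_power2[OF that] by (rule norm_cauchy_schwarz)
    also have "\<dots> \<le> K" using K(1)[of "\<eta> x"] norm_\<eta>[OF that] by simp
    finally show "(h x)\<^sup>2 \<le> K" .
  qed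
  then show ?thesis using that[of "sqrt K"] K(2) by simp
qed

text \<open>All polynomial factors, those of the derivative as well as the weight
  \<open>1 + norm x powr \<beta>\<close>, are bounded by powers of the single quantity
  \<open>s\<close>; the Gaussian in \<open>norm z = s - b\<close> absorbs them.\<close>

lemma Gk_bounded:
  assumes \<beta>: "0 < \<beta>"
  obtains C where "0 \<le> C" "\<And>x t. x \<in> reg \<Longrightarrow> \<bar>t\<bar> \<le> 1 \<Longrightarrow> \<bar>Gk k x t\<bar> \<le> C * (1 / (1 + norm x powr \<beta>))"
proof -
  obtain R where R: "0 \<le> R" "\<And>x. x \<in> reg \<Longrightarrow> nrm x \<le> R" using nrm_bounded by blast
  obtain p where p: "\<And>y. (deriv ^^ k) (\<lambda>t::real. exp (- t\<^sup>2 / 2)) y = poly p y * exp (- y\<^sup>2 / 2)"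
    using higher_deriv_gauss by blast
  obtain B d where B: "0 \<le> B" "\<And>y. \<bar>poly p y\<bar> \<le> B * (1 + \<bar>y\<bar>) ^ d" using poly_growth by blast
  \<comment> \<open>Integer exponent not below \<beta>, so that the weight is dominated by a
    multiple of \<open>s ^ m\<close>.\<close>
  define m where "m = nat \<lceil>\<beta>\<rceil>"
  \<comment> \<open>As \<open>nrm x \<le> R\<close>, the length of \<open>x\<close> is at most
    \<open>norm z + R\<close> and the Gaussian argument has modulus at most
    \<open>norm z + 2 * R\<close>; the summand 1 gives \<open>s \<ge> 1\<close>.\<close>
  define b where "b = 1 + 2 * R"
  define c where "c = (2 * pi) powr (- real CARD('n) / 2)"
  define C where "C = c * R ^ k * B * (2 * (fact (d + m) * exp (b + 1 / 2)))"
  have c0: "0 \<le> c" by (simp add: c_def)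
  show thesis
  proof (rule that)
    show "0 \<le> C" unfolding C_def using R B c0 by auto
    fix x and t :: real assume x: "x \<in> reg" and t: "\<bar>t\<bar> \<le> 1"
    define z where "z = x + t *\<^sub>R \<nu> x"
    define s where "s = b + norm z"
    have s: "1 \<le> s" using R by (simp add: s_def b_def)
    have n0: "0 \<le> nrm x" "nrm x \<le> R" using R(2)[OF x] by (auto simp: nrm_def)
    have tr: "\<bar>t\<bar> * nrm x \<le> R" using t n0 mult_mono[of "\<bar>t\<bar>" 1 "nrm x" R] by simp
    have "norm x \<le> norm z + norm (t *\<^sub>R \<nu> x)"
      using norm_triangle_ineq4[of z "t *\<^sub>R \<nu> x"] by (simp add: z_def)
    then have nx: "norm x \<le> norm z + R" using tr by (simp add: nrm_def)
    have "\<bar>cmp x\<bar> \<le> norm x * norm ((1 / norm (\<Theta> *v \<eta> x)) *\<^sub>R (\<Theta> *v \<eta> x))"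
      unfolding cmp_def by (rule Cauchy_Schwarz_ineq2)
    also have "\<dots> \<le> norm x * 1" by (intro mult_left_mono) auto
    finally have ax: "\<bar>cmp x\<bar> \<le> norm x" by simp
    have ys: "1 + \<bar>cmp x + nrm x * t\<bar> \<le> s"
    proof -
      have "\<bar>cmp x + nrm x * t\<bar> \<le> \<bar>cmp x\<bar> + \<bar>t\<bar> * nrm x"
        using abs_triangle_ineq[of "cmp x" "nrm x * t"] n0 by (simp add: abs_mult mult.commute)
      then show ?thesis using ax nx tr by (simp add: s_def b_def)
    qed
    have xs: "1 + norm x powr \<beta> \<le> 2 * s ^ m"
    proof -
      have "norm x powr \<beta> \<le> s powr \<beta>" using nx R \<beta> by (intro powr_mono2) (auto simp: s_def b_def)
      also have "\<dots> \<le> s powr real m"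
      proof (rule powr_mono)
        show "\<beta> \<le> real m" unfolding m_def by (rule real_nat_ceiling_ge)
      qed (rule s)
      also have "\<dots> = s ^ m" using s by (simp add: powr_realpow)
      finally show ?thesis using one_le_power[OF s, of m] by simp
    qed
    have G: "Gk k x t = c * nrm x ^ k * (poly p (cmp x + nrm x * t) * exp (- (norm z)\<^sup>2 / 2))"
    proof -
      have "exp (- ((norm x)\<^sup>2 - (cmp x)\<^sup>2) / 2) * exp (- (cmp x + nrm x * t)\<^sup>2 / 2) = exp (- (norm z)\<^sup>2 / 2)"
        unfolding z_def norm_tube[OF x] by (simp add: exp_add[symmetric] diff_divide_distrib add_divide_distrib)
      then show ?thesis unfolding Gk_def p c_def by (simp add: algebra_simps)
    qed
    have "\<bar>Gk k x t\<bar> \<le> c * R ^ k * (B * s ^ d * exp (- (s - b)\<^sup>2 / 2))"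
    proof -
      have "\<bar>poly p (cmp x + nrm x * t)\<bar> \<le> B * s ^ d"
      proof -
        have "(1 + \<bar>cmp x + nrm x * t\<bar>) ^ d \<le> s ^ d" by (rule power_mono[OF ys]) auto
        then have "B * (1 + \<bar>cmp x + nrm x * t\<bar>) ^ d \<le> B * s ^ d" using B(1) by (rule mult_left_mono)
        then show ?thesis using B(2)[of "cmp x + nrm x * t"] by linarith
      qed
      moreover have "nrm x ^ k \<le> R ^ k" using n0 by (intro power_mono) auto
      ultimately show ?thesis
        unfolding G s_def using n0 c0 by (auto simp: abs_mult intro!: mult_mono)
    qed
    then have "\<bar>Gk k x t\<bar> * (1 + norm x powr \<beta>) \<le> c * R ^ k * (B * s ^ d * exp (- (s - b)\<^sup>2 / 2)) * (2 * s ^ m)"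
      using xs B(1) R(1) c0 s by (intro mult_mono) auto
    also have "\<dots> = c * R ^ k * B * (2 * (s ^ (d + m) * exp (- (s - b)\<^sup>2 / 2)))" by (simp add: power_add algebra_simps)
    also have "\<dots> \<le> C"
      unfolding C_def using power_gauss_bounded[of s "d + m" b] s c0 R(1) B(1) by (intro mult_left_mono) auto
    finally have "\<bar>Gk k x t\<bar> * (1 + norm x powr \<beta>) \<le> C" .
    moreover have "0 < 1 + norm x powr \<beta>" by (simp add: add_pos_nonneg)
    ultimately show "\<bar>Gk k x t\<bar> \<le> C * (1 / (1 + norm x powr \<beta>))" by (simp add: pos_le_divide_eq)
  qed
qed

lemma tube_density_expansion:
  assumes \<beta>: "0 < \<beta>"
  obtains C where "0 \<le> C" "\<And>x t. x \<in> reg \<Longrightarrow> \<bar>t\<bar> \<le> 1 \<Longrightarrow>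
    \<bar>gauss_dens (tube (x, t)) - (\<Sum>k<P. Gk k x 0 / fact k * t ^ k)\<bar> \<le> C * (1 / (1 + norm x powr \<beta>)) * \<bar>t\<bar> ^ P"
proof -
  obtain C where C: "0 \<le> C" "\<And>x t. x \<in> reg \<Longrightarrow> \<bar>t\<bar> \<le> 1 \<Longrightarrow> \<bar>Gk P x t\<bar> \<le> C * (1 / (1 + norm x powr \<beta>))"
    using Gk_bounded[OF \<beta>] by blast
  show thesis
  proof (rule that[OF C(1)])
    fix x and t :: real assume x: "x \<in> reg" and t: "\<bar>t\<bar> \<le> 1"
    obtain s where s: "\<bar>s\<bar> \<le> \<bar>t\<bar>" "Gk 0 x t = (\<Sum>k<P. Gk k x 0 / fact k * t ^ k) + Gk P x s / fact P * t ^ P"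
      using Gk_taylor by blast
    have "\<bar>gauss_dens (tube (x, t)) - (\<Sum>k<P. Gk k x 0 / fact k * t ^ k)\<bar> = \<bar>Gk P x s\<bar> / fact P * \<bar>t\<bar> ^ P"
      using s(2) unfolding Gk_0[OF x] by (simp add: tube_def abs_mult power_abs)
    also have "\<dots> \<le> (C * (1 / (1 + norm x powr \<beta>))) * \<bar>t\<bar> ^ P"
    proof (intro mult_right_mono)
      have "\<bar>Gk P x s\<bar> / fact P \<le> \<bar>Gk P x s\<bar> / 1" by (intro divide_left_mono) auto
      also have "\<dots> \<le> C * (1 / (1 + norm x powr \<beta>))" using C(2)[OF x, of s] s(1) t by simp
      finally show "\<bar>Gk P x s\<bar> / fact P \<le> C * (1 / (1 + norm x powr \<beta>))" .
    qed auto
    finally show "\<bar>gauss_dens (tube (x, t)) - (\<Sum>k<P. Gk k x 0 / fact k * t ^ k)\<bar> \<le> C * (1 / (1 + norm x powr \<beta>)) * \<bar>t\<bar> ^ P" .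
  qed
qed

end

text \<open>The density factorises over the coordinates into one-dimensional normal integrals.
  Finiteness makes \<open>measure\<close> additive on the disjoint union of body and shell.\<close>

lemma finite_gauss_measure: "finite_measure (gauss_measure :: (real^'n) measure)"
proof (rule finite_measureI)
  let ?c = "(2 * pi) powr (- real CARD('n) / 2)"
  have one: "(\<integral>\<^sup>+y. ennreal (exp (- y\<^sup>2 / 2)) \<partial>(lborel :: real measure)) < \<infinity>"
  proof -
    have "integrable lborel (\<lambda>y. sqrt (2 * pi) * std_normal_density y)"
      by (intro integrable_mult_right integrable_normal_density) auto
    moreover have "sqrt (2 * pi) * std_normal_density y = exp (- y\<^sup>2 / 2)" for y
      by (simp add: std_normal_density_def)
    ultimately have "integrable lborel (\<lambda>y::real. exp (- y\<^sup>2 / 2))" by simp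
    then show ?thesis by (simp add: integrable_iff_bounded)
  qed
  have prod: "ennreal (exp (- (norm x)\<^sup>2 / 2)) = (\<Prod>b\<in>Basis. ennreal (exp (- (x \<bullet> b)\<^sup>2 / 2)))" for x :: "real^'n"
  proof -
    have "- (norm x)\<^sup>2 / 2 = (\<Sum>b\<in>Basis. - (x \<bullet> b)\<^sup>2 / 2)"
      unfolding power2_norm_eq_inner euclidean_inner[of x x]
      by (simp add: sum_negf sum_divide_distrib power2_eq_square)
    then show ?thesis by (simp add: exp_sum prod_ennreal)
  qed
  have "(\<integral>\<^sup>+x. ennreal (exp (- (norm x)\<^sup>2 / 2)) \<partial>(lborel :: (real^'n) measure))
     = (\<Prod>b\<in>(Basis :: (real^'n) set). \<integral>\<^sup>+y. ennreal (exp (- y\<^sup>2 / 2)) \<partial>lborel)"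
    unfolding prod by (rule nn_integral_lborel_prod) auto
  also have "\<dots> < \<infinity>" using one unfolding prod_constant infinity_ennreal_def by (simp only: power_less_top_ennreal) simp
  finally have "(\<integral>\<^sup>+x. ennreal (exp (- (norm x)\<^sup>2 / 2)) \<partial>(lborel :: (real^'n) measure)) < \<infinity>" .
  moreover have "emeasure (gauss_measure :: (real^'n) measure) (space gauss_measure)
     = (\<integral>\<^sup>+x. ennreal (gauss_dens x) \<partial>(lborel :: (real^'n) measure))"
    unfolding gauss_measure_def by (subst emeasure_density) (auto simp: gauss_dens_def)
  moreover have "(\<integral>\<^sup>+x. ennreal (gauss_dens x) \<partial>(lborel :: (real^'n) measure))
     = ennreal ?c * (\<integral>\<^sup>+x. ennreal (exp (- (norm x)\<^sup>2 / 2)) \<partial>(lborel :: (real^'n) measure))"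
    unfolding gauss_dens_def by (subst nn_integral_cmult[symmetric]) (auto simp: ennreal_mult')
  ultimately show "emeasure (gauss_measure :: (real^'n) measure) (space gauss_measure) \<noteq> \<infinity>"
    by (simp add: ennreal_mult_eq_top_iff less_top)
qed

lemma gauss_dens_measurable [measurable]: "gauss_dens \<in> borel_measurable borel"
  unfolding gauss_dens_def[abs_def] by measurable

lemma gauss_dens_nonneg: "0 \<le> gauss_dens x" by (simp add: gauss_dens_def)

text \<open>Regrouping by total degree, \<open>l - 1 = m + k\<close>.\<close>

lemma sum_binomial_grading:
  fixes G :: "nat \<Rightarrow> nat \<Rightarrow> real"
  shows "(\<Sum>l = 1..L. \<Sum>m = 0..l - 1. G m (l - 1 - m)) = (\<Sum>(m, k) | m + k < L. G m k)"
proof -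
  have "(\<Sum>l = 1..L. \<Sum>m = 0..l - 1. G m (l - 1 - m)) = (\<Sum>(l, m)\<in>(SIGMA l:{1..L}. {0..l - 1}). G m (l - 1 - m))"
    by (rule sum.Sigma) auto
  also have "\<dots> = (\<Sum>(m, k) | m + k < L. G m k)"
    by (rule sum.reindex_bij_witness[where i="\<lambda>(m, k). (m + k + 1, m)" and j="\<lambda>(l, m). (m, l - 1 - m)"]) auto
  finally show ?thesis .
qed

section \<open>The expansion at a single boundary point\<close>

context smooth_convex_body
begin

lemma integral_monomial: "0 \<le> \<epsilon> \<Longrightarrow> ((\<lambda>t::real. t ^ m) has_integral \<epsilon> ^ Suc m / real (Suc m)) {0..\<epsilon>}"
proof -
  assume \<epsilon>: "0 \<le> \<epsilon>"
  have "((\<lambda>t::real. t ^ m) has_integral (\<epsilon> ^ Suc m / real (Suc m) - 0 ^ Suc m / real (Suc m))) {0..\<epsilon>}"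
  proof (rule fundamental_theorem_of_calculus[OF \<epsilon>])
    fix t :: real
    have "((\<lambda>t. t ^ Suc m / real (Suc m)) has_real_derivative real (Suc m) * t ^ (Suc m - Suc 0) / real (Suc m)) (at t within {0..\<epsilon>})"
      by (rule DERIV_cdivide[OF DERIV_pow])
    then have "((\<lambda>t. t ^ Suc m / real (Suc m)) has_real_derivative t ^ m) (at t within {0..\<epsilon>})"
      by (rule DERIV_cong) simp
    then show "((\<lambda>t. t ^ Suc m / real (Suc m)) has_vector_derivative t ^ m) (at t within {0..\<epsilon>})"
      by (rule has_real_derivative_iff_has_vector_derivative[THEN iffD1])
  qed
  then show ?thesis by simp
qed

text \<open>The indicator extends the curvature density by 0 to the whole space, where its Borel
  measurability can be stated.\<close>

definition "md j z = indicator bdry z * Mstar_dens \<Theta> F j z"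
definition "wt \<beta> z = 1 / (1 + norm z powr \<beta>)" for z :: "real^'n"
text \<open>Integrand of the coefficient for the minors of size \<open>j\<close> and the Taylor
  order \<open>k\<close>; the shift \<open>Suc j\<close> is the one between \<open>detr\<close> and
  \<open>Mstar_dens\<close>.\<close>

definition "ac j k x = h x * Gk k x 0 * md (Suc j) x"

lemma wt_pos: "0 < wt \<beta> z" by (simp add: wt_def add_pos_nonneg)

lemma wt_measurable [measurable]: "wt \<beta> \<in> borel_measurable borel"
  unfolding wt_def[abs_def] by measurable

lemma nrm_measurable [measurable]: "nrm \<in> borel_measurable borel"
  unfolding nrm_def[abs_def] by measurable

lemma cmp_measurable [measurable]: "cmp \<in> borel_measurable borel"
  unfolding cmp_def[abs_def] by measurable

lemma Gk_measurable [measurable]: "(\<lambda>x. Gk k x t) \<in> borel_measurable borel"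
proof -
  have [measurable]: "(deriv ^^ k) (\<lambda>t::real. exp (- t\<^sup>2 / 2)) \<in> borel_measurable borel"
    by (rule borel_measurable_continuous_onI, rule DERIV_continuous_on, rule has_field_derivative_at_within,
        rule higher_deriv_gauss_has_derivative)
  show ?thesis unfolding Gk_def by measurable
qed

lemma bm_eq: "bm = density (hausdorff_measure (CARD('n) - 1)) (\<lambda>x. ennreal (indicator bdry x))"
  unfolding bm_def by (rule arg_cong[where f="density _"]) (auto split: split_indicator)

lemma jac_Mstar: "jac x t = h x * (\<Sum>j<CARD('n). t ^ j / fact j * Mstar_dens \<Theta> F (Suc j) x)"
  unfolding jac_def Mstar_dens_def by (auto intro!: sum.cong)

text \<open>The Taylor polynomial of the density times the polynomial \<open>jac\<close> is
  integrated termwise, \<open>t ^ (j + k)\<close> giving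
  \<open>\<epsilon> ^ (j + k + 1) / (j + k + 1)\<close>. The error of order
  \<open>\<epsilon> ^ P\<close> in the integrand gains one more power from the length of the
  interval.\<close>

lemma inner_expansion:
  assumes \<beta>: "0 < \<beta>"
  obtains K where "0 \<le> K" "\<And>x \<epsilon>. x \<in> bdry \<Longrightarrow> 0 < \<epsilon> \<Longrightarrow> \<epsilon> \<le> 1 \<Longrightarrow>
    \<exists>I\<ge>0. (\<integral>\<^sup>+t. ennreal (gauss_dens (tube (x, t))) * (jacf (x, t) * indicator (bdry \<times> {0<..\<epsilon>}) (x, t)) \<partial>lborel) = ennreal I \<and>
      \<bar>I - (\<Sum>j<CARD('n). \<Sum>k<P. \<epsilon> ^ Suc (j + k) / (real (Suc (j + k)) * fact j * fact k) * ac j k x)\<bar>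
        \<le> \<epsilon> ^ Suc P * (K * (\<Sum>j<CARD('n). wt \<beta> x * \<bar>md (Suc j) x\<bar>))"
proof -
  obtain C where C: "0 \<le> C" "\<And>x t. x \<in> reg \<Longrightarrow> \<bar>t\<bar> \<le> 1 \<Longrightarrow>
    \<bar>gauss_dens (tube (x, t)) - (\<Sum>k<P. Gk k x 0 / fact k * t ^ k)\<bar> \<le> C * (1 / (1 + norm x powr \<beta>)) * \<bar>t\<bar> ^ P"
    using tube_density_expansion[OF \<beta>] by blast
  obtain H where H: "0 \<le> H" "\<And>x. x \<in> reg \<Longrightarrow> h x \<le> H" using h_bounded by blast
  show thesis
  proof (rule that[of "C * H"])
    show "0 \<le> C * H" using C H by simp
    fix x and \<epsilon> :: real assume x: "x \<in> bdry" and \<epsilon>: "0 < \<epsilon>" "\<epsilon> \<le> 1"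
    have reg: "x \<in> reg" using x bdry_reg by auto
    have md: "md j x = Mstar_dens \<Theta> F j x" for j using x by (simp add: md_def)
    define GJ where "GJ t = gauss_dens (tube (x, t)) * jac x t" for t
    have cont: "continuous_on S GJ" for S
      unfolding GJ_def jac_def gauss_dens_def tube_def fst_conv snd_conv by (intro continuous_intros) auto
    have pos: "0 \<le> GJ t" if "0 \<le> t" for t
      unfolding GJ_def using jac_pos[OF x that] gauss_dens_nonneg by (intro mult_nonneg_nonneg) auto
    define I where "I = integral {0..\<epsilon>} GJ"
    have int: "(GJ has_integral I) {0..\<epsilon>}"
      unfolding I_def using cont by (intro integrable_integral integrable_continuous_real)
    have "0 \<le> I" using int pos by (intro has_integral_nonneg[OF int]) auto
    have nn: "(\<integral>\<^sup>+t. ennreal (gauss_dens (tube (x, t))) * (jacf (x, t) * indicator (bdry \<times> {0<..\<epsilon>}) (x, t)) \<partial>lborel) = ennreal I"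
    proof -
      \<comment> \<open>The half-open interval of the shell and the closed interval of the gauge
        integral differ by the null set \<open>{0}\<close>.\<close>
      define G where "G t = (if t \<in> {0<..\<epsilon>} then GJ t else 0)" for t
      have "((\<lambda>t. if t \<in> {0..\<epsilon>} then GJ t else 0) has_integral I) UNIV"
        using int by (simp only: has_integral_restrict_UNIV)
      then have "(G has_integral I) UNIV"
        by (rule has_integral_spike[of "{0}", rotated 2]) (auto simp: G_def)
      moreover have "G \<in> borel_measurable borel"
        unfolding G_def using borel_measurable_continuous_onI[OF cont[of UNIV]] by (intro measurable_If_set) auto
      moreover have "0 \<le> G t" for t using pos by (simp add: G_def)
      ultimately have "(\<integral>\<^sup>+t. ennreal (G t) \<partial>lborel) = ennreal I" by (intro nn_integral_has_integral_lborel)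
      moreover have "ennreal (gauss_dens (tube (x, t))) * (jacf (x, t) * indicator (bdry \<times> {0<..\<epsilon>}) (x, t)) = ennreal (G t)" for t
        using x ennreal_mult'[OF gauss_dens_nonneg, of "tube (x, t)" "jac x t"]
        by (auto simp: G_def GJ_def jacf_eq[OF reg] split: split_indicator)
      ultimately show ?thesis by simp
    qed
    define po where "po t = (\<Sum>j<CARD('n). \<Sum>k<P. ac j k x / (fact j * fact k) * t ^ (j + k))" for t
    define ip where "ip = (\<Sum>j<CARD('n). \<Sum>k<P. ac j k x / (fact j * fact k) * (\<epsilon> ^ Suc (j + k) / real (Suc (j + k))))"
    have ipo: "(po has_integral ip) {0..\<epsilon>}"
      unfolding po_def[abs_def] ip_def using \<epsilon>
      by (intro has_integral_sum has_integral_mult_right integral_monomial) auto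
    have ip_eq: "ip = (\<Sum>j<CARD('n). \<Sum>k<P. \<epsilon> ^ Suc (j + k) / (real (Suc (j + k)) * fact j * fact k) * ac j k x)"
      unfolding ip_def by (intro sum.cong refl) (simp add: field_simps)
    define M where "M = (\<Sum>j<CARD('n). \<bar>md (Suc j) x\<bar>)"
    define W where "W = C * H * (wt \<beta> x * M)"
    have M0: "0 \<le> M" by (auto simp: M_def intro: sum_nonneg)
    have bound: "\<bar>GJ t - po t\<bar> \<le> W * \<epsilon> ^ P" if t: "t \<in> {0..\<epsilon>}" for t
    proof -
      have "po t = (\<Sum>k<P. Gk k x 0 / fact k * t ^ k) * jac x t"
      proof -
        have "po t = (\<Sum>j<CARD('n). \<Sum>k<P. (h x * (t ^ j / fact j * Mstar_dens \<Theta> F (Suc j) x)) * (Gk k x 0 / fact k * t ^ k))"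
          unfolding po_def ac_def md by (intro sum.cong refl) (simp add: power_add)
        also have "\<dots> = jac x t * (\<Sum>k<P. Gk k x 0 / fact k * t ^ k)"
          unfolding jac_Mstar by (simp only: sum_distrib_left[of "h x"] sum_product)
        finally show ?thesis by (simp only: mult.commute)
      qed
      then have "\<bar>GJ t - po t\<bar> = \<bar>gauss_dens (tube (x, t)) - (\<Sum>k<P. Gk k x 0 / fact k * t ^ k)\<bar> * \<bar>jac x t\<bar>"
        unfolding GJ_def by (simp add: abs_mult[symmetric] left_diff_distrib)
      also have "\<dots> \<le> (C * wt \<beta> x * \<epsilon> ^ P) * (H * M)"
      proof (rule mult_mono)
        have "\<bar>gauss_dens (tube (x, t)) - (\<Sum>k<P. Gk k x 0 / fact k * t ^ k)\<bar> \<le> C * wt \<beta> x * \<bar>t\<bar> ^ P"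
          using C(2)[OF reg, of t] t \<epsilon> by (simp add: wt_def)
        also have "\<dots> \<le> C * wt \<beta> x * \<epsilon> ^ P"
          using t C(1) wt_pos[of \<beta> x] by (intro mult_left_mono power_mono mult_nonneg_nonneg) auto
        finally show "\<bar>gauss_dens (tube (x, t)) - (\<Sum>k<P. Gk k x 0 / fact k * t ^ k)\<bar> \<le> C * wt \<beta> x * \<epsilon> ^ P" .
        have "\<bar>\<Sum>j<CARD('n). t ^ j / fact j * Mstar_dens \<Theta> F (Suc j) x\<bar> \<le> M"
          unfolding M_def
        proof (rule order_trans[OF sum_abs sum_mono])
          fix j
          have "t ^ j / fact j \<le> 1 / 1" using t \<epsilon> by (intro frac_le power_le_one) auto
          then have "\<bar>t ^ j / fact j\<bar> * \<bar>Mstar_dens \<Theta> F (Suc j) x\<bar> \<le> 1 * \<bar>Mstar_dens \<Theta> F (Suc j) x\<bar>"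
            using t by (intro mult_right_mono) auto
          then show "\<bar>t ^ j / fact j * Mstar_dens \<Theta> F (Suc j) x\<bar> \<le> \<bar>md (Suc j) x\<bar>" by (simp add: md abs_mult)
        qed
        then show "\<bar>jac x t\<bar> \<le> H * M"
          unfolding jac_Mstar abs_mult using H(2)[OF reg] h_pos[OF reg] H(1) by (intro mult_mono) auto
      qed (use C H M0 \<epsilon> wt_pos[of \<beta> x] in \<open>auto intro!: mult_nonneg_nonneg\<close>)
      also have "\<dots> = W * \<epsilon> ^ P" by (simp add: W_def)
      finally show ?thesis .
    qed
    have "norm (integral {0..\<epsilon>} (\<lambda>t. GJ t - po t)) \<le> (W * \<epsilon> ^ P) * (\<epsilon> - 0)"
    proof (rule integral_bound)
      show "continuous_on {0..\<epsilon>} (\<lambda>t. GJ t - po t)"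
        unfolding po_def by (intro continuous_intros cont)
    qed (use \<epsilon> bound in auto)
    moreover have "integral {0..\<epsilon>} (\<lambda>t. GJ t - po t) = I - ip"
      by (rule integral_unique[OF has_integral_diff[OF int ipo]])
    ultimately have "\<bar>I - ip\<bar> \<le> \<epsilon> ^ Suc P * W" by (simp add: mult.commute mult.left_commute)
    also have "W = C * H * (\<Sum>j<CARD('n). wt \<beta> x * \<bar>md (Suc j) x\<bar>)" by (simp add: W_def M_def sum_distrib_left)
    finally show "\<exists>I\<ge>0. (\<integral>\<^sup>+t. ennreal (gauss_dens (tube (x, t))) * (jacf (x, t) * indicator (bdry \<times> {0<..\<epsilon>}) (x, t)) \<partial>lborel) = ennreal I \<and>
      \<bar>I - (\<Sum>j<CARD('n). \<Sum>k<P. \<epsilon> ^ Suc (j + k) / (real (Suc (j + k)) * fact j * fact k) * ac j k x)\<bar>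
        \<le> \<epsilon> ^ Suc P * (C * H * (\<Sum>j<CARD('n). wt \<beta> x * \<bar>md (Suc j) x\<bar>))"
      using nn \<open>0 \<le> I\<close> unfolding ip_eq by blast
  qed
qed

end

section \<open>Coefficients and remainder under the integrability hypothesis\<close>

context smooth_convex_body
begin

context
  fixes \<beta> :: real
  assumes \<beta>: "0 < \<beta>"
    and bnd: "\<And>j. j \<in> {1..CARD('n)} \<Longrightarrow> set_integrable (hausdorff_measure (CARD('n) - 1)) bdry
         (\<lambda>z. 1 / (1 + norm z powr \<beta>) * Mstar_dens \<Theta> F j z)"
begin

text \<open>The weight is positive and Borel, so dividing the integrable function by it recovers
  measurability of the curvature density, about which the choice of frames says nothing.\<close>

lemma md_measurable:
  assumes j: "j \<in> {1..CARD('n)}"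
  shows "md j \<in> borel_measurable borel"
proof -
  have "(\<lambda>z. indicator bdry z *\<^sub>R (wt \<beta> z * Mstar_dens \<Theta> F j z)) \<in> borel_measurable (hausdorff_measure (CARD('n) - 1))"
    using bnd[OF j] unfolding set_integrable_def wt_def by (rule borel_measurable_integrable)
  then have "(\<lambda>z. indicator bdry z *\<^sub>R (wt \<beta> z * Mstar_dens \<Theta> F j z)) \<in> borel_measurable borel"
    by (simp add: measurable_cong_sets[OF sets_hausdorff_measure refl])
  then have "(\<lambda>z. (indicator bdry z *\<^sub>R (wt \<beta> z * Mstar_dens \<Theta> F j z)) / wt \<beta> z) \<in> borel_measurable borel"
    by (intro borel_measurable_divide wt_measurable)
  moreover have "(indicator bdry z *\<^sub>R (wt \<beta> z * Mstar_dens \<Theta> F j z)) / wt \<beta> z = md j z" for z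
    using wt_pos[of \<beta> z] by (simp add: md_def)
  ultimately show ?thesis by simp
qed

lemma md_integrable:
  assumes j: "j \<in> {1..CARD('n)}"
  shows "integrable bm (\<lambda>z. wt \<beta> z * md j z)"
proof -
  have "integrable (hausdorff_measure (CARD('n) - 1)) (\<lambda>z. indicator bdry z *\<^sub>R (wt \<beta> z * Mstar_dens \<Theta> F j z))"
    using bnd[OF j] by (simp add: set_integrable_def wt_def)
  moreover have "indicator bdry z *\<^sub>R (wt \<beta> z * Mstar_dens \<Theta> F j z) = indicator bdry z *\<^sub>R (wt \<beta> z * md j z)" for z
    by (simp add: md_def split: split_indicator)
  ultimately have "integrable (hausdorff_measure (CARD('n) - 1)) (\<lambda>z. indicator bdry z *\<^sub>R (wt \<beta> z * md j z))" by (simp only:)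
  then show ?thesis
    unfolding bm_eq using md_measurable[OF j]
    by (subst integrable_density) (auto simp: measurable_cong_sets[OF sets_hausdorff_measure refl])
qed

lemma Mstar_int_eq:
  assumes j: "j \<in> {1..CARD('n)}" and \<phi>: "\<phi> \<in> borel_measurable borel"
  shows "Mstar_int \<Theta> F u j \<phi> = (\<integral>z. \<phi> z * md j z \<partial>bm)"
proof -
  have "(\<integral>z. \<phi> z * md j z \<partial>bm) = (\<integral>z. indicator bdry z *\<^sub>R (\<phi> z * md j z) \<partial>hausdorff_measure (CARD('n) - 1))"
    unfolding bm_eq using md_measurable[OF j] \<phi>
    by (subst integral_density) (auto simp: measurable_cong_sets[OF sets_hausdorff_measure refl])
  also have "\<dots> = Mstar_int \<Theta> F u j \<phi>"
    unfolding Mstar_int_def set_lebesgue_integral_def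
    by (intro Bochner_Integration.integral_cong) (auto simp: md_def split: split_indicator)
  finally show ?thesis by simp
qed

text \<open>Since \<open>detr 0\<close> is 1, the hypothesis for \<open>j = 1\<close> says that the
  weight itself is integrable over the boundary. On each ball the weight is bounded below, so the
  boundary has finite measure there.\<close>

lemma sigma_finite_bm: "sigma_finite_measure bm"
proof
  define A where "A k = cball (0::real^'n) (real k)" for k
  have M1: "Mstar_dens \<Theta> F 1 z = 1" for z by (simp add: Mstar_dens_def)
  have one: "1 \<in> {1..CARD('n)}" by (simp add: Suc_leI)
  have fin: "(\<integral>\<^sup>+z. ennreal (norm (indicator bdry z *\<^sub>R wt \<beta> z)) \<partial>hausdorff_measure (CARD('n) - 1)) < \<infinity>"
    using bnd[OF one] unfolding set_integrable_def wt_def[symmetric] M1 mult_1_right integrable_iff_bounded by blast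
  have "emeasure bm (A k) \<noteq> \<infinity>" for k
  proof -
    have A: "A k \<in> sets borel" by (simp add: A_def)
    have w: "(\<lambda>z. ennreal (norm (indicator bdry z *\<^sub>R wt \<beta> z))) \<in> borel_measurable borel" by measurable
    have "emeasure bm (A k) = (\<integral>\<^sup>+z. indicator bdry z * indicator (A k) z \<partial>hausdorff_measure (CARD('n) - 1))"
      unfolding bm_def using A by (intro emeasure_density) auto
    also have "\<dots> \<le> (\<integral>\<^sup>+z. ennreal (1 + real k powr \<beta>) * ennreal (norm (indicator bdry z *\<^sub>R wt \<beta> z)) \<partial>hausdorff_measure (CARD('n) - 1))"
    proof (rule nn_integral_mono)
      fix z :: "real^'n"
      show "indicator bdry z * indicator (A k) z \<le> ennreal (1 + real k powr \<beta>) * ennreal (norm (indicator bdry z *\<^sub>R wt \<beta> z))"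
      proof (cases "z \<in> bdry \<and> z \<in> A k")
        case True
        have "norm z powr \<beta> \<le> real k powr \<beta>" using True \<beta> by (intro powr_mono2) (auto simp: A_def)
        then have "1 \<le> (1 + real k powr \<beta>) * wt \<beta> z"
          by (simp add: wt_def add_pos_nonneg)
        then show ?thesis
          using True wt_pos[of \<beta> z] ennreal_leI[of 1 "(1 + real k powr \<beta>) * wt \<beta> z"]
            ennreal_mult'[of "1 + real k powr \<beta>" "wt \<beta> z"] by simp
      qed (auto split: split_indicator)
    qed
    also have "\<dots> = ennreal (1 + real k powr \<beta>) * (\<integral>\<^sup>+z. ennreal (norm (indicator bdry z *\<^sub>R wt \<beta> z)) \<partial>hausdorff_measure (CARD('n) - 1))"
      using w by (intro nn_integral_cmult) (simp add: measurable_cong_sets[OF sets_hausdorff_measure refl])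
    also have "\<dots> < \<infinity>" using fin by (simp add: ennreal_mult_less_top)
    finally show ?thesis by simp
  qed
  moreover have "(\<Union>k. A k) = UNIV" unfolding A_def by (auto intro: real_arch_simple)
  ultimately show "\<exists>A. countable A \<and> A \<subseteq> sets bm \<and> \<Union>A = space bm \<and> (\<forall>a\<in>A. emeasure bm a \<noteq> \<infinity>)"
    by (intro exI[of _ "range A"]) (auto simp: A_def)
qed

lemma ac_measurable:
  assumes "j < CARD('n)" shows "ac j k \<in> borel_measurable borel"
proof -
  have [measurable]: "md (Suc j) \<in> borel_measurable borel" using assms by (intro md_measurable) auto
  show ?thesis unfolding ac_def[abs_def] by measurable
qed

text \<open>Boundedness of \<open>h\<close> and the decay of \<open>Gk\<close> dominate the
  integrand by the weighted density of the hypothesis.\<close>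

lemma ac_integrable:
  assumes j: "j < CARD('n)" shows "integrable bm (ac j k)"
proof -
  obtain C where C: "0 \<le> C" "\<And>x t. x \<in> reg \<Longrightarrow> \<bar>t\<bar> \<le> 1 \<Longrightarrow> \<bar>Gk k x t\<bar> \<le> C * (1 / (1 + norm x powr \<beta>))"
    using Gk_bounded[OF \<beta>] by blast
  obtain H where H: "0 \<le> H" "\<And>x. x \<in> reg \<Longrightarrow> h x \<le> H" using h_bounded by blast
  have "integrable bm (\<lambda>z. (H * C) * (wt \<beta> z * md (Suc j) z))"
    using j by (intro integrable_mult_right md_integrable) auto
  then show ?thesis
  proof (rule Bochner_Integration.integrable_bound)
    show "ac j k \<in> borel_measurable bm"
      using ac_measurable[OF j] by (simp add: measurable_cong_sets[OF sets_bm refl])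
    have "norm (ac j k z) \<le> norm ((H * C) * (wt \<beta> z * md (Suc j) z))" for z
    proof (cases "z \<in> bdry")
      case True
      then have reg: "z \<in> reg" using bdry_reg by auto
      have "\<bar>h z\<bar> * \<bar>Gk k z 0\<bar> * \<bar>md (Suc j) z\<bar> \<le> H * (C * wt \<beta> z) * \<bar>md (Suc j) z\<bar>"
        using H h_pos[OF reg] C(2)[OF reg, of 0] H(2)[OF reg]
        by (intro mult_right_mono mult_mono) (auto simp: wt_def)
      then show ?thesis
        using H(1) C(1) wt_pos[of \<beta> z] by (simp add: ac_def abs_mult algebra_simps)
    qed (simp add: ac_def md_def)
    then show "AE z in bm. norm (ac j k z) \<le> norm ((H * C) * (wt \<beta> z * md (Suc j) z))" by simp
  qed
qed

text \<open>The value 0 from \<open>CARD('n)\<close> on is the convention for measures beyond the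
  dimension; it lets the formula for \<open>Ml\<close> range over all \<open>m\<close>.\<close>

definition "co j k = (if j < CARD('n) then \<integral>z. ac j k z \<partial>bm else 0)"

text \<open>\<open>Gk_at_0\<close> supplies the sign and the Hermite polynomial; on the boundary
  \<eta> has length 1 and \<open>nrm\<close> is the quotient of lengths.\<close>

lemma Mstar_int_co:
  "(-1) ^ k * Mstar_int \<Theta> F u (m + 1) (\<lambda>x.
        theta_norm \<Theta> (\<eta> x) / norm (\<eta> x) * (norm (\<Theta> *v \<eta> x) / theta_norm \<Theta> (\<eta> x)) ^ k *
        hermite k (x \<bullet> ((1 / norm (\<Theta> *v \<eta> x)) *\<^sub>R (\<Theta> *v \<eta> x))) * gauss_dens x) = co m k"
proof (cases "m < CARD('n)")
  case False
  then show ?thesis by (simp add: co_def Mstar_int_def Mstar_dens_def set_lebesgue_integral_def)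
next
  case True
  define \<phi> where "\<phi> x = h x / norm (\<eta> x) * (norm (\<Theta> *v \<eta> x) / h x) ^ k * hermite k (cmp x) * gauss_dens x" for x
  have "hermite k y = (-1) ^ k * exp (y\<^sup>2 / 2) * (deriv ^^ k) (\<lambda>t::real. exp (- t\<^sup>2 / 2)) y" for y
    by (simp add: hermite_def)
  moreover have "(deriv ^^ k) (\<lambda>t::real. exp (- t\<^sup>2 / 2)) \<in> borel_measurable borel"
    by (rule borel_measurable_continuous_onI, rule DERIV_continuous_on, rule has_field_derivative_at_within,
        rule higher_deriv_gauss_has_derivative)
  ultimately have [measurable]: "hermite k \<in> borel_measurable borel" by (simp add: hermite_def[abs_def])
  have \<phi>: "\<phi> \<in> borel_measurable borel" unfolding \<phi>_def[abs_def] by measurable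
  have "Mstar_int \<Theta> F u (m + 1) \<phi> = (\<integral>z. \<phi> z * md (m + 1) z \<partial>bm)"
    using True by (intro Mstar_int_eq \<phi>) auto
  then have "(-1) ^ k * Mstar_int \<Theta> F u (m + 1) \<phi> = (\<integral>z. (-1) ^ k * (\<phi> z * md (m + 1) z) \<partial>bm)" by simp
  also have "\<dots> = (\<integral>z. ac m k z \<partial>bm)"
  proof (intro Bochner_Integration.integral_cong refl)
    fix z
    show "(-1) ^ k * (\<phi> z * md (m + 1) z) = ac m k z"
    proof (cases "z \<in> bdry")
      case True
      then have reg: "z \<in> reg" using bdry_reg by auto
      show ?thesis
        by (simp add: \<phi>_def ac_def Gk_at_0 nrm_eq[OF reg] norm_\<eta>[OF reg])
    qed (simp add: ac_def md_def)
  qed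
  finally show ?thesis using True by (simp add: co_def \<phi>_def[abs_def] h_def cmp_def)
qed

lemma Ml_co: "Ml \<Theta> F u l = (\<Sum>m = 0..l-1. real (l - 1 choose m) * co m (l - 1 - m))"
  unfolding Ml_def Mstar_int_co[symmetric] by (intro sum.cong refl) (simp only: mult.assoc)

text \<open>With \<open>l - 1 = m + k\<close> the binomial coefficient divided by
  \<open>fact l\<close> becomes \<open>1 / ((m + k + 1) * fact m * fact k)\<close>, the coefficient
  produced by termwise integration.\<close>

lemma Ml_term: "1 \<le> l \<Longrightarrow> \<epsilon> ^ l / fact l * Ml \<Theta> F u l
    = (\<Sum>m = 0..l-1. \<epsilon> ^ Suc (m + (l - 1 - m)) / (real (Suc (m + (l - 1 - m))) * fact m * fact (l - 1 - m)) * co m (l - 1 - m))"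
proof -
  assume l: "1 \<le> l"
  then obtain r where r: "l = Suc r" by (cases l) auto
  show ?thesis
    unfolding Ml_co sum_distrib_left r
  proof (intro sum.cong refl)
    fix m assume "m \<in> {0..Suc r - 1}"
    then have m: "m \<le> r" by simp
    have "real (r choose m) = fact r / (fact m * fact (r - m))" by (rule binomial_fact[OF m])
    then show "\<epsilon> ^ Suc r / fact (Suc r) * (real (Suc r - 1 choose m) * co m (Suc r - 1 - m))
      = \<epsilon> ^ Suc (m + (Suc r - 1 - m)) / (real (Suc (m + (Suc r - 1 - m))) * fact m * fact (Suc r - 1 - m)) * co m (Suc r - 1 - m)"
      using m fact_Suc[of r, where 'a = real] by (simp add: mult.commute mult.left_commute)
  qed
qed

text \<open>The pointwise expansion is integrated over the boundary; the dominating function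
  \<open>D\<close> is integrable by hypothesis, and its integral is the constant.\<close>

lemma shell_measure_expansion:
  obtains C where "0 \<le> C" "\<And>\<epsilon>. 0 < \<epsilon> \<Longrightarrow> \<epsilon> \<le> 1 \<Longrightarrow>
    \<bar>measure gauss_measure (tube ` (bdry \<times> {0<..\<epsilon>}))
      - (\<Sum>j<CARD('n). \<Sum>k<P. \<epsilon> ^ Suc (j + k) / (real (Suc (j + k)) * fact j * fact k) * co j k)\<bar> \<le> \<epsilon> ^ Suc P * C"
proof -
  obtain K where K: "0 \<le> K" "\<And>x \<epsilon>. x \<in> bdry \<Longrightarrow> 0 < \<epsilon> \<Longrightarrow> \<epsilon> \<le> 1 \<Longrightarrow>
    \<exists>I\<ge>0. (\<integral>\<^sup>+t. ennreal (gauss_dens (tube (x, t))) * (jacf (x, t) * indicator (bdry \<times> {0<..\<epsilon>}) (x, t)) \<partial>lborel) = ennreal I \<and>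
      \<bar>I - (\<Sum>j<CARD('n). \<Sum>k<P. \<epsilon> ^ Suc (j + k) / (real (Suc (j + k)) * fact j * fact k) * ac j k x)\<bar>
        \<le> \<epsilon> ^ Suc P * (K * (\<Sum>j<CARD('n). wt \<beta> x * \<bar>md (Suc j) x\<bar>))"
    using inner_expansion[OF \<beta>, of P] by blast
  define D where "D x = K * (\<Sum>j<CARD('n). wt \<beta> x * \<bar>md (Suc j) x\<bar>)" for x
  have D0: "0 \<le> D x" for x
    unfolding D_def using K(1) wt_pos[of \<beta> x] by (intro mult_nonneg_nonneg sum_nonneg) auto
  have Dint: "integrable bm D"
    unfolding D_def
  proof (intro integrable_mult_right Bochner_Integration.integrable_sum)
    fix j assume "j \<in> {..<CARD('n)}"
    then have "integrable bm (\<lambda>z. \<bar>wt \<beta> z * md (Suc j) z\<bar>)" by (intro integrable_abs md_integrable) auto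
    moreover have "\<bar>wt \<beta> z * md (Suc j) z\<bar> = wt \<beta> z * \<bar>md (Suc j) z\<bar>" for z
      using wt_pos[of \<beta> z] by (simp add: abs_mult)
    ultimately show "integrable bm (\<lambda>z. wt \<beta> z * \<bar>md (Suc j) z\<bar>)" by simp
  qed
  show thesis
  proof (rule that)
    show "0 \<le> (\<integral>x. D x \<partial>bm)" using D0 by (intro integral_nonneg_AE) auto
    fix \<epsilon> :: real assume \<epsilon>: "0 < \<epsilon>" "\<epsilon> \<le> 1"
    define inner where "inner x = (\<integral>\<^sup>+t. ennreal (gauss_dens (tube (x, t))) * (jacf (x, t) * indicator (bdry \<times> {0<..\<epsilon>}) (x, t)) \<partial>lborel)" for x
    define f where "f x = enn2real (inner x)" for x
    define S where "S x = (\<Sum>j<CARD('n). \<Sum>k<P. \<epsilon> ^ Suc (j + k) / (real (Suc (j + k)) * fact j * fact k) * ac j k x)" for x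
    have pt: "inner x = ennreal (f x) \<and> \<bar>f x - S x\<bar> \<le> \<epsilon> ^ Suc P * D x" for x
    proof (cases "x \<in> bdry")
      case True
      from K(2)[OF this \<epsilon>] show ?thesis unfolding inner_def[symmetric] S_def[symmetric] D_def[symmetric] f_def by auto
    next
      case False
      have "inner x = 0" using False by (simp add: inner_def)
      moreover have "S x = 0" using False by (simp add: S_def ac_def md_def)
      ultimately show ?thesis using D0[of x] \<epsilon> by (simp add: f_def)
    qed
    have meas: "(\<lambda>p. ennreal (gauss_dens (tube p)) * (jacf p * indicator (bdry \<times> {0<..\<epsilon>}) p)) \<in> borel_measurable (bm \<Otimes>\<^sub>M lborel)"
    proof -
      have "bdry \<times> {0<..\<epsilon>} \<in> sets borel" by (intro borel_Times) auto
      then have "(\<lambda>p. ennreal (gauss_dens (tube p)) * (jacf p * indicator (bdry \<times> {0<..\<epsilon>}) p)) \<in> borel_measurable borel"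
        using tube_measurable jacf_measurable gauss_dens_measurable
        by (intro borel_measurable_times_ennreal measurable_compose[OF measurable_compose[OF tube_measurable gauss_dens_measurable] measurable_ennreal]) auto
      then show ?thesis unfolding Q_def[symmetric] by (simp add: measurable_cong_sets[OF sets_Q refl])
    qed
    have "inner \<in> borel_measurable bm"
      unfolding inner_def using lborel.borel_measurable_nn_integral_fst[OF meas] by simp
    then have fm: "f \<in> borel_measurable bm" unfolding f_def[abs_def] by measurable
    have Y: "bdry \<times> {0<..\<epsilon>} \<in> sets borel" "bdry \<times> {0<..\<epsilon>} \<subseteq> bdry \<times> {0<..}" by (auto intro!: borel_Times)
    have tY: "tube ` (bdry \<times> {0<..\<epsilon>}) \<in> sets borel" by (rule tube_measure(1)[OF sigma_finite_bm Y])
    have "emeasure gauss_measure (tube ` (bdry \<times> {0<..\<epsilon>}))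
       = (\<integral>\<^sup>+y. ennreal (gauss_dens y) * indicator (tube ` (bdry \<times> {0<..\<epsilon>})) y \<partial>lborel)"
      unfolding gauss_measure_def using tY by (intro emeasure_density) auto
    also have "\<dots> = (\<integral>\<^sup>+x. inner x \<partial>bm)"
      unfolding inner_def by (rule nn_integral_tube[OF sigma_finite_bm]) measurable
    also have "\<dots> = (\<integral>\<^sup>+x. ennreal (f x) \<partial>bm)" using pt by simp
    finally have "measure gauss_measure (tube ` (bdry \<times> {0<..\<epsilon>})) = (\<integral>x. f x \<partial>bm)"
      using fm by (subst integral_eq_nn_integral) (auto simp: measure_def f_def)
    moreover have Sint: "integrable bm S"
      unfolding S_def by (intro Bochner_Integration.integrable_sum integrable_mult_right ac_integrable) auto
    moreover have dint: "integrable bm (\<lambda>x. f x - S x)"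
    proof (rule Bochner_Integration.integrable_bound[of bm "\<lambda>x. \<epsilon> ^ Suc P * D x"])
      show "integrable bm (\<lambda>x. \<epsilon> ^ Suc P * D x)" using Dint by (intro integrable_mult_right)
      show "(\<lambda>x. f x - S x) \<in> borel_measurable bm" using fm Sint by (intro borel_measurable_diff) auto
      show "AE x in bm. norm (f x - S x) \<le> norm (\<epsilon> ^ Suc P * D x)"
      proof (rule AE_I2)
        fix x
        have "0 \<le> \<epsilon> ^ Suc P * D x" using D0[of x] \<epsilon> by simp
        then show "norm (f x - S x) \<le> norm (\<epsilon> ^ Suc P * D x)" using pt[of x] by simp
      qed
    qed
    moreover have "(\<integral>x. f x - S x \<partial>bm) = (\<integral>x. f x \<partial>bm) - (\<integral>x. S x \<partial>bm)"
    proof -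
      have "integrable bm (\<lambda>x. (f x - S x) + S x)" using dint Sint by (rule Bochner_Integration.integrable_add)
      then have "integrable bm f" by simp
      then show ?thesis using Sint by (rule Bochner_Integration.integral_diff)
    qed
    moreover have "\<bar>\<integral>x. f x - S x \<partial>bm\<bar> \<le> (\<integral>x. \<epsilon> ^ Suc P * D x \<partial>bm)"
      using dint Dint pt by (intro integral_abs_bound_integral integrable_mult_right) auto
    moreover have "(\<integral>x. S x \<partial>bm) = (\<Sum>j<CARD('n). \<Sum>k<P. \<epsilon> ^ Suc (j + k) / (real (Suc (j + k)) * fact j * fact k) * co j k)"
      unfolding S_def
      by (subst Bochner_Integration.integral_sum, intro Bochner_Integration.integrable_sum integrable_mult_right ac_integrable)
        (auto simp: co_def ac_integrable intro!: sum.cong)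
    ultimately show "\<bar>measure gauss_measure (tube ` (bdry \<times> {0<..\<epsilon>}))
      - (\<Sum>j<CARD('n). \<Sum>k<P. \<epsilon> ^ Suc (j + k) / (real (Suc (j + k)) * fact j * fact k) * co j k)\<bar> \<le> \<epsilon> ^ Suc P * (\<integral>x. D x \<partial>bm)"
      by simp
  qed
qed

lemma tube_formula_expansion:
  "\<exists>C. \<exists>\<epsilon>0>0. \<forall>\<epsilon>. 0 < \<epsilon> \<and> \<epsilon> \<le> \<epsilon>0 \<longrightarrow>
    \<bar>measure gauss_measure (minkowski_sum body (theta_ball \<Theta> \<epsilon>))
      - (M0 F u + (\<Sum>l = 1..n + CARD('n). \<epsilon> ^ l / fact l * Ml \<Theta> F u l))\<bar>
     \<le> \<epsilon> ^ (n + 2) / fact (n + 2) * C"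
proof -
  define N where "N = CARD('n)"
  have N: "1 \<le> N" by (simp add: N_def Suc_leI)
  define P where "P = n + N"
  obtain C where C: "0 \<le> C" "\<And>\<epsilon>. 0 < \<epsilon> \<Longrightarrow> \<epsilon> \<le> 1 \<Longrightarrow>
    \<bar>measure gauss_measure (tube ` (bdry \<times> {0<..\<epsilon>}))
      - (\<Sum>j<N. \<Sum>k<P. \<epsilon> ^ Suc (j + k) / (real (Suc (j + k)) * fact j * fact k) * co j k)\<bar> \<le> \<epsilon> ^ Suc P * C"
    unfolding N_def using shell_measure_expansion[of P] by blast
  define b where "b j k = 1 / (real (Suc (j + k)) * fact j * fact k) * co j k" for j k
  define B where "B = (\<Sum>(j, k)\<in>{..<N} \<times> {..<P}. \<bar>b j k\<bar>)"
  have main: "\<bar>measure gauss_measure (minkowski_sum body (theta_ball \<Theta> \<epsilon>))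
      - (M0 F u + (\<Sum>l = 1..P. \<epsilon> ^ l / fact l * Ml \<Theta> F u l))\<bar>
     \<le> \<epsilon> ^ (n + 2) / fact (n + 2) * (fact (n + 2) * (C + B))" if \<epsilon>: "0 < \<epsilon>" "\<epsilon> \<le> 1" for \<epsilon>
  proof -
    interpret G: finite_measure "gauss_measure :: (real^'n) measure" by (rule finite_gauss_measure)
    define T where "T = tube ` (bdry \<times> {0<..\<epsilon>})"
    have Y: "bdry \<times> {0<..\<epsilon>} \<in> sets borel" "bdry \<times> {0<..\<epsilon>} \<subseteq> bdry \<times> {0<..}" by (auto intro!: borel_Times)
    have T: "T \<in> sets borel" unfolding T_def by (rule tube_measure(1)[OF sigma_finite_bm Y])
    have "measure gauss_measure (minkowski_sum body (theta_ball \<Theta> \<epsilon>)) = measure gauss_measure (body \<union> T)"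
      unfolding T_def body_plus_ball[OF \<epsilon>(1)] ..
    also have "\<dots> = M0 F u + measure gauss_measure T"
      unfolding M0_def using T closed_body tube_disjoint_body[of \<epsilon>]
      by (intro G.finite_measure_Union) (auto simp: gauss_measure_def T_def)
    finally have m1: "measure gauss_measure (minkowski_sum body (theta_ball \<Theta> \<epsilon>)) = M0 F u + measure gauss_measure T" .
    define W where "W j k = \<epsilon> ^ Suc (j + k) * b j k" for j k
    have Wb: "\<epsilon> ^ Suc (j + k) / (real (Suc (j + k)) * fact j * fact k) * co j k = W j k" for j k
      by (simp add: W_def b_def)
    have m2: "\<bar>measure gauss_measure T - (\<Sum>(j, k)\<in>{..<N} \<times> {..<P}. W j k)\<bar> \<le> \<epsilon> ^ Suc P * C"
      using C(2)[OF \<epsilon>] unfolding Wb T_def by (simp add: sum.cartesian_product)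
    have m3: "(\<Sum>l = 1..P. \<epsilon> ^ l / fact l * Ml \<Theta> F u l) = (\<Sum>(m, k) | m + k < P. W m k)"
    proof -
      have "(\<Sum>l = 1..P. \<epsilon> ^ l / fact l * Ml \<Theta> F u l) = (\<Sum>l = 1..P. \<Sum>m = 0..l - 1. W m (l - 1 - m))"
        using Ml_term[of _ \<epsilon>] unfolding Wb by (intro sum.cong refl) auto
      then show ?thesis unfolding sum_binomial_grading .
    qed
    \<comment> \<open>Intersection of triangle and rectangle. The rest of the triangle has
      \<open>m \<ge> N\<close> and vanishes by the convention in \<open>co\<close>; the rest of the
      rectangle goes into the remainder.\<close>
    define A where "A = {(m, k). m + k < P \<and> m < N}"
    have fin: "finite {(m, k). m + k < P}"
      by (rule finite_subset[of _ "{..<P} \<times> {..<P}"]) auto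
    have "(\<Sum>(m, k) | m + k < P. W m k) = (\<Sum>(m, k)\<in>A. W m k)"
    proof (rule sum.mono_neutral_right[OF fin])
      show "\<forall>i\<in>{(m, k). m + k < P} - A. (case i of (m, k) \<Rightarrow> W m k) = 0"
        by (auto simp: A_def W_def b_def co_def N_def split: if_splits)
    qed (auto simp: A_def)
    moreover have AS: "A \<subseteq> {..<N} \<times> {..<P}" by (auto simp: A_def)
    moreover have "(\<Sum>(j, k)\<in>{..<N} \<times> {..<P}. W j k) = (\<Sum>(m, k)\<in>A. W m k) + (\<Sum>(j, k)\<in>{..<N} \<times> {..<P} - A. W j k)"
      using AS by (subst sum.subset_diff[of A]) auto
    moreover have "\<bar>\<Sum>(j, k)\<in>{..<N} \<times> {..<P} - A. W j k\<bar> \<le> \<epsilon> ^ (n + 2) * B"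
    proof -
      have "\<bar>\<Sum>(j, k)\<in>{..<N} \<times> {..<P} - A. W j k\<bar> \<le> (\<Sum>(j, k)\<in>{..<N} \<times> {..<P} - A. \<epsilon> ^ (n + 2) * \<bar>b j k\<bar>)"
      proof (rule order_trans[OF sum_abs sum_mono])
        fix p assume p: "p \<in> {..<N} \<times> {..<P} - A"
        obtain j k where jk: "p = (j, k)" by (cases p)
        \<comment> \<open>Outside the triangle \<open>j + k \<ge> P = n + N\<close>, and
          \<open>N \<ge> 1\<close>.\<close>
        then have "n + 2 \<le> Suc (j + k)" using p N by (auto simp: A_def P_def)
        then have "\<epsilon> ^ Suc (j + k) \<le> \<epsilon> ^ (n + 2)" using \<epsilon> by (intro power_decreasing) auto
        then have "\<epsilon> ^ Suc (j + k) * \<bar>b j k\<bar> \<le> \<epsilon> ^ (n + 2) * \<bar>b j k\<bar>" by (intro mult_right_mono) auto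
        then show "\<bar>case p of (j, k) \<Rightarrow> W j k\<bar> \<le> (case p of (j, k) \<Rightarrow> \<epsilon> ^ (n + 2) * \<bar>b j k\<bar>)"
          using \<epsilon> by (simp add: jk W_def abs_mult)
      qed
      also have "\<dots> \<le> (\<Sum>(j, k)\<in>{..<N} \<times> {..<P}. \<epsilon> ^ (n + 2) * \<bar>b j k\<bar>)"
        using \<epsilon> by (intro sum_mono2) auto
      also have "\<dots> = \<epsilon> ^ (n + 2) * B" unfolding B_def sum_distrib_left by (intro sum.cong) auto
      finally show ?thesis .
    qed
    moreover have "\<epsilon> ^ Suc P * C \<le> \<epsilon> ^ (n + 2) * C"
      using \<epsilon> N C(1) by (intro mult_right_mono power_decreasing) (auto simp: P_def)
    ultimately have "\<bar>measure gauss_measure T - (\<Sum>l = 1..P. \<epsilon> ^ l / fact l * Ml \<Theta> F u l)\<bar> \<le> \<epsilon> ^ (n + 2) * C + \<epsilon> ^ (n + 2) * B"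
      using m2 unfolding m3 by linarith
    also have "\<dots> = \<epsilon> ^ (n + 2) / fact (n + 2) * (fact (n + 2) * (C + B))" by (simp add: distrib_left del: fact_Suc power_Suc fact_2)
    finally show ?thesis unfolding m1 by simp
  qed
  show ?thesis
    unfolding N_def[symmetric] P_def[symmetric]
    \<comment> \<open>The constant carries the factor \<open>fact (n + 2)\<close> to cancel the
      denominator of the claimed bound; up to \<open>\<epsilon> = 1\<close> all higher powers are
      dominated by \<open>\<epsilon> ^ (n + 2)\<close>.\<close>
    by (rule exI[of _ "fact (n + 2) * (C + B)"], rule exI[of _ 1]) (use main in auto)
qed

end

end

theorem mainTheorem4:
  fixes F :: "real^'n \<Rightarrow> real" and u :: real and \<Theta> :: "real^'n^'n" and n :: nat
  assumes smooth: "smooth_fun F"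
    and conv: "convex {y. u \<le> F y}"
    and regular: "\<forall>x \<in> frontier {y. u \<le> F y}. grad F x \<noteq> 0"
    and sym: "transpose \<Theta> = \<Theta>"
    and posdef: "\<forall>v. v \<noteq> 0 \<longrightarrow> v \<bullet> (\<Theta> *v v) > 0"
    and bnd: "\<exists>\<beta>>0. \<forall>j \<in> {1..CARD('n)}.
       set_integrable (hausdorff_measure (CARD('n) - 1)) (frontier {y. u \<le> F y})
         (\<lambda>z. 1 / (1 + norm z powr \<beta>) * Mstar_dens \<Theta> F j z)"
  shows "\<exists>C. \<exists>\<epsilon>0>0. \<forall>\<epsilon>. 0 < \<epsilon> \<and> \<epsilon> \<le> \<epsilon>0 \<longrightarrow>
    \<bar>measure gauss_measure (minkowski_sum {y. u \<le> F y} (theta_ball \<Theta> \<epsilon>))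
      - (M0 F u + (\<Sum>l = 1..n + CARD('n). \<epsilon> ^ l / fact l * Ml \<Theta> F u l))\<bar>
     \<le> \<epsilon> ^ (n + 2) / fact (n + 2) * C"
proof -
  interpret smooth_convex_body F u \<Theta>
    using smooth conv regular sym posdef by (rule smooth_convex_body.intro)
  obtain \<beta> where \<beta>: "0 < \<beta>" "\<And>j. j \<in> {1..CARD('n)} \<Longrightarrow>
       set_integrable (hausdorff_measure (CARD('n) - 1)) (frontier {y. u \<le> F y})
         (\<lambda>z. 1 / (1 + norm z powr \<beta>) * Mstar_dens \<Theta> F j z)"
    using bnd by blast
  show ?thesis by (rule tube_formula_expansion[OF \<beta>])
qed

end
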